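(* Let $X$ be a quasi-Polish space and let $\mathcal M$ be a second-countable metric-étale structure (in some countable, possibly multi-sorted, relational language) over $X$. Then there exist a countable single-sorted (relational) language $\mathcal L$ for continuous logic (not necessarily that of $\mathcal M$) and a full and faithful Borel functor $\mathrm{Iso}_X(\mathcal M)\to\mathrm{Iso}(\mathbb U)\ltimes\mathrm{Mod}_{\mathbb U}(\mathcal L)$.
   Context: Quasi-Polish spaces. Let $\mathbb S=\{0,1\}$ with open sets $\emptyset,\{1\},\{0,1\}$. A set is $\mathbf\Pi^0_2$ if it is of the form $\bigcap_{i\in\mathbb N}(F_i\cup U_i)$ with $F_i$ closed, $U_i$ open. A space is quasi-Polish if it is homeomorphic to a $\mathbf\Pi^0_2$ subspace of $\mathbb S^{\mathbb N}$. Quasi-Polish spaces are standard Borel with respect to their Borel $\sigma$-algebras. Topometric and metric-étale spaces. All metrics have diameter $\le1$. A topometric space is a set $A$ with a topology and a metric $d$ such that the open sets of $A$ are exactly the sets $\{a:V(a)<1\}$ for $V:A\to[0,1]$ upper semicontinuous (for the topology) and $1$-Lipschitz (for $d$); it is complete if $d$ is. For $p:A\to X$, $q:B\to X$: $A_x=p^{-1}(x)$, $A\times_XB=\{(a,b):p(a)=q(b)\}$ with the subspace topology; the empty fiber product is $X$. A metric-étale space over $X$ is a complete topometric space $A$ with a continuous open map $p:A\to X$ such that $d(a,b)=1$ whenever $p(a)\ne p(b)$, and $\{(a,b)\in A\times_XA:d(a,b)<r\}$ is open in $A\times_XA$ for all $r>0$. Metric-étale structures. A metric-étale $\mathcal L_0$-structure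 $\mathcal M$ over $X$, for a multi-sorted relational language $\mathcal L_0$, consists of a metric-étale space $P^{\mathcal M}$ over $X$ for each sort $P$, and for each $(P_0,\dots,P_{n-1})$-ary relation symbol $R$ an upper semicontinuous $R^{\mathcal M}:P_0^{\mathcal M}\times_X\cdots\times_XP_{n-1}^{\mathcal M}\to[0,1]$ which is $1$-Lipschitz for the sum metric (truncated at $1$). The fibers over $x$ form a metric structure $\mathcal M_x$. $\mathcal M$ is second-countable if $\mathcal L_0$ is countable and $X$ and all $P^{\mathcal M}$ are second-countable. Isomorphism groupoid. $\mathrm{Iso}_X(\mathcal M)$ has objects $X$, and morphisms $x\to y$ are triples $(x,y,f)$, $f=(f_P)_P$ an isomorphism $\mathcal M_x\cong\mathcal M_y$ (isometric bijections preserving the value of every relation); its set of morphisms has the topology generated by continuity of source and target together with the sets $\{(x,y,f):f_P(S_x)\cap T_y\ne\emptyset\}$ for sorts $P$ and open $S,T\subseteq P^{\mathcal M}$ ($S_x=S\cap P^{\mathcal M}_x$). For $X$ quasi-Polish and $\mathcal M$ second-countable this is a quasi-Polish groupoid, regarded as a standard Borel groupoid. Urysohn sphere. $\mathbb U$ is the unique-up-to-isometry Polish metric space of diameter $\le1$ such that for every finite $F\subseteq\mathbb U$ and $1$-Lipschitz $u:F\to[0,1]$ with $u(a)+u(b)\ge d(a,b)$ for all $a,b\in F$, there is $z\in\mathbb U$ with $d(z,a)=u(a)$ for all $a\in F$. $\mathrm{Iso}(\mathbb U)$ is its group of isometric bijections with pointwise convergence. For a countable single-sorted relational $\mathcal L$,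 $\mathrm{Mod}_{\mathbb U}(\mathcal L)$ is the Polish space of metric $\mathcal L$-structures on $\mathbb U$, i.e., families of $1$-Lipschitz maps $R^{\mathcal N}:\mathbb U^n\to[0,1]$ for each $n$-ary $R\in\mathcal L$ ($\mathbb U^n$ with the truncated sum metric), with pointwise convergence; $\mathrm{Iso}(\mathbb U)$ acts by $R^{g\cdot\mathcal N}(\vec a)=R^{\mathcal N}(g^{-1}\vec a)$. The action groupoid $\mathrm{Iso}(\mathbb U)\ltimes\mathrm{Mod}_{\mathbb U}(\mathcal L)$ has objects $\mathrm{Mod}_{\mathbb U}(\mathcal L)$ and morphisms $(g,\mathcal N):\mathcal N\to g\cdot\mathcal N$. A Borel functor between standard Borel groupoids is a functor Borel on objects and morphisms; a functor is full (faithful) if it is surjective (injective) on each hom-set. *)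

theory Defs
  imports "HOL-Analysis.Analysis"
begin

section \<open>Quasi-Polish spaces and Borel structure\<close>

definition sierpinski :: "bool topology" where
  "sierpinski = topology (\<lambda>U. U \<in> {{}, {True}, UNIV})"

definition pi02_in :: "'a topology \<Rightarrow> 'a set \<Rightarrow> bool" where
  "pi02_in T S \<longleftrightarrow>
     (\<exists>(F :: nat \<Rightarrow> 'a set) (U :: nat \<Rightarrow> 'a set).
        (\<forall>i. closedin T (F i)) \<and> (\<forall>i. openin T (U i)) \<and> S = (\<Inter>i. F i \<union> U i))"

definition quasi_polish :: "'x topology \<Rightarrow> bool" where
  "quasi_polish X \<longleftrightarrow>
     (\<exists>S. pi02_in (product_topology (\<lambda>_. sierpinski) (UNIV :: nat set)) S \<and>
          X homeomorphic_space
            subtopology (product_topology (\<lambda>_. sierpinski) (UNIV :: nat set)) S)"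

definition borel_of :: "'a topology \<Rightarrow> 'a measure" where
  "borel_of T = sigma (topspace T) {U. openin T U}"

section \<open>Topometric and metric-etale spaces\<close>

definition upper_semicontinuous_map :: "'a topology \<Rightarrow> ('a \<Rightarrow> real) \<Rightarrow> bool" where
  "upper_semicontinuous_map T V \<longleftrightarrow> (\<forall>r. openin T {a \<in> topspace T. V a < r})"

definition diameter_le1 :: "'a metric \<Rightarrow> bool" where
  "diameter_le1 m \<longleftrightarrow> (\<forall>a \<in> mspace m. \<forall>b \<in> mspace m. mdist m a b \<le> 1)"

text \<open>The topology \<open>T\<close> of a topometric space is in general coarser than the topology of its
  metric \<open>m\<close>, so both are carried along.\<close>

definition topometric :: "'a topology \<Rightarrow> 'a metric \<Rightarrow> bool" where
  "topometric T m \<longleftrightarrow>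
     mspace m = topspace T \<and> diameter_le1 m \<and>
     (\<forall>U. openin T U \<longleftrightarrow>
        (\<exists>V :: 'a \<Rightarrow> real.
           V \<in> topspace T \<rightarrow> {0..1} \<and>
           upper_semicontinuous_map T V \<and>
           (\<forall>a \<in> topspace T. \<forall>b \<in> topspace T. \<bar>V a - V b\<bar> \<le> mdist m a b) \<and>
           U = {a \<in> topspace T. V a < 1}))"

record ('x, 'a) space_over =
  tp :: "'a topology"
  met :: "'a metric"
  proj :: "'a \<Rightarrow> 'x"

definition fiber :: "('x, 'a) space_over \<Rightarrow> 'x \<Rightarrow> 'a set" where
  "fiber A x = {a \<in> topspace (tp A). proj A a = x}"

definition metric_etale_space :: "'x topology \<Rightarrow> ('x, 'a) space_over \<Rightarrow> bool" where
  "metric_etale_space X A \<longleftrightarrow>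
     topometric (tp A) (met A) \<and> mcomplete_of (met A) \<and>
     continuous_map (tp A) X (proj A) \<and> open_map (tp A) X (proj A) \<and>
     (\<forall>a \<in> topspace (tp A). \<forall>b \<in> topspace (tp A).
        proj A a \<noteq> proj A b \<longrightarrow> mdist (met A) a b = 1) \<and>
     (\<forall>r > 0. openin (subtopology (prod_topology (tp A) (tp A)) {(a, b). proj A a = proj A b})
        {(a, b). a \<in> topspace (tp A) \<and> b \<in> topspace (tp A) \<and>
                 proj A a = proj A b \<and> mdist (met A) a b < r})"

section \<open>Languages and metric-etale structures\<close>

record ('s, 'r) language =
  sorts :: "'s set"
  rels :: "'r set"
  arity :: "'r \<Rightarrow> 's list"

definition is_language :: "('s, 'r) language \<Rightarrow> bool" where
  "is_language L \<longleftrightarrow> (\<forall>R \<in> rels L. set (arity L R) \<subseteq> sorts L)"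

definition countable_language :: "('s, 'r) language \<Rightarrow> bool" where
  "countable_language L \<longleftrightarrow> countable (sorts L) \<and> countable (rels L)"

text \<open>An element of the fiber product of \<open>A\<^sub>0, \<dots>, A\<^sub>n\<^sub>-\<^sub>1\<close> over \<open>X\<close> is a pair
  \<open>(x, a)\<close> of a base point \<open>x\<close> and an \<open>n\<close>-tuple \<open>a\<close> (a function on \<open>{..<n}\<close>, extended by
  \<open>undefined\<close>) in the fiber over \<open>x\<close>. For \<open>n > 0\<close> the base point is redundant, and the space is
  the subspace of the product of the \<open>A\<^sub>i\<close> by \<open>fprod_topology_homeomorphic\<close> below; for \<open>n = 0\<close> it
  is a copy of \<open>X\<close>.\<close>

definition fprod :: "'x topology \<Rightarrow> ('x, 'a) space_over list \<Rightarrow> ('x \<times> (nat \<Rightarrow> 'a)) set" where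
  "fprod X As = {(x, a). x \<in> topspace X \<and> a \<in> (\<Pi>\<^sub>E i \<in> {..<length As}. fiber (As ! i) x)}"

definition fprod_topology ::
    "'x topology \<Rightarrow> ('x, 'a) space_over list \<Rightarrow> ('x \<times> (nat \<Rightarrow> 'a)) topology" where
  "fprod_topology X As =
     subtopology (prod_topology X (product_topology (\<lambda>i. tp (As ! i)) {..<length As}))
       (fprod X As)"

text \<open>The sum metric truncated at 1. Points of a fiber product over different base points are at
  distance 1; when there is at least one factor this already follows from the truncated sum (see
  \<open>fprod_dist_eq_truncated_sum\<close>), and
  for no factors it is the metric making the identity map of \<open>X\<close> a metric-etale space.\<close>

definition fprod_dist ::
    "('x, 'a) space_over list \<Rightarrow> 'x \<times> (nat \<Rightarrow> 'a) \<Rightarrow> 'x \<times> (nat \<Rightarrow> 'a) \<Rightarrow> real" where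
  "fprod_dist As = (\<lambda>(x, a) (y, b).
     if x = y then min 1 (\<Sum>i<length As. mdist (met (As ! i)) (a i) (b i)) else 1)"

record ('s, 'r, 'x, 'a) etale_structure =
  srt :: "'s \<Rightarrow> ('x, 'a) space_over"
  rel :: "'r \<Rightarrow> 'x \<times> (nat \<Rightarrow> 'a) \<Rightarrow> real"

definition arity_spaces ::
    "('s, 'r) language \<Rightarrow> ('s, 'r, 'x, 'a) etale_structure \<Rightarrow> 'r \<Rightarrow> ('x, 'a) space_over list" where
  "arity_spaces L M R = map (srt M) (arity L R)"

definition metric_etale_structure ::
    "('s, 'r) language \<Rightarrow> 'x topology \<Rightarrow> ('s, 'r, 'x, 'a) etale_structure \<Rightarrow> bool" where
  "metric_etale_structure L X M \<longleftrightarrow>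
     is_language L \<and>
     (\<forall>P \<in> sorts L. metric_etale_space X (srt M P)) \<and>
     (\<forall>R \<in> rels L. let As = arity_spaces L M R in
        rel M R \<in> fprod X As \<rightarrow> {0..1} \<and>
        upper_semicontinuous_map (fprod_topology X As) (rel M R) \<and>
        (\<forall>u \<in> fprod X As. \<forall>v \<in> fprod X As. \<bar>rel M R u - rel M R v\<bar> \<le> fprod_dist As u v))"

definition second_countable_structure ::
    "('s, 'r) language \<Rightarrow> 'x topology \<Rightarrow> ('s, 'r, 'x, 'a) etale_structure \<Rightarrow> bool" where
  "second_countable_structure L X M \<longleftrightarrow>
     countable_language L \<and> second_countable X \<and>
     (\<forall>P \<in> sorts L. second_countable (tp (srt M P)))"

section \<open>Borel groupoids and functors\<close>

text \<open>A groupoid with Borel structures on its objects and morphisms; the sets of objects and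
  morphisms are the underlying sets of the measurable spaces \<open>ob\<close> and \<open>mor\<close> (measures themselves
  are irrelevant). \<open>cmp G g f\<close> is the composite of \<open>f\<close> followed by \<open>g\<close>.\<close>

record ('o, 'm) borel_groupoid =
  ob :: "'o measure"
  mor :: "'m measure"
  src :: "'m \<Rightarrow> 'o"
  tgt :: "'m \<Rightarrow> 'o"
  idt :: "'o \<Rightarrow> 'm"
  cmp :: "'m \<Rightarrow> 'm \<Rightarrow> 'm"
  ivs :: "'m \<Rightarrow> 'm"

definition hom_set :: "('o, 'm) borel_groupoid \<Rightarrow> 'o \<Rightarrow> 'o \<Rightarrow> 'm set" where
  "hom_set G x y = {f \<in> space (mor G). src G f = x \<and> tgt G f = y}"

definition groupoid_laws :: "('o, 'm) borel_groupoid \<Rightarrow> bool" where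
  "groupoid_laws G \<longleftrightarrow>
     src G \<in> space (mor G) \<rightarrow> space (ob G) \<and> tgt G \<in> space (mor G) \<rightarrow> space (ob G) \<and>
     (\<forall>x \<in> space (ob G). idt G x \<in> hom_set G x x) \<and>
     (\<forall>x y z. \<forall>f \<in> hom_set G x y. \<forall>g \<in> hom_set G y z. cmp G g f \<in> hom_set G x z) \<and>
     (\<forall>x y. \<forall>f \<in> hom_set G x y. cmp G f (idt G x) = f \<and> cmp G (idt G y) f = f) \<and>
     (\<forall>w x y z. \<forall>f \<in> hom_set G w x. \<forall>g \<in> hom_set G x y. \<forall>h \<in> hom_set G y z.
        cmp G h (cmp G g f) = cmp G (cmp G h g) f) \<and>
     (\<forall>x y. \<forall>f \<in> hom_set G x y. ivs G f \<in> hom_set G y x \<and>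
        cmp G (ivs G f) f = idt G x \<and> cmp G f (ivs G f) = idt G y)"

definition is_functor ::
    "('o, 'm) borel_groupoid \<Rightarrow> ('p, 'n) borel_groupoid \<Rightarrow> ('o \<Rightarrow> 'p) \<Rightarrow> ('m \<Rightarrow> 'n) \<Rightarrow> bool" where
  "is_functor G H F0 F1 \<longleftrightarrow>
     F0 \<in> space (ob G) \<rightarrow> space (ob H) \<and> F1 \<in> space (mor G) \<rightarrow> space (mor H) \<and>
     (\<forall>f \<in> space (mor G). src H (F1 f) = F0 (src G f) \<and> tgt H (F1 f) = F0 (tgt G f)) \<and>
     (\<forall>x \<in> space (ob G). F1 (idt G x) = idt H (F0 x)) \<and>
     (\<forall>f \<in> space (mor G). \<forall>g \<in> space (mor G).
        src G g = tgt G f \<longrightarrow> F1 (cmp G g f) = cmp H (F1 g) (F1 f))"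

definition borel_functor ::
    "('o, 'm) borel_groupoid \<Rightarrow> ('p, 'n) borel_groupoid \<Rightarrow> ('o \<Rightarrow> 'p) \<Rightarrow> ('m \<Rightarrow> 'n) \<Rightarrow> bool" where
  "borel_functor G H F0 F1 \<longleftrightarrow>
     is_functor G H F0 F1 \<and> F0 \<in> measurable (ob G) (ob H) \<and> F1 \<in> measurable (mor G) (mor H)"

definition full_functor ::
    "('o, 'm) borel_groupoid \<Rightarrow> ('p, 'n) borel_groupoid \<Rightarrow> ('o \<Rightarrow> 'p) \<Rightarrow> ('m \<Rightarrow> 'n) \<Rightarrow> bool" where
  "full_functor G H F0 F1 \<longleftrightarrow>
     (\<forall>x \<in> space (ob G). \<forall>y \<in> space (ob G). F1 ` hom_set G x y = hom_set H (F0 x) (F0 y))"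

definition faithful_functor ::
    "('o, 'm) borel_groupoid \<Rightarrow> ('p, 'n) borel_groupoid \<Rightarrow> ('o \<Rightarrow> 'p) \<Rightarrow> ('m \<Rightarrow> 'n) \<Rightarrow> bool" where
  "faithful_functor G H F0 F1 \<longleftrightarrow>
     (\<forall>x \<in> space (ob G). \<forall>y \<in> space (ob G). inj_on F1 (hom_set G x y))"

section \<open>The isomorphism groupoid of a metric-etale structure\<close>

text \<open>Maps are extended by \<open>undefined\<close> outside their domains, so that equality of morphisms is
  equality of the maps on the fibers.\<close>

definition fiber_isomorphisms ::
    "('s, 'r) language \<Rightarrow> ('s, 'r, 'x, 'a) etale_structure \<Rightarrow> 'x \<Rightarrow> 'x \<Rightarrow> ('s \<Rightarrow> 'a \<Rightarrow> 'a) set" where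
  "fiber_isomorphisms L M x y =
     {f \<in> (\<Pi>\<^sub>E P \<in> sorts L. fiber (srt M P) x \<rightarrow>\<^sub>E fiber (srt M P) y).
        (\<forall>P \<in> sorts L. bij_betw (f P) (fiber (srt M P) x) (fiber (srt M P) y) \<and>
           (\<forall>a \<in> fiber (srt M P) x. \<forall>b \<in> fiber (srt M P) x.
              mdist (met (srt M P)) (f P a) (f P b) = mdist (met (srt M P)) a b)) \<and>
        (\<forall>R \<in> rels L. \<forall>a \<in> (\<Pi>\<^sub>E i \<in> {..<length (arity L R)}. fiber (srt M (arity L R ! i)) x).
           rel M R (y, \<lambda>i \<in> {..<length (arity L R)}. f (arity L R ! i) (a i)) = rel M R (x, a))}"

definition iso_morphisms ::
    "('s, 'r) language \<Rightarrow> 'x topology \<Rightarrow> ('s, 'r, 'x, 'a) etale_structure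
      \<Rightarrow> ('x \<times> 'x \<times> ('s \<Rightarrow> 'a \<Rightarrow> 'a)) set" where
  "iso_morphisms L X M =
     {(x, y, f). x \<in> topspace X \<and> y \<in> topspace X \<and> f \<in> fiber_isomorphisms L M x y}"

definition iso_morphism_topology ::
    "('s, 'r) language \<Rightarrow> 'x topology \<Rightarrow> ('s, 'r, 'x, 'a) etale_structure
      \<Rightarrow> ('x \<times> 'x \<times> ('s \<Rightarrow> 'a \<Rightarrow> 'a)) topology" where
  "iso_morphism_topology L X M = topology_generated_by
     ({{(x, y, f) \<in> iso_morphisms L X M. x \<in> U} | U. openin X U} \<union>
      {{(x, y, f) \<in> iso_morphisms L X M. y \<in> U} | U. openin X U} \<union>
      {{(x, y, f) \<in> iso_morphisms L X M.
          f P ` (S \<inter> fiber (srt M P) x) \<inter> (T \<inter> fiber (srt M P) y) \<noteq> {}} | P S T.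
        P \<in> sorts L \<and> openin (tp (srt M P)) S \<and> openin (tp (srt M P)) T})"

definition iso_groupoid ::
    "('s, 'r) language \<Rightarrow> 'x topology \<Rightarrow> ('s, 'r, 'x, 'a) etale_structure
      \<Rightarrow> ('x, 'x \<times> 'x \<times> ('s \<Rightarrow> 'a \<Rightarrow> 'a)) borel_groupoid" where
  "iso_groupoid L X M = \<lparr>
     ob = borel_of X,
     mor = borel_of (iso_morphism_topology L X M),
     src = (\<lambda>(x, y, f). x),
     tgt = (\<lambda>(x, y, f). y),
     idt = (\<lambda>x. (x, x, \<lambda>P \<in> sorts L. \<lambda>a \<in> fiber (srt M P) x. a)),
     cmp = (\<lambda>(y', z, g) (x, y, f). (x, z, \<lambda>P \<in> sorts L. compose (fiber (srt M P) x) (g P) (f P))),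
     ivs = (\<lambda>(x, y, f). (y, x, \<lambda>P \<in> sorts L. \<lambda>b \<in> fiber (srt M P) y.
              inv_into (fiber (srt M P) x) (f P) b)) \<rparr>"

section \<open>The Urysohn sphere\<close>

definition urysohn_sphere :: "'u metric \<Rightarrow> bool" where
  "urysohn_sphere \<U> \<longleftrightarrow>
     mcomplete_of \<U> \<and> separable_space (mtopology_of \<U>) \<and> diameter_le1 \<U> \<and>
     (\<forall>F (u :: 'u \<Rightarrow> real).
        finite F \<and> F \<subseteq> mspace \<U> \<and> u \<in> F \<rightarrow> {0..1} \<and>
        (\<forall>a \<in> F. \<forall>b \<in> F. \<bar>u a - u b\<bar> \<le> mdist \<U> a b) \<and>
        (\<forall>a \<in> F. \<forall>b \<in> F. mdist \<U> a b \<le> u a + u b) \<longrightarrow>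
        (\<exists>z \<in> mspace \<U>. \<forall>a \<in> F. mdist \<U> z a = u a))"

definition isometry_group :: "'u metric \<Rightarrow> ('u \<Rightarrow> 'u) set" where
  "isometry_group \<U> =
     {g \<in> mspace \<U> \<rightarrow>\<^sub>E mspace \<U>. bij_betw g (mspace \<U>) (mspace \<U>) \<and>
        (\<forall>a \<in> mspace \<U>. \<forall>b \<in> mspace \<U>. mdist \<U> (g a) (g b) = mdist \<U> a b)}"

definition isometry_group_topology :: "'u metric \<Rightarrow> ('u \<Rightarrow> 'u) topology" where
  "isometry_group_topology \<U> =
     subtopology (product_topology (\<lambda>_. mtopology_of \<U>) (mspace \<U>)) (isometry_group \<U>)"

section \<open>Metric structures on a fixed metric space, and the logic action\<close>

definition single_sorted :: "(unit, 'r) language \<Rightarrow> bool" where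
  "single_sorted L \<longleftrightarrow> sorts L = {()}"

definition tuples :: "'u metric \<Rightarrow> nat \<Rightarrow> (nat \<Rightarrow> 'u) set" where
  "tuples \<U> n = {..<n} \<rightarrow>\<^sub>E mspace \<U>"

definition Mod :: "'u metric \<Rightarrow> (unit, 'r) language \<Rightarrow> ('r \<Rightarrow> (nat \<Rightarrow> 'u) \<Rightarrow> real) set" where
  "Mod \<U> L =
     {N \<in> (\<Pi>\<^sub>E R \<in> rels L. tuples \<U> (length (arity L R)) \<rightarrow>\<^sub>E {0..1}).
        \<forall>R \<in> rels L. \<forall>a \<in> tuples \<U> (length (arity L R)). \<forall>b \<in> tuples \<U> (length (arity L R)).
          \<bar>N R a - N R b\<bar> \<le> min 1 (\<Sum>i<length (arity L R). mdist \<U> (a i) (b i))}"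

definition Mod_topology ::
    "'u metric \<Rightarrow> (unit, 'r) language \<Rightarrow> ('r \<Rightarrow> (nat \<Rightarrow> 'u) \<Rightarrow> real) topology" where
  "Mod_topology \<U> L =
     subtopology
       (product_topology
          (\<lambda>R. product_topology (\<lambda>_. euclideanreal) (tuples \<U> (length (arity L R)))) (rels L))
       (Mod \<U> L)"

definition logic_action ::
    "'u metric \<Rightarrow> (unit, 'r) language \<Rightarrow> ('u \<Rightarrow> 'u)
      \<Rightarrow> ('r \<Rightarrow> (nat \<Rightarrow> 'u) \<Rightarrow> real) \<Rightarrow> ('r \<Rightarrow> (nat \<Rightarrow> 'u) \<Rightarrow> real)" where
  "logic_action \<U> L g N =
     (\<lambda>R \<in> rels L. \<lambda>a \<in> tuples \<U> (length (arity L R)).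
        N R (\<lambda>i \<in> {..<length (arity L R)}. inv_into (mspace \<U>) g (a i)))"

definition action_groupoid ::
    "'u metric \<Rightarrow> (unit, 'r) language
      \<Rightarrow> ('r \<Rightarrow> (nat \<Rightarrow> 'u) \<Rightarrow> real, ('u \<Rightarrow> 'u) \<times> ('r \<Rightarrow> (nat \<Rightarrow> 'u) \<Rightarrow> real)) borel_groupoid" where
  "action_groupoid \<U> L = \<lparr>
     ob = borel_of (Mod_topology \<U> L),
     mor = borel_of (prod_topology (isometry_group_topology \<U>) (Mod_topology \<U> L)),
     src = (\<lambda>(g, N). N),
     tgt = (\<lambda>(g, N). logic_action \<U> L g N),
     idt = (\<lambda>N. (\<lambda>a \<in> mspace \<U>. a, N)),
     cmp = (\<lambda>(h, N') (g, N). (compose (mspace \<U>) h g, N)),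
     ivs = (\<lambda>(g, N). (\<lambda>a \<in> mspace \<U>. inv_into (mspace \<U>) g a, logic_action \<U> L g N)) \<rparr>"

section \<open>Consistency of the encodings\<close>


lemma openin_sierpinski: "openin sierpinski U \<longleftrightarrow> U \<in> {{}, {True}, UNIV}"
proof -
  have "istopology (\<lambda>U :: bool set. U \<in> {{}, {True}, UNIV})"
    unfolding istopology_def
  proof (intro conjI allI impI)
    fix K :: "bool set set"
    assume K: "\<forall>S\<in>K. S \<in> {{}, {True}, UNIV}"
    show "\<Union> K \<in> {{}, {True}, UNIV}"
    proof (cases "UNIV \<in> K")
      case False
      with K have "\<Union> K \<subseteq> {True}" by blast
      then show ?thesis by auto
    qed auto
  qed auto
  then show ?thesis unfolding sierpinski_def by (subst topology_inverse') (assumption, rule refl)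
qed

lemma topspace_iso_morphism_topology [simp]:
  "topspace (iso_morphism_topology L X M) = iso_morphisms L X M"
proof -
  have *: "\<Union> (A \<union> B \<union> C) = m" if "m \<in> A" "\<forall>S\<in>A. S \<subseteq> m" "\<forall>S\<in>B. S \<subseteq> m" "\<forall>S\<in>C. S \<subseteq> m"
    for m :: "'z set" and A B C
    using that by blast
  show ?thesis
    unfolding iso_morphism_topology_def topology_generated_by_topspace
  proof (rule *)
    have "iso_morphisms L X M = {(x, y, f) \<in> iso_morphisms L X M. x \<in> topspace X}"
      by (auto simp: iso_morphisms_def)
    then show "iso_morphisms L X M \<in> {{(x, y, f) \<in> iso_morphisms L X M. x \<in> U} | U. openin X U}"
      using openin_topspace[of X] by blast
  qed (intro ballI, elim CollectE exE conjE, simp, rule subsetI, simp add: case_prod_beta)+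
qed

lemma space_borel_of [simp]: "space (borel_of T) = topspace T"
  unfolding borel_of_def by (rule space_measure_of) (auto dest: openin_subset)

lemma topspace_isometry_group_topology [simp]:
  "topspace (isometry_group_topology U) = isometry_group U"
  by (auto simp: isometry_group_topology_def isometry_group_def)

lemma topspace_Mod_topology [simp]: "topspace (Mod_topology U L) = Mod U L"
  by (auto simp: Mod_topology_def Mod_def PiE_iff extensional_def)

lemma topspace_fprod_topology [simp]: "topspace (fprod_topology X As) = fprod X As"
  by (auto simp: fprod_topology_def fprod_def fiber_def PiE_iff extensional_def)

lemma fprod_topology_homeomorphic:
  assumes "As \<noteq> []" and cont: "\<And>A. A \<in> set As \<Longrightarrow> continuous_map (tp A) X (proj A)"
  shows "homeomorphic_map (fprod_topology X As)
     (subtopology (product_topology (\<lambda>i. tp (As ! i)) {..<length As})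
        {a. \<forall>i<length As. \<forall>j<length As. proj (As ! i) (a i) = proj (As ! j) (a j)}) snd"
    (is "homeomorphic_map ?F (subtopology ?P ?S) snd")
proof -
  have 0: "0 < length As" using assms by simp
  let ?g = "\<lambda>a. (proj (As ! 0) (a 0), a)"
  have c1: "continuous_map ?F (subtopology ?P ?S) snd"
    unfolding continuous_map_in_subtopology
  proof
    show "continuous_map ?F ?P snd"
      unfolding fprod_topology_def by (rule continuous_map_from_subtopology[OF continuous_map_snd])
    show "snd \<in> topspace ?F \<rightarrow> ?S"
      unfolding topspace_fprod_topology by (auto simp: fprod_def fiber_def PiE_iff)
  qed
  have c0: "continuous_map ?P X (\<lambda>a. proj (As ! 0) (a 0))"
    using continuous_map_compose[OF continuous_map_product_projection[of 0 "{..<length As}" "\<lambda>i. tp (As ! i)"],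
      of X "proj (As ! 0)"] cont[of "As ! 0"] 0 by (simp add: o_def)
  then have c0': "a \<in> topspace ?P \<Longrightarrow> proj (As ! 0) (a 0) \<in> topspace X" for a
    using continuous_map_funspace by blast
  have im: "?g a \<in> fprod X As" if "a \<in> topspace (subtopology ?P ?S)" for a
  proof -
    have aS: "a \<in> ?S" and a2: "a \<in> topspace ?P" using that unfolding topspace_subtopology by blast+
    have a1: "a \<in> (\<Pi>\<^sub>E i\<in>{..<length As}. topspace (tp (As ! i)))" using a2 by simp
    have eq: "proj (As ! i) (a i) = proj (As ! 0) (a 0)" if "i < length As" for i
      using aS that 0 by blast
    have "a i \<in> fiber (As ! i) (proj (As ! 0) (a 0))" if "i < length As" for i
      using a1 eq[OF that] that by (simp add: fiber_def PiE_iff)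
    then show ?thesis using a1 c0'[OF a2] by (simp add: fprod_def PiE_iff)
  qed
  have c2: "continuous_map (subtopology ?P ?S) ?F ?g"
    unfolding fprod_topology_def continuous_map_in_subtopology
  proof
    show "?g \<in> topspace (subtopology ?P ?S) \<rightarrow> fprod X As" using im by blast
    show "continuous_map (subtopology ?P ?S) (prod_topology X ?P) ?g"
      unfolding continuous_map_pairwise o_def fst_conv snd_conv
      by (intro conjI continuous_map_from_subtopology c0) simp
  qed
  have "?g (snd u) = u" if "u \<in> topspace ?F" for u
    using that 0 by (auto simp: fprod_def fiber_def PiE_iff)
  then have "homeomorphic_maps ?F (subtopology ?P ?S) snd ?g"
    unfolding homeomorphic_maps_def using c1 c2 by simp
  then show ?thesis using homeomorphic_maps_map by blast
qed

lemma fprod_dist_eq_truncated_sum: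
  assumes "As \<noteq> []" and "\<And>A. A \<in> set As \<Longrightarrow> metric_etale_space X A"
    and u: "(x, a) \<in> fprod X As" and v: "(y, b) \<in> fprod X As"
  shows "fprod_dist As (x, a) (y, b) =
     min 1 (\<Sum>i<length As. mdist (met (As ! i)) (a i) (b i))"
proof (cases "x = y")
  case False
  have 0: "0 < length As" using assms by simp
  then have "metric_etale_space X (As ! 0)" using assms by simp
  moreover have "a 0 \<in> fiber (As ! 0) x" "b 0 \<in> fiber (As ! 0) y"
    using u v 0 by (auto simp: fprod_def PiE_iff)
  ultimately have "mdist (met (As ! 0)) (a 0) (b 0) = 1"
    using False by (auto simp: metric_etale_space_def fiber_def)
  moreover have "mdist (met (As ! 0)) (a 0) (b 0) \<le> (\<Sum>i<length As. mdist (met (As ! i)) (a i) (b i))"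
    using 0 by (intro member_le_sum) auto
  ultimately show ?thesis using False by (simp add: fprod_dist_def)
qed (simp add: fprod_dist_def)


lemma isometry_group_inverse:
  assumes "g \<in> isometry_group U"
  shows "(\<lambda>a \<in> mspace U. inv_into (mspace U) g a) \<in> isometry_group U"
proof -
  let ?S = "mspace U"
  have b: "bij_betw g ?S ?S" and d: "\<And>a b. a \<in> ?S \<Longrightarrow> b \<in> ?S \<Longrightarrow> mdist U (g a) (g b) = mdist U a b"
    using assms by (auto simp: isometry_group_def)
  have bi: "bij_betw (inv_into ?S g) ?S ?S" by (rule bij_betw_inv_into[OF b])
  then have bi': "bij_betw (\<lambda>a\<in>?S. inv_into ?S g a) ?S ?S"
    by (simp add: bij_betw_cong[of ?S "\<lambda>a\<in>?S. inv_into ?S g a" "inv_into ?S g"])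
  have m: "a \<in> ?S \<Longrightarrow> inv_into ?S g a \<in> ?S" for a using bi by (auto simp: bij_betw_def)
  have "mdist U (inv_into ?S g a) (inv_into ?S g c) = mdist U a c" if "a \<in> ?S" "c \<in> ?S" for a c
    using d[OF m m, OF that] that b by (simp add: bij_betw_inv_into_right)
  then show ?thesis using bi' m by (auto simp: isometry_group_def)
qed

lemma logic_action_in_Mod:
  assumes g: "g \<in> isometry_group U" and N: "N \<in> Mod U L"
  shows "logic_action U L g N \<in> Mod U L"
proof -
  let ?S = "mspace U" and ?i = "inv_into (mspace U) g"
  have h: "(\<lambda>a \<in> ?S. ?i a) \<in> isometry_group U" using isometry_group_inverse[OF g] .
  have m: "a \<in> ?S \<Longrightarrow> ?i a \<in> ?S" for a using h by (force simp: isometry_group_def PiE_iff)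
  have d: "a \<in> ?S \<Longrightarrow> b \<in> ?S \<Longrightarrow> mdist U (?i a) (?i b) = mdist U a b" for a b
    using h by (force simp: isometry_group_def)
  have t: "a \<in> tuples U n \<Longrightarrow> (\<lambda>i\<in>{..<n}. ?i (a i)) \<in> tuples U n" for a n
    using m by (auto simp: tuples_def)
  have s: "(\<Sum>i<n. mdist U ((\<lambda>i\<in>{..<n}. ?i (a i)) i) ((\<lambda>i\<in>{..<n}. ?i (b i)) i)) = (\<Sum>i<n. mdist U (a i) (b i))"
    if "a \<in> tuples U n" "b \<in> tuples U n" for a b n
    using that by (intro sum.cong) (auto simp: tuples_def PiE_iff d)
  have r: "N R a \<in> {0..1}" if "R \<in> rels L" "a \<in> tuples U (length (arity L R))" for R a
    using N that unfolding Mod_def by blast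
  have l: "\<bar>N R a - N R b\<bar> \<le> min 1 (\<Sum>i<length (arity L R). mdist U (a i) (b i))"
    if "R \<in> rels L" "a \<in> tuples U (length (arity L R))" "b \<in> tuples U (length (arity L R))" for R a b
    using N that unfolding Mod_def by blast
  have A: "logic_action U L g N \<in> (\<Pi>\<^sub>E R \<in> rels L. tuples U (length (arity L R)) \<rightarrow>\<^sub>E {0..1})"
    unfolding logic_action_def using r t by (simp add: PiE_iff Pi_iff)
  show ?thesis unfolding Mod_def
  proof (intro CollectI conjI A ballI)
    fix R a b assume R: "R \<in> rels L" and a: "a \<in> tuples U (length (arity L R))" and b: "b \<in> tuples U (length (arity L R))"
    show "\<bar>logic_action U L g N R a - logic_action U L g N R b\<bar> \<le> min 1 (\<Sum>i<length (arity L R). mdist U (a i) (b i))"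
      using l[OF R t[OF a] t[OF b]] s[OF a b] R a b by (simp add: logic_action_def)
  qed
qed

lemma isometry_group_compose:
  assumes "g \<in> isometry_group U" "h \<in> isometry_group U"
  shows "compose (mspace U) h g \<in> isometry_group U"
  using assms unfolding isometry_group_def
  by (auto simp: bij_betw_compose compose_eq PiE_iff Pi_iff)

lemma inv_into_compose_isometries:
  assumes g: "g \<in> isometry_group U" and h: "h \<in> isometry_group U" and a: "a \<in> mspace U"
  shows "inv_into (mspace U) (compose (mspace U) h g) a = inv_into (mspace U) g (inv_into (mspace U) h a)"
proof -
  let ?S = "mspace U"
  have b: "bij_betw g ?S ?S" "bij_betw h ?S ?S" using g h by (auto simp: isometry_group_def)
  have 1: "inv_into ?S h a \<in> ?S" "inv_into ?S g (inv_into ?S h a) \<in> ?S"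
    using b a by (metis bij_betw_imp_surj_on inv_into_into)+
  then have "compose ?S h g (inv_into ?S g (inv_into ?S h a)) = a"
    using b a by (simp add: compose_eq bij_betw_inv_into_right)
  moreover have "inj_on (compose ?S h g) ?S"
    using isometry_group_compose[OF g h] by (auto simp: isometry_group_def bij_betw_def)
  ultimately show ?thesis using 1 by (metis inv_into_f_eq)
qed

lemma logic_action_compose:
  assumes g: "g \<in> isometry_group U" and h: "h \<in> isometry_group U"
  shows "logic_action U L (compose (mspace U) h g) N = logic_action U L h (logic_action U L g N)"
proof -
  let ?S = "mspace U"
  have m: "a \<in> ?S \<Longrightarrow> inv_into ?S h a \<in> ?S" for a
    using isometry_group_inverse[OF h] by (force simp: isometry_group_def PiE_iff)
  have "(\<lambda>i\<in>{..<n}. inv_into ?S (compose ?S h g) (a i)) =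
        (\<lambda>i\<in>{..<n}. inv_into ?S g ((\<lambda>i\<in>{..<n}. inv_into ?S h (a i)) i))"
    "(\<lambda>i\<in>{..<n}. inv_into ?S h (a i)) \<in> tuples U n" if "a \<in> tuples U n" for a n
    using that m by (auto simp: tuples_def PiE_iff inv_into_compose_isometries[OF g h] intro!: restrict_ext)
  then show ?thesis
    unfolding logic_action_def by (intro restrict_ext) (simp cong: restrict_cong)
qed

lemma isometry_group_id: "(\<lambda>a \<in> mspace U. a) \<in> isometry_group U"
  by (auto simp: isometry_group_def bij_betw_def inj_on_def)

lemma logic_action_id:
  assumes N: "N \<in> Mod U L"
  shows "logic_action U L (\<lambda>a \<in> mspace U. a) N = N"
proof -
  have "inv_into (mspace U) (\<lambda>a \<in> mspace U. a) a = a" if "a \<in> mspace U" for a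
    using that by (intro inv_into_f_eq) (auto simp: inj_on_def)
  then have 1: "a \<in> tuples U n \<Longrightarrow> (\<lambda>i\<in>{..<n}. inv_into (mspace U) (\<lambda>a \<in> mspace U. a) (a i)) = a" for a n
    by (auto simp: tuples_def PiE_iff extensional_def fun_eq_iff)
  have e: "N \<in> extensional (rels L)" "\<And>R. R \<in> rels L \<Longrightarrow> N R \<in> extensional (tuples U (length (arity L R)))"
    using N by (auto simp: Mod_def PiE_iff)
  show ?thesis
    unfolding logic_action_def
    by (rule extensionalityI[OF restrict_extensional e(1)])
       (auto intro!: extensionalityI[OF restrict_extensional e(2)] simp: 1)
qed

lemma isometry_group_inv_compose:
  assumes g: "g \<in> isometry_group U"
  shows "compose (mspace U) (\<lambda>a \<in> mspace U. inv_into (mspace U) g a) g = (\<lambda>a \<in> mspace U. a)"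
    and "compose (mspace U) g (\<lambda>a \<in> mspace U. inv_into (mspace U) g a) = (\<lambda>a \<in> mspace U. a)"
proof -
  have "bij_betw g (mspace U) (mspace U)" using g by (auto simp: isometry_group_def)
  then show "compose (mspace U) (\<lambda>a \<in> mspace U. inv_into (mspace U) g a) g = (\<lambda>a \<in> mspace U. a)"
    "compose (mspace U) g (\<lambda>a \<in> mspace U. inv_into (mspace U) g a) = (\<lambda>a \<in> mspace U. a)"
    using bij_betwE by (fastforce simp: compose_def fun_eq_iff bij_betw_inv_into_left bij_betw_inv_into_right)+
qed

lemma isometry_group_compose_id:
  assumes g: "g \<in> isometry_group U"
  shows "compose (mspace U) (\<lambda>a \<in> mspace U. a) g = g" "compose (mspace U) g (\<lambda>a \<in> mspace U. a) = g"
  using g by (auto simp: isometry_group_def compose_def fun_eq_iff PiE_iff extensional_def)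

theorem groupoid_laws_action_groupoid: "groupoid_laws (action_groupoid U L)"
proof -
  have assoc: "compose (mspace U) h (compose (mspace U) g f) = compose (mspace U) (compose (mspace U) h g) f"
    if "f \<in> isometry_group U" for f g h
    using that by (auto simp: isometry_group_def compose_def fun_eq_iff PiE_iff)
  have inv: "logic_action U L (\<lambda>a \<in> mspace U. inv_into (mspace U) g a) (logic_action U L g N) = N"
    if "g \<in> isometry_group U" "N \<in> Mod U L" for g N
    using logic_action_compose[OF that(1) isometry_group_inverse[OF that(1)], of L N]
      isometry_group_inv_compose(1)[OF that(1)] logic_action_id[OF that(2)] by simp
  show ?thesis
    unfolding groupoid_laws_def hom_set_def
    by (auto simp: action_groupoid_def logic_action_in_Mod isometry_group_compose logic_action_compose
        isometry_group_id logic_action_id isometry_group_inverse isometry_group_inv_compose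
        isometry_group_compose_id assoc inv simp del: restrict_apply)
qed

lemma fiber_isomorphisms_id:
  assumes "is_language L"
  shows "(\<lambda>P \<in> sorts L. \<lambda>a \<in> fiber (srt M P) x. a) \<in> fiber_isomorphisms L M x x"
proof -
  have "R \<in> rels L \<Longrightarrow> i < length (arity L R) \<Longrightarrow> arity L R ! i \<in> sorts L" for R i
    using assms nth_mem by (fastforce simp: is_language_def)
  then have "(\<lambda>i \<in> {..<length (arity L R)}. (\<lambda>P \<in> sorts L. \<lambda>a \<in> fiber (srt M P) x. a) (arity L R ! i) (a i)) = a"
    if "R \<in> rels L" "a \<in> (\<Pi>\<^sub>E i \<in> {..<length (arity L R)}. fiber (srt M (arity L R ! i)) x)" for R a
    using that by (auto simp: fun_eq_iff PiE_iff extensional_def)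
  then show ?thesis
    by (auto simp: fiber_isomorphisms_def bij_betw_def inj_on_def)
qed

lemma fiber_isomorphisms_compose:
  assumes L: "is_language L" and f: "f \<in> fiber_isomorphisms L M x y" and g: "g \<in> fiber_isomorphisms L M y z"
  shows "(\<lambda>P \<in> sorts L. compose (fiber (srt M P) x) (g P) (f P)) \<in> fiber_isomorphisms L M x z"
    (is "?h \<in> _")
proof -
  have ar: "R \<in> rels L \<Longrightarrow> i < length (arity L R) \<Longrightarrow> arity L R ! i \<in> sorts L" for R i
    using L nth_mem by (fastforce simp: is_language_def)
  have fb: "bij_betw (f P) (fiber (srt M P) x) (fiber (srt M P) y)"
    and gb: "bij_betw (g P) (fiber (srt M P) y) (fiber (srt M P) z)" if "P \<in> sorts L" for P
    using f g that by (auto simp: fiber_isomorphisms_def)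
  have fm: "a \<in> fiber (srt M P) x \<Longrightarrow> f P a \<in> fiber (srt M P) y" if "P \<in> sorts L" for P a
    using fb[OF that] by (auto dest: bij_betwE)
  have gm: "a \<in> fiber (srt M P) y \<Longrightarrow> g P a \<in> fiber (srt M P) z" if "P \<in> sorts L" for P a
    using gb[OF that] by (auto dest: bij_betwE)
  have rl: "rel M R (z, \<lambda>i \<in> {..<length (arity L R)}. ?h (arity L R ! i) (a i)) = rel M R (x, a)"
    if R: "R \<in> rels L" and a: "a \<in> (\<Pi>\<^sub>E i \<in> {..<length (arity L R)}. fiber (srt M (arity L R ! i)) x)" for R a
  proof -
    let ?b = "\<lambda>i \<in> {..<length (arity L R)}. f (arity L R ! i) (a i)"
    have b: "?b \<in> (\<Pi>\<^sub>E i \<in> {..<length (arity L R)}. fiber (srt M (arity L R ! i)) y)"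
      using a ar[OF R] fm by (simp add: PiE_iff)
    have "(\<lambda>i \<in> {..<length (arity L R)}. ?h (arity L R ! i) (a i)) =
          (\<lambda>i \<in> {..<length (arity L R)}. g (arity L R ! i) (?b i))"
      using a ar[OF R] by (intro restrict_ext) (auto simp: compose_eq PiE_iff)
    moreover have "rel M R (z, \<lambda>i \<in> {..<length (arity L R)}. g (arity L R ! i) (?b i)) = rel M R (y, ?b)"
      using g R b unfolding fiber_isomorphisms_def by blast
    ultimately have "rel M R (z, \<lambda>i \<in> {..<length (arity L R)}. ?h (arity L R ! i) (a i)) = rel M R (y, ?b)"
      by (simp only:)
    also have "\<dots> = rel M R (x, a)" using f R a unfolding fiber_isomorphisms_def by blast
    finally show ?thesis .
  qed
  have iso: "mdist (met (srt M P)) (?h P a) (?h P b) = mdist (met (srt M P)) a b"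
    if P: "P \<in> sorts L" and ab: "a \<in> fiber (srt M P) x" "b \<in> fiber (srt M P) x" for P a b
  proof -
    have "mdist (met (srt M P)) (g P (f P a)) (g P (f P b)) = mdist (met (srt M P)) (f P a) (f P b)"
      using g P fm[OF P] ab unfolding fiber_isomorphisms_def by blast
    also have "\<dots> = mdist (met (srt M P)) a b"
      using f P ab unfolding fiber_isomorphisms_def by blast
    finally show ?thesis using P ab by (simp add: compose_eq)
  qed
  have bj: "bij_betw (?h P) (fiber (srt M P) x) (fiber (srt M P) z)" if "P \<in> sorts L" for P
    using bij_betw_compose[OF fb gb] that by simp
  have "?h \<in> (\<Pi>\<^sub>E P \<in> sorts L. fiber (srt M P) x \<rightarrow>\<^sub>E fiber (srt M P) z)"
    using fm gm by (simp add: PiE_iff compose_eq)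
  then show ?thesis unfolding fiber_isomorphisms_def using rl iso bj by blast
qed

lemma fiber_isomorphisms_inverse:
  assumes L: "is_language L" and f: "f \<in> fiber_isomorphisms L M x y"
  shows "(\<lambda>P \<in> sorts L. \<lambda>b \<in> fiber (srt M P) y. inv_into (fiber (srt M P) x) (f P) b) \<in> fiber_isomorphisms L M y x"
    (is "?h \<in> _")
proof -
  have ar: "R \<in> rels L \<Longrightarrow> i < length (arity L R) \<Longrightarrow> arity L R ! i \<in> sorts L" for R i
    using L nth_mem by (fastforce simp: is_language_def)
  have fb: "bij_betw (f P) (fiber (srt M P) x) (fiber (srt M P) y)" if "P \<in> sorts L" for P
    using f that by (auto simp: fiber_isomorphisms_def)
  have hb: "bij_betw (?h P) (fiber (srt M P) y) (fiber (srt M P) x)" if P: "P \<in> sorts L" for P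
  proof -
    have "?h P b = inv_into (fiber (srt M P) x) (f P) b" if "b \<in> fiber (srt M P) y" for b
      using P that by simp
    then show ?thesis using bij_betw_inv_into[OF fb[OF P]] bij_betw_cong by blast
  qed
  have hm: "b \<in> fiber (srt M P) y \<Longrightarrow> ?h P b \<in> fiber (srt M P) x" if "P \<in> sorts L" for P b
    using bij_betwE[OF hb[OF that]] by blast
  have fh: "f P (?h P b) = b" if "P \<in> sorts L" "b \<in> fiber (srt M P) y" for P b
    using that bij_betw_inv_into_right[OF fb[OF that(1)] that(2)] by simp
  have rl: "rel M R (x, \<lambda>i \<in> {..<length (arity L R)}. ?h (arity L R ! i) (b i)) = rel M R (y, b)"
    if R: "R \<in> rels L" and b: "b \<in> (\<Pi>\<^sub>E i \<in> {..<length (arity L R)}. fiber (srt M (arity L R ! i)) y)" for R b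
  proof -
    let ?a = "\<lambda>i \<in> {..<length (arity L R)}. ?h (arity L R ! i) (b i)"
    have a: "?a \<in> (\<Pi>\<^sub>E i \<in> {..<length (arity L R)}. fiber (srt M (arity L R ! i)) x)"
      using b ar[OF R] hm by (auto simp: PiE_iff)
    have "(\<lambda>i \<in> {..<length (arity L R)}. f (arity L R ! i) (?a i)) = b"
      using b ar[OF R] fh by (auto simp: fun_eq_iff PiE_iff extensional_def)
    moreover have "rel M R (y, \<lambda>i \<in> {..<length (arity L R)}. f (arity L R ! i) (?a i)) = rel M R (x, ?a)"
      using f R a unfolding fiber_isomorphisms_def by blast
    ultimately show ?thesis by simp
  qed
  have iso: "mdist (met (srt M P)) (?h P a) (?h P b) = mdist (met (srt M P)) a b"
    if P: "P \<in> sorts L" and ab: "a \<in> fiber (srt M P) y" "b \<in> fiber (srt M P) y" for P a b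
  proof -
    have "mdist (met (srt M P)) (f P (?h P a)) (f P (?h P b)) = mdist (met (srt M P)) (?h P a) (?h P b)"
      using f P hm[OF P] ab unfolding fiber_isomorphisms_def by blast
    then show ?thesis using fh[OF P] ab by simp
  qed
  have "?h \<in> (\<Pi>\<^sub>E P \<in> sorts L. fiber (srt M P) y \<rightarrow>\<^sub>E fiber (srt M P) x)"
    using hm by (auto simp: PiE_iff)
  then show ?thesis unfolding fiber_isomorphisms_def using rl iso hb by blast
qed

theorem groupoid_laws_iso_groupoid:
  assumes L: "is_language L"
  shows "groupoid_laws (iso_groupoid L X M)"
proof -
  have e: "f \<in> extensional (sorts L)" "\<And>P. P \<in> sorts L \<Longrightarrow> f P \<in> fiber (srt M P) x \<rightarrow>\<^sub>E fiber (srt M P) y"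
    "\<And>P. P \<in> sorts L \<Longrightarrow> bij_betw (f P) (fiber (srt M P) x) (fiber (srt M P) y)"
    if "f \<in> fiber_isomorphisms L M x y" for f x y
    using that by (auto simp: fiber_isomorphisms_def PiE_iff)
  have u: "(\<lambda>P \<in> sorts L. compose (fiber (srt M P) x) ((\<lambda>P \<in> sorts L. \<lambda>a \<in> fiber (srt M P) y. a) P) (f P)) = f"
    "(\<lambda>P \<in> sorts L. compose (fiber (srt M P) x) (f P) ((\<lambda>P \<in> sorts L. \<lambda>a \<in> fiber (srt M P) x. a) P)) = f"
    if "f \<in> fiber_isomorphisms L M x y" for f x y
    using e(1,2)[OF that]
    by (auto simp: fun_eq_iff compose_def extensional_def PiE_iff)
  have as: "(\<lambda>P \<in> sorts L. compose (fiber (srt M P) w) (h P) ((\<lambda>P \<in> sorts L. compose (fiber (srt M P) w) (g P) (f P)) P)) =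
     (\<lambda>P \<in> sorts L. compose (fiber (srt M P) w) ((\<lambda>P \<in> sorts L. compose (fiber (srt M P) x) (h P) (g P)) P) (f P))"
    if "f \<in> fiber_isomorphisms L M w x" for f g h w x
    using e(2)[OF that] by (auto simp: fun_eq_iff compose_def PiE_iff)
  have i1: "inv_into (fiber (srt M P) x) (f P) (f P a) = a"
    if "f \<in> fiber_isomorphisms L M x y" "P \<in> sorts L" "a \<in> fiber (srt M P) x" for f x y P a
    by (rule bij_betw_inv_into_left[OF e(3)[OF that(1,2)] that(3)])
  have i2: "f P (inv_into (fiber (srt M P) x) (f P) a) = a"
    if "f \<in> fiber_isomorphisms L M x y" "P \<in> sorts L" "a \<in> fiber (srt M P) y" for f x y P a
    by (rule bij_betw_inv_into_right[OF e(3)[OF that(1,2)] that(3)])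
  have iv: "(\<lambda>P \<in> sorts L. compose (fiber (srt M P) x) ((\<lambda>P \<in> sorts L. \<lambda>b \<in> fiber (srt M P) y. inv_into (fiber (srt M P) x) (f P) b) P) (f P))
      = (\<lambda>P \<in> sorts L. \<lambda>a \<in> fiber (srt M P) x. a)"
    "(\<lambda>P \<in> sorts L. compose (fiber (srt M P) y) (f P) ((\<lambda>P \<in> sorts L. \<lambda>b \<in> fiber (srt M P) y. inv_into (fiber (srt M P) x) (f P) b) P))
      = (\<lambda>P \<in> sorts L. \<lambda>a \<in> fiber (srt M P) y. a)"
    if "f \<in> fiber_isomorphisms L M x y" for f x y
    using e(2,3)[OF that]
    by (auto intro!: restrict_ext simp: compose_def PiE_iff i1[OF that] i2[OF that])
  have sp: "space (mor (iso_groupoid L X M)) = iso_morphisms L X M" "space (ob (iso_groupoid L X M)) = topspace X"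
    by (simp_all add: iso_groupoid_def)
  have hm: "hom_set (iso_groupoid L X M) x y =
      {(x', y', f). x' = x \<and> y' = y \<and> x \<in> topspace X \<and> y \<in> topspace X \<and> f \<in> fiber_isomorphisms L M x y}" for x y
    unfolding hom_set_def sp by (auto simp: iso_morphisms_def iso_groupoid_def)
  have op: "idt (iso_groupoid L X M) x = (x, x, \<lambda>P \<in> sorts L. \<lambda>a \<in> fiber (srt M P) x. a)"
    "cmp (iso_groupoid L X M) (y', z, g) (x, y, f) = (x, z, \<lambda>P \<in> sorts L. compose (fiber (srt M P) x) (g P) (f P))"
    "ivs (iso_groupoid L X M) (x, y, f) = (y, x, \<lambda>P \<in> sorts L. \<lambda>b \<in> fiber (srt M P) y.
              inv_into (fiber (srt M P) x) (f P) b)" for x y y' z f g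
    by (simp_all add: iso_groupoid_def)
  show ?thesis
    unfolding groupoid_laws_def
  proof (intro conjI allI ballI)
    show "src (iso_groupoid L X M) \<in> space (mor (iso_groupoid L X M)) \<rightarrow> space (ob (iso_groupoid L X M))"
      "tgt (iso_groupoid L X M) \<in> space (mor (iso_groupoid L X M)) \<rightarrow> space (ob (iso_groupoid L X M))"
      unfolding sp by (auto simp: iso_groupoid_def iso_morphisms_def)
    show "idt (iso_groupoid L X M) x \<in> hom_set (iso_groupoid L X M) x x" if "x \<in> space (ob (iso_groupoid L X M))" for x
      using that unfolding sp hm op by (simp del: restrict_apply add: fiber_isomorphisms_id[OF L])
    fix x y z f g assume "f \<in> hom_set (iso_groupoid L X M) x y" "g \<in> hom_set (iso_groupoid L X M) y z"
    then show "cmp (iso_groupoid L X M) g f \<in> hom_set (iso_groupoid L X M) x z"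
      unfolding hm by (auto simp del: restrict_apply simp: op intro: fiber_isomorphisms_compose[OF L])
  next
    fix x y f assume f: "f \<in> hom_set (iso_groupoid L X M) x y"
    then show "ivs (iso_groupoid L X M) f \<in> hom_set (iso_groupoid L X M) y x"
      unfolding hm by (auto simp del: restrict_apply simp: op intro: fiber_isomorphisms_inverse[OF L])
    obtain f' where f': "f = (x, y, f')" "f' \<in> fiber_isomorphisms L M x y" using f unfolding hm by auto
    show "cmp (iso_groupoid L X M) f (idt (iso_groupoid L X M) x) = f"
      "cmp (iso_groupoid L X M) (idt (iso_groupoid L X M) y) f = f"
      "cmp (iso_groupoid L X M) (ivs (iso_groupoid L X M) f) f = idt (iso_groupoid L X M) x"
      "cmp (iso_groupoid L X M) f (ivs (iso_groupoid L X M) f) = idt (iso_groupoid L X M) y"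
      unfolding f'(1) op u[OF f'(2)] iv[OF f'(2)] by (rule refl)+
  next
    fix w x y z f g h
    assume f: "f \<in> hom_set (iso_groupoid L X M) w x" and g: "g \<in> hom_set (iso_groupoid L X M) x y"
      and h: "h \<in> hom_set (iso_groupoid L X M) y z"
    obtain f' where f': "f = (w, x, f')" "f' \<in> fiber_isomorphisms L M w x" using f unfolding hm by auto
    obtain g' where g': "g = (x, y, g')" using g unfolding hm by auto
    obtain h' where h': "h = (y, z, h')" using h unfolding hm by auto
    show "cmp (iso_groupoid L X M) h (cmp (iso_groupoid L X M) g f) =
      cmp (iso_groupoid L X M) (cmp (iso_groupoid L X M) h g) f"
      unfolding f'(1) g' h' op as[OF f'(2)] by (rule refl)
  qed
qed

end

theory Submission
  imports Defs
begin

text \<open>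
  The sorts of a fiber over \<open>x\<close>, with one extra point, make up a single metric space \<open>M\<^sub>x\<close> in which
  different sorts are at distance 1. The functor realizes \<open>M\<^sub>x\<close> inside the Urysohn sphere in
  a canonical way and then names enough predicates to recover \<open>M\<^sub>x\<close> from the sphere.

  Canonicity comes from Katetov's construction of the sphere: starting with \<open>M\<^sub>x\<close>, adjoin points that
  realize prescribed distances to finitely many old points, and iterate. The adjoined points are
  written down as finite trees (type \<open>trm\<close>) whose leaves lie in \<open>M\<^sub>x\<close> and whose inner nodes list
  earlier trees with rational distances. The distance \<open>tdist\<close> of two trees is computed by finitely
  many maxima and minima from the distances between leaves. Hence an isometry of the
  leaves acts on trees (\<open>tdist_map_trm\<close>), the distance of two trees depends on the leaves continuously
  (\<open>tdist_perturb\<close>) and measurably (\<open>measurable_tdist\<close>), and any one-point extension of a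
  finite set of trees is approximated by a tree (\<open>approximate_extension\<close>). By the last property the
  completion of the space of trees is the Urysohn sphere.

  To do this for all \<open>x\<close> at once in a Borel way, choose sections \<open>s x 0, s x 1, \<dots>\<close> that are dense
  in \<open>M\<^sub>x\<close> and have Borel distances: a section is the limit of a
  sequence of basic open sets of shrinking fiber diameter, selected by least index
  (\<open>etale_sections_exist\<close>). A back-and-forth between the countable space of trees over the sections
  and a dense sequence of the sphere, again by least index, gives isometric embeddings \<open>\<Phi> x\<close> with dense
  image that are Borel in \<open>x\<close> (\<open>uniform_back_and_forth\<close>). They extend to all trees over \<open>M\<^sub>x\<close>; the extension
  is \<open>\<phi> x\<close>. An isomorphism \<open>f\<close> of fibers moves trees over \<open>M\<^sub>x\<close> to trees over \<open>M\<^sub>y\<close>, and so induces an isometry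
  of the sphere.

  The structure attached to \<open>x\<close> has two kinds of predicates. One kind extends the relations of the fiber
  from \<open>M\<^sub>x\<close> to the sphere in the largest 1-Lipschitz way. The other kind has a predicate for every
  tree shape \<open>\<tau>\<close> with sorts for its variables, which measures how far
  \<open>(z\<^sub>0, z\<^sub>1, \<dots>, z\<^sub>k)\<close> is from being \<open>(\<tau>(b), b\<^sub>1, \<dots>, b\<^sub>k)\<close> for some leaves \<open>b\<close> of these sorts.
  Induced isometries preserve all of them (\<open>encoded_natural\<close>). Conversely let an isometry preserve
  them. It maps \<open>M\<^sub>x\<close> to \<open>M\<^sub>y\<close> sort by sort because fibers are complete (\<open>point_transfer\<close>), so it
  restricts to an isomorphism of fibers, and it maps \<open>\<tau>(b)\<close> to the tree with the same
  shape over the image of \<open>b\<close> (\<open>term_transfer\<close>), so it is induced by its restriction. This is fullness;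
  faithfulness holds because leaves are trees.
\<close>

section \<open>Katetov functions with finite support\<close>

definition pseudometric_on :: "'q set \<Rightarrow> ('q \<Rightarrow> 'q \<Rightarrow> real) \<Rightarrow> bool" where
  "pseudometric_on Q \<delta> \<longleftrightarrow>
     (\<forall>p\<in>Q. \<delta> p p = 0) \<and>
     (\<forall>p\<in>Q. \<forall>q\<in>Q. 0 \<le> \<delta> p q \<and> \<delta> p q \<le> 1 \<and> \<delta> p q = \<delta> q p \<and> (\<forall>s\<in>Q. \<delta> p s \<le> \<delta> p q + \<delta> q s))"

lemma pseudometric_onD:
  assumes "pseudometric_on Q \<delta>"
  shows "p \<in> Q \<Longrightarrow> \<delta> p p = 0"
    and "p \<in> Q \<Longrightarrow> q \<in> Q \<Longrightarrow> 0 \<le> \<delta> p q"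
    and "p \<in> Q \<Longrightarrow> q \<in> Q \<Longrightarrow> \<delta> p q \<le> 1"
    and "p \<in> Q \<Longrightarrow> q \<in> Q \<Longrightarrow> \<delta> p q = \<delta> q p"
    and "p \<in> Q \<Longrightarrow> q \<in> Q \<Longrightarrow> s \<in> Q \<Longrightarrow> \<delta> p s \<le> \<delta> p q + \<delta> q s"
  using assms unfolding pseudometric_on_def by blast+

text \<open>
  A list of pairs \<open>(p, w)\<close> stands for the Katetov function that is the largest 1-Lipschitz function
  bounded by 1 and by \<open>w\<close> at each \<open>p\<close>; \<open>kval\<close> evaluates it. The uniform distance of two such
  functions is attained on their supports (\<open>kval_diff_le_kdist\<close>), which is why \<open>kdist\<close> takes only a finite
  maximum.
\<close>
definition kval :: "('q \<Rightarrow> 'q \<Rightarrow> real) \<Rightarrow> ('q \<times> real) list \<Rightarrow> 'q \<Rightarrow> real" where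
  "kval \<delta> l q = Min (insert 1 ((\<lambda>(p, w). w + \<delta> p q) ` set l))"

definition kdist :: "('q \<Rightarrow> 'q \<Rightarrow> real) \<Rightarrow> ('q \<times> real) list \<Rightarrow> ('q \<times> real) list \<Rightarrow> real" where
  "kdist \<delta> l l' = Max (insert 0 ((\<lambda>p. \<bar>kval \<delta> l p - kval \<delta> l' p\<bar>) ` fst ` (set l \<union> set l')))"

definition admissible :: "'q set \<Rightarrow> ('q \<Rightarrow> 'q \<Rightarrow> real) \<Rightarrow> ('q \<times> real) list \<Rightarrow> bool" where
  "admissible Q \<delta> l \<longleftrightarrow> fst ` set l \<subseteq> Q \<and> (\<forall>(p, w)\<in>set l. \<forall>(q, v)\<in>set l. \<delta> p q \<le> w + v)"

lemma admissible_support: "admissible Q \<delta> l \<Longrightarrow> fst ` set l \<subseteq> Q"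
  by (simp add: admissible_def)

lemma kval_le_1: "kval \<delta> l q \<le> 1"
  unfolding kval_def by simp

lemma kval_le: "(p, w) \<in> set l \<Longrightarrow> kval \<delta> l q \<le> w + \<delta> p q"
  unfolding kval_def by (rule Min_le) force+

lemma kval_cases: "kval \<delta> l q = 1 \<or> (\<exists>p w. (p, w) \<in> set l \<and> kval \<delta> l q = w + \<delta> p q)"
proof -
  have "kval \<delta> l q \<in> insert 1 ((\<lambda>(p, w). w + \<delta> p q) ` set l)"
    unfolding kval_def by (rule Min_in) auto
  then show ?thesis by auto
qed

lemma kval_geI:
  "c \<le> 1 \<Longrightarrow> (\<And>p w. (p, w) \<in> set l \<Longrightarrow> c \<le> w + \<delta> p q) \<Longrightarrow> c \<le> kval \<delta> l q"
  using kval_cases[of \<delta> l q] by auto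

context
  fixes Q :: "'q set" and \<delta> :: "'q \<Rightarrow> 'q \<Rightarrow> real"
  assumes pm: "pseudometric_on Q \<delta>"
begin

lemma admissible_weight_nonneg:
  assumes "admissible Q \<delta> l" "(p, w) \<in> set l"
  shows "0 \<le> w" and "p \<in> Q"
proof -
  show p: "p \<in> Q" using assms unfolding admissible_def by force
  have "\<delta> p p \<le> w + w" using assms unfolding admissible_def by blast
  then show "0 \<le> w" using pseudometric_onD(1)[OF pm p] by simp
qed

lemma kval_nonneg:
  assumes "admissible Q \<delta> l" "q \<in> Q"
  shows "0 \<le> kval \<delta> l q"
proof (rule kval_geI)
  fix p w assume "(p, w) \<in> set l"
  then show "0 \<le> w + \<delta> p q"
    by (intro add_nonneg_nonneg admissible_weight_nonneg[OF assms(1)] pseudometric_onD(2)[OF pm _ assms(2)])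
qed simp

lemma kval_lipschitz:
  assumes l: "admissible Q \<delta> l" and q: "q \<in> Q" "q' \<in> Q"
  shows "kval \<delta> l q \<le> kval \<delta> l q' + \<delta> q q'"
proof (cases rule: disjE[OF kval_cases[of \<delta> l q']])
  case 1
  then show ?thesis using kval_le_1[of \<delta> l q] pseudometric_onD(2)[OF pm q] by simp
next
  case 2
  then obtain p w where p: "(p, w) \<in> set l" "kval \<delta> l q' = w + \<delta> p q'" by blast
  have "p \<in> Q" using admissible_weight_nonneg[OF l p(1)] by simp
  then have "\<delta> p q \<le> \<delta> p q' + \<delta> q' q" "\<delta> q' q = \<delta> q q'"
    using pseudometric_onD(4)[OF pm] pseudometric_onD(5)[OF pm] q by blast+
  then show ?thesis using kval_le[OF p(1), of \<delta> q] p(2) by linarith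
qed

lemma kval_katetov:
  assumes l: "admissible Q \<delta> l" and q: "q \<in> Q" "q' \<in> Q"
  shows "\<delta> q q' \<le> kval \<delta> l q + kval \<delta> l q'"
proof -
  have 1: "\<delta> q q' \<le> 1" "0 \<le> kval \<delta> l q" "0 \<le> kval \<delta> l q'"
    using pseudometric_onD(3)[OF pm q] kval_nonneg[OF l] q by auto
  consider "kval \<delta> l q = 1" | "kval \<delta> l q' = 1"
    | p w p' w' where "(p, w) \<in> set l" "kval \<delta> l q = w + \<delta> p q" "(p', w') \<in> set l" "kval \<delta> l q' = w' + \<delta> p' q'"
    using kval_cases[of \<delta> l q] kval_cases[of \<delta> l q'] by blast
  then show ?thesis
  proof cases
    case 3
    then have Q: "p \<in> Q" "p' \<in> Q" using admissible_weight_nonneg[OF l] by blast+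
    have "\<delta> p p' \<le> w + w'" using 3 l unfolding admissible_def by blast
    moreover have "\<delta> q q' \<le> \<delta> q p + \<delta> p q'" "\<delta> p q' \<le> \<delta> p p' + \<delta> p' q'" "\<delta> q p = \<delta> p q"
      using pseudometric_onD(4)[OF pm] pseudometric_onD(5)[OF pm] Q q by blast+
    ultimately show ?thesis using 3 by linarith
  qed (use 1 in linarith)+
qed

lemma kdist_ge_support:
  assumes "p \<in> fst ` (set l \<union> set l')"
  shows "\<bar>kval \<delta> l p - kval \<delta> l' p\<bar> \<le> kdist \<delta> l l'"
  unfolding kdist_def using assms by (intro Max_ge) auto

lemma kdist_nonneg: "0 \<le> kdist \<delta> l l'"
  unfolding kdist_def by (rule Max_ge) auto

lemma kdist_sym: "kdist \<delta> l l' = kdist \<delta> l' l"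
  unfolding kdist_def by (simp add: abs_minus_commute Un_commute)

lemma kdist_leI:
  "0 \<le> c \<Longrightarrow> (\<And>p. p \<in> fst ` (set l \<union> set l') \<Longrightarrow> \<bar>kval \<delta> l p - kval \<delta> l' p\<bar> \<le> c) \<Longrightarrow> kdist \<delta> l l' \<le> c"
  unfolding kdist_def by (subst Max_le_iff) auto

lemma kdist_refl: "kdist \<delta> l l = 0"
  by (rule antisym[OF kdist_leI kdist_nonneg]) auto

text \<open>
  If \<open>p\<close> attains the minimum that defines the first function at \<open>q\<close>, then moving from \<open>q\<close> to \<open>p\<close>
  lowers the first function by at least \<open>\<delta> p q\<close> and the second one by at most that much.
\<close>
lemma kval_diff_le_kdist_half:
  assumes l: "admissible Q \<delta> l" and l': "admissible Q \<delta> l'" and q: "q \<in> Q"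
  shows "kval \<delta> l' q - kval \<delta> l q \<le> kdist \<delta> l l'"
proof (cases rule: disjE[OF kval_cases[of \<delta> l q]])
  case 1
  then show ?thesis using kval_le_1[of \<delta> l' q] kdist_nonneg[of l l'] by simp
next
  case 2
  then obtain p w where p: "(p, w) \<in> set l" "kval \<delta> l q = w + \<delta> p q" by blast
  have pQ: "p \<in> Q" using admissible_weight_nonneg[OF l p(1)] by simp
  have "kval \<delta> l p \<le> w" using kval_le[OF p(1), of \<delta> p] pseudometric_onD(1)[OF pm pQ] by simp
  moreover have "kval \<delta> l' q \<le> kval \<delta> l' p + \<delta> p q"
    using kval_lipschitz[OF l' q pQ] pseudometric_onD(4)[OF pm q pQ] by simp
  moreover have "p \<in> fst ` (set l \<union> set l')" using p by force
  then have "\<bar>kval \<delta> l p - kval \<delta> l' p\<bar> \<le> kdist \<delta> l l'" by (rule kdist_ge_support)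
  ultimately show ?thesis using p(2) by linarith
qed

lemma kval_diff_le_kdist:
  assumes l: "admissible Q \<delta> l" and l': "admissible Q \<delta> l'" and q: "q \<in> Q"
  shows "\<bar>kval \<delta> l q - kval \<delta> l' q\<bar> \<le> kdist \<delta> l l'"
  using kval_diff_le_kdist_half[OF l l' q] kval_diff_le_kdist_half[OF l' l q] kdist_sym[of l l'] by linarith

lemma kdist_le_1:
  assumes l: "admissible Q \<delta> l" and l': "admissible Q \<delta> l'"
  shows "kdist \<delta> l l' \<le> 1"
proof (rule kdist_leI)
  fix p assume "p \<in> fst ` (set l \<union> set l')"
  then have "p \<in> Q" using admissible_support[OF l] admissible_support[OF l'] by auto
  then show "\<bar>kval \<delta> l p - kval \<delta> l' p\<bar> \<le> 1"
    using kval_nonneg[OF l, of p] kval_nonneg[OF l', of p] kval_le_1[of \<delta> l p] kval_le_1[of \<delta> l' p] by linarith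
qed simp

lemma pseudometric_on_kdist: "pseudometric_on {l. admissible Q \<delta> l} (kdist \<delta>)"
proof -
  have tri: "kdist \<delta> l l'' \<le> kdist \<delta> l l' + kdist \<delta> l' l''"
    if l: "l \<in> {l. admissible Q \<delta> l}" "l' \<in> {l. admissible Q \<delta> l}" "l'' \<in> {l. admissible Q \<delta> l}" for l l' l''
  proof (rule kdist_leI)
    fix p assume "p \<in> fst ` (set l \<union> set l'')"
    then have "p \<in> Q" using l admissible_support[of Q \<delta> l] admissible_support[of Q \<delta> l''] by auto
    then have "\<bar>kval \<delta> l p - kval \<delta> l' p\<bar> \<le> kdist \<delta> l l'" "\<bar>kval \<delta> l' p - kval \<delta> l'' p\<bar> \<le> kdist \<delta> l' l''"
      using l by (auto intro!: kval_diff_le_kdist)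
    then show "\<bar>kval \<delta> l p - kval \<delta> l'' p\<bar> \<le> kdist \<delta> l l' + kdist \<delta> l' l''" by linarith
  qed (use kdist_nonneg[of l l'] kdist_nonneg[of l' l''] in linarith)
  show ?thesis
    unfolding pseudometric_on_def
    by (intro conjI ballI) (use tri in \<open>auto simp: kdist_refl kdist_nonneg kdist_le_1 intro: kdist_sym\<close>)
qed

lemma admissible_point: "q \<in> Q \<Longrightarrow> admissible Q \<delta> [(q, 0)]"
  using pseudometric_onD(1)[OF pm] by (simp add: admissible_def)

lemma kval_point: "q \<in> Q \<Longrightarrow> p \<in> Q \<Longrightarrow> kval \<delta> [(q, 0)] p = \<delta> q p"
  using pseudometric_onD(3)[OF pm] by (simp add: kval_def)

text \<open>
  A point \<open>q\<close> is the same as the Katetov function \<open>[(q, 0)]\<close>, so the space embeds isometrically in the space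
  of its Katetov functions, and the function \<open>l\<close> becomes the distance to the new point \<open>l\<close>.
\<close>
lemma kdist_point:
  assumes l: "admissible Q \<delta> l" and q: "q \<in> Q"
  shows "kdist \<delta> l [(q, 0)] = kval \<delta> l q"
proof (rule antisym)
  show "kdist \<delta> l [(q, 0)] \<le> kval \<delta> l q"
  proof (rule kdist_leI)
    fix p assume "p \<in> fst ` (set l \<union> set [(q, 0)])"
    then have p: "p \<in> Q" using admissible_support[OF l] q by auto
    show "\<bar>kval \<delta> l p - kval \<delta> [(q, 0)] p\<bar> \<le> kval \<delta> l q"
      using kval_lipschitz[OF l p q] kval_katetov[OF l p q] pseudometric_onD(4)[OF pm p q]
      unfolding kval_point[OF q p] by linarith
  qed (rule kval_nonneg[OF l q])
  have "\<bar>kval \<delta> l q - kval \<delta> [(q, 0)] q\<bar> \<le> kdist \<delta> l [(q, 0)]" by (rule kdist_ge_support) simp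
  then show "kval \<delta> l q \<le> kdist \<delta> l [(q, 0)]"
    unfolding kval_point[OF q q] pseudometric_onD(1)[OF pm q] by linarith
qed

end

section \<open>Trees over a pseudometric space\<close>

text \<open>
  Arbitrary rational weights need not satisfy the Katetov inequality \<open>\<delta> p q \<le> w + v\<close>. Adding
  the worst violation to all weights repairs this and keeps the dependence on \<open>\<delta>\<close> continuous,
  so that every list of weights describes a point. Admissible lists are left unchanged.
\<close>
definition slack :: "('q \<Rightarrow> 'q \<Rightarrow> real) \<Rightarrow> ('q \<times> rat) list \<Rightarrow> real" where
  "slack \<delta> l = Max (insert 0 ((\<lambda>((p, r), (q, s)). \<delta> p q - of_rat r - of_rat s) ` (set l \<times> set l)))"

definition relax :: "('q \<Rightarrow> 'q \<Rightarrow> real) \<Rightarrow> ('q \<times> rat) list \<Rightarrow> ('q \<times> real) list" where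
  "relax \<delta> l = map (\<lambda>(p, r). (p, of_rat r + slack \<delta> l)) l"

lemma slack_nonneg: "0 \<le> slack \<delta> l"
  unfolding slack_def by (rule Max_ge) auto

lemma slack_ge: "(p, r) \<in> set l \<Longrightarrow> (q, s) \<in> set l \<Longrightarrow> \<delta> p q - of_rat r - of_rat s \<le> slack \<delta> l"
  unfolding slack_def by (rule Max_ge) (auto intro!: rev_image_eqI[of "((p, r), (q, s))"])

lemma slack_leI: "0 \<le> c \<Longrightarrow> (\<And>p r q s. (p, r) \<in> set l \<Longrightarrow> (q, s) \<in> set l \<Longrightarrow> \<delta> p q - of_rat r - of_rat s \<le> c) \<Longrightarrow> slack \<delta> l \<le> c"
  unfolding slack_def by (subst Max_le_iff) auto

lemma admissible_relax:
  assumes "fst ` set l \<subseteq> Q"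
  shows "admissible Q \<delta> (relax \<delta> l)"
  unfolding admissible_def
proof
  show "fst ` set (relax \<delta> l) \<subseteq> Q" using assms by (force simp: relax_def)
  have "\<delta> p q \<le> (of_rat r + slack \<delta> l) + (of_rat s + slack \<delta> l)"
    if "(p, r) \<in> set l" "(q, s) \<in> set l" for p q r s
    using slack_ge[OF that, of \<delta>] slack_nonneg[of \<delta> l] by linarith
  then show "\<forall>(p, w)\<in>set (relax \<delta> l). \<forall>(q, v)\<in>set (relax \<delta> l). \<delta> p q \<le> w + v"
    by (auto simp: relax_def)
qed

text \<open>
  \<open>Kat [(t\<^sub>1, r\<^sub>1), \<dots>]\<close> is a new point at distance about \<open>r\<^sub>i\<close> from \<open>t\<^sub>i\<close>. Rational weights make the set of trees over
  a countable set countable.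
\<close>
datatype 'p trm = Pt 'p | Kat "('p trm \<times> rat) list"

instance trm :: (countable) countable
  by countable_datatype

primrec args :: "'p trm \<Rightarrow> ('p trm \<times> rat) list" where
  "args (Pt a) = []"
| "args (Kat l) = l"

text \<open>
  Any rank that is larger at a node than at its children serves as the stage at which a tree is adjoined;
  the sum is convenient because it is invariant under renaming the leaves.
\<close>
fun lev :: "'p trm \<Rightarrow> nat" where
  "lev (Pt a) = 0"
| "lev (Kat l) = Suc (\<Sum>u\<leftarrow>l. lev (fst u))"

lemma lev_args: "u \<in> set (args t) \<Longrightarrow> lev (fst u) < lev t"
  by (cases t) (auto simp: less_Suc_eq_le intro!: member_le_sum_list)

lemma lev_map_trm: "lev (map_trm f t) = lev t"
proof (induction t rule: lev.induct)
  case (2 l)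
  then show ?case by (auto simp: comp_def intro!: arg_cong[where f = sum_list])
qed simp

lemma args_map_trm: "args (map_trm f t) = map (map_prod (map_trm f) id) (args t)"
  by (cases t) auto

lemma set_args: "u \<in> set (args t) \<Longrightarrow> set_trm (fst u) \<subseteq> set_trm t"
proof (cases t)
  case (Kat l)
  assume "u \<in> set (args t)"
  then have u: "u \<in> set l" using Kat by simp
  have "set_trm (fst u) \<subseteq> (\<Union>x\<in>set l. \<Union> (set_trm ` Basic_BNFs.fsts x))"
    by (intro subsetI UN_I[OF u] UN_I[of "fst u"]) (cases u; simp)+
  then show ?thesis using Kat by simp
qed simp

lemma finite_set_trm: "finite (set_trm t)"
proof (induction t)
  case (Kat l)
  have "finite (set_trm (fst u))" if "u \<in> set l" for u using Kat that by (cases u) fastforce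
  moreover have "set_trm (Kat l) = (\<Union>u\<in>set l. set_trm (fst u))"
  proof -
    have "Basic_BNFs.fsts u = {fst u}" for u :: "'a trm \<times> rat" by (cases u) auto
    then show ?thesis by simp
  qed
  ultimately show ?case by simp
qed simp

text \<open>
  At stage \<open>n + 1\<close> a tree is regarded as a Katetov function on the trees of level at most \<open>n\<close>: an old tree is
  the distance to itself, and a new tree is given by its children.
\<close>
definition descr :: "('p trm \<Rightarrow> 'p trm \<Rightarrow> real) \<Rightarrow> nat \<Rightarrow> 'p trm \<Rightarrow> ('p trm \<times> real) list" where
  "descr \<delta> n t = (if lev t \<le> n then [(t, 0)] else relax \<delta> (args t))"

text \<open>
  Stage \<open>n\<close> is meaningful for trees of level at most \<open>n\<close>; elsewhere the values are arbitrary.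
\<close>
primrec tower :: "('p \<Rightarrow> 'p \<Rightarrow> real) \<Rightarrow> nat \<Rightarrow> 'p trm \<Rightarrow> 'p trm \<Rightarrow> real" where
  "tower d 0 = (\<lambda>t s. case (t, s) of (Pt a, Pt b) \<Rightarrow> d a b | _ \<Rightarrow> 0)"
| "tower d (Suc n) = (\<lambda>t s. kdist (tower d n) (descr (tower d n) n t) (descr (tower d n) n s))"

definition tdist :: "('p \<Rightarrow> 'p \<Rightarrow> real) \<Rightarrow> 'p trm \<Rightarrow> 'p trm \<Rightarrow> real" where
  "tdist d t s = tower d (max (lev t) (lev s)) t s"

lemma lev_0: "lev t = 0 \<longleftrightarrow> (\<exists>a. t = Pt a)"
  by (cases t) auto

lemma admissible_descr:
  assumes "pseudometric_on {t. lev t \<le> n} \<delta>" "lev t \<le> Suc n"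
  shows "admissible {t. lev t \<le> n} \<delta> (descr \<delta> n t)"
proof (cases "lev t \<le> n")
  case True
  then show ?thesis using admissible_point[OF assms(1)] by (simp add: descr_def)
next
  case False
  have "fst ` set (args t) \<subseteq> {t. lev t \<le> n}" using lev_args[of _ t] assms(2) by force
  then show ?thesis using False by (simp add: descr_def admissible_relax)
qed

context
  fixes d :: "'p \<Rightarrow> 'p \<Rightarrow> real"
  assumes d: "pseudometric_on UNIV d"
begin

lemma pseudometric_on_tower: "pseudometric_on {t. lev t \<le> n} (tower d n)"
proof (induction n)
  case 0
  show ?case using d unfolding pseudometric_on_def by (auto simp: lev_0)
next
  case (Suc n)
  show ?case
    using pseudometric_on_kdist[OF Suc] admissible_descr[OF Suc]
    unfolding pseudometric_on_def by simp
qed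

text \<open>
  Passing to Katetov functions does not change distances between old points, so the stages are compatible
  and \<open>tdist\<close> may be read off at any late enough stage.
\<close>
lemma tower_Suc: "lev t \<le> n \<Longrightarrow> lev s \<le> n \<Longrightarrow> tower d (Suc n) t s = tower d n t s"
  using kdist_point[OF pseudometric_on_tower[of n] admissible_point[OF pseudometric_on_tower[of n]]]
    kval_point[OF pseudometric_on_tower[of n]]
  by (simp add: descr_def)

lemma tower_eq_tdist: 
  assumes "lev t \<le> n" "lev s \<le> n" 
  shows "tower d n t s = tdist d t s"
proof -
  have "max (lev t) (lev s) \<le> n" using assms by simp
  then show ?thesis unfolding tdist_def
    by (induction n rule: dec_induct) (auto simp del: tower.simps simp: tower_Suc)
qed

lemma pseudometric_on_tdist: "pseudometric_on UNIV (tdist d)"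
proof -
  have "\<exists>n. lev p \<le> n \<and> lev q \<le> n \<and> lev s \<le> n" for p q s :: "'p trm"
    by (intro exI[of _ "lev p + lev q + lev s"]) auto
  then show ?thesis
    using pseudometric_on_tower unfolding pseudometric_on_def
    by (smt (verit) mem_Collect_eq tower_eq_tdist)
qed

lemma tdist_Pt [simp]: "tdist d (Pt a) (Pt b) = d a b"
  by (simp add: tdist_def)

lemma slack_cong: "(\<And>p q. p \<in> fst ` set l \<Longrightarrow> q \<in> fst ` set l \<Longrightarrow> \<delta> p q = \<delta>' p q) \<Longrightarrow> slack \<delta> l = slack \<delta>' l"
  unfolding slack_def by (intro arg_cong[where f = Max] arg_cong2[where f = insert] image_cong) force+

lemma kval_cong: "(\<And>p. p \<in> fst ` set l \<Longrightarrow> \<delta> p q = \<delta>' p q) \<Longrightarrow> kval \<delta> l q = kval \<delta>' l q"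
  unfolding kval_def by (intro arg_cong[where f = Min] arg_cong2[where f = insert] image_cong) force+

lemma tdist_arg_formula:
  assumes "lev s < lev t"
  shows "tdist d t s = kval (tdist d) (relax (tdist d) (args t)) s"
proof -
  obtain n where n: "lev t = Suc n" using assms by (cases "lev t") auto
  have s: "lev s \<le> n" using n assms by simp
  have le: "p \<in> fst ` set (args t) \<Longrightarrow> lev p \<le> n" for p using lev_args[of _ t] n by force
  have "tdist d t s = tower d (Suc n) t s" using n s by (simp add: tower_eq_tdist del: tower.simps)
  also have "\<dots> = kdist (tower d n) (descr (tower d n) n t) [(s, 0)]" using s by (simp add: descr_def)
  also have "\<dots> = kval (tower d n) (descr (tower d n) n t) s"
    using kdist_point[OF pseudometric_on_tower admissible_descr[OF pseudometric_on_tower]] n s by simp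
  also have "\<dots> = kval (tower d n) (relax (tower d n) (args t)) s" using n by (simp add: descr_def)
  also have "relax (tower d n) (args t) = relax (tdist d) (args t)"
    unfolding relax_def using le slack_cong[of "args t" "tower d n" "tdist d"] by (simp add: tower_eq_tdist)
  also have "kval (tower d n) (relax (tdist d) (args t)) s = kval (tdist d) (relax (tdist d) (args t)) s"
    using le s by (intro kval_cong) (auto simp: relax_def tower_eq_tdist image_comp split_def)
  finally show ?thesis .
qed

text \<open>
  Round the prescribed distances \<open>u\<close> up to rationals. This keeps the Katetov inequality, so the slack of
  the resulting node is 0, and the 1-Lipschitz property of \<open>u\<close> keeps the value at each \<open>p\<close> from dropping below \<open>u p\<close>.
\<close>
lemma approximate_extension:
  assumes F: "finite F" and u: "\<And>p. p \<in> F \<Longrightarrow> 0 \<le> u p \<and> u p \<le> 1"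
    and lip: "\<And>p q. p \<in> F \<Longrightarrow> q \<in> F \<Longrightarrow> \<bar>u p - u q\<bar> \<le> tdist d p q \<and> tdist d p q \<le> u p + u q"
    and e: "0 < e"
  shows "\<exists>t. \<forall>p\<in>F. \<bar>tdist d t p - u p\<bar> \<le> e"
proof -
  obtain ts where ts: "set ts = F" using finite_list[OF F] by blast
  have "\<exists>r. u p < of_rat r \<and> of_rat r < u p + e" for p using of_rat_dense[of "u p" "u p + e"] e by auto
  then obtain r where r: "\<And>p. u p < of_rat (r p)" "\<And>p. of_rat (r p) < u p + e" by metis
  let ?l = "map (\<lambda>p. (p, r p)) ts"
  let ?t = "Kat ?l"
  have "slack (tdist d) ?l \<le> 0"
  proof (rule slack_leI)
    fix p a q b assume "(p, a) \<in> set ?l" "(q, b) \<in> set ?l"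
    then have "p \<in> F" "q \<in> F" "a = r p" "b = r q" using ts by auto
    then show "tdist d p q - of_rat a - of_rat b \<le> 0" using lip[of p q] r(1)[of p] r(1)[of q] by simp
  qed simp
  then have sl: "slack (tdist d) ?l = 0" using slack_nonneg[of "tdist d" ?l] by simp
  have "\<bar>tdist d ?t p - u p\<bar> \<le> e" if p: "p \<in> F" for p
  proof -
    have "(p, r p) \<in> set (args ?t)" using p ts by auto
    then have "lev p < lev ?t" using lev_args by fastforce
    then have eq: "tdist d ?t p = kval (tdist d) (map (\<lambda>p. (p, of_rat (r p))) ts) p"
      unfolding tdist_arg_formula[OF \<open>lev p < lev ?t\<close>] by (simp add: relax_def sl comp_def)
    have "kval (tdist d) (map (\<lambda>p. (p, of_rat (r p))) ts) p \<le> of_rat (r p) + tdist d p p"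
      using p ts by (intro kval_le) auto
    moreover have "u p \<le> kval (tdist d) (map (\<lambda>p. (p, of_rat (r p))) ts) p"
    proof (rule kval_geI)
      fix q w assume "(q, w) \<in> set (map (\<lambda>p. (p, of_rat (r p) :: real)) ts)"
      then have q: "q \<in> F" "w = of_rat (r q)" using ts by auto
      then show "u p \<le> w + tdist d q p" using lip[OF q(1) p] r(1)[of q] by linarith
    qed (use u p in simp)
    ultimately show ?thesis using eq r(2)[of p] pseudometric_onD(1)[OF pseudometric_on_tdist, of p] by simp
  qed
  then show ?thesis by blast
qed

end

lemma slack_map: "(\<And>p q. p \<in> fst ` set l \<Longrightarrow> q \<in> fst ` set l \<Longrightarrow> \<delta>' (f p) (f q) = \<delta> p q) \<Longrightarrow>
    slack \<delta>' (map (map_prod f id) l) = slack \<delta> l"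
proof -
  assume *: "\<And>p q. p \<in> fst ` set l \<Longrightarrow> q \<in> fst ` set l \<Longrightarrow> \<delta>' (f p) (f q) = \<delta> p q"
  have "(\<lambda>((p, r), (q, s)). \<delta>' p q - of_rat r - of_rat s) ` (set (map (map_prod f id) l) \<times> set (map (map_prod f id) l))
     = (\<lambda>((p, r), (q, s)). \<delta>' (f p) (f q) - of_rat r - of_rat s) ` (set l \<times> set l)"
    by (force simp: image_iff Bex_def)
  also have "\<dots> = (\<lambda>((p, r), (q, s)). \<delta> p q - of_rat r - of_rat s) ` (set l \<times> set l)"
    using * by (intro image_cong) force+
  finally show ?thesis unfolding slack_def by simp
qed

lemma relax_map:
  assumes "\<And>p q. p \<in> fst ` set l \<Longrightarrow> q \<in> fst ` set l \<Longrightarrow> \<delta>' (f p) (f q) = \<delta> p q"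
  shows "relax \<delta>' (map (map_prod f id) l) = map (map_prod f id) (relax \<delta> l)"
  using slack_map[of l \<delta>' f \<delta>] assms unfolding relax_def by (simp add: split_def)

lemma kval_map: "(\<And>p. p \<in> fst ` set l \<Longrightarrow> \<delta>' (f p) (f q) = \<delta> p q) \<Longrightarrow> kval \<delta>' (map (map_prod f id) l) (f q) = kval \<delta> l q"
  unfolding kval_def
  by (intro arg_cong[where f = Min] arg_cong2[where f = insert])
     (force simp: image_image split_def intro!: image_cong)+

lemma kdist_map:
  assumes "\<And>p q. p \<in> fst ` (set l \<union> set l') \<Longrightarrow> q \<in> fst ` (set l \<union> set l') \<Longrightarrow> \<delta>' (f p) (f q) = \<delta> p q"
  shows "kdist \<delta>' (map (map_prod f id) l) (map (map_prod f id) l') = kdist \<delta> l l'"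
proof -
  have "(\<lambda>p. \<bar>kval \<delta>' (map (map_prod f id) l) p - kval \<delta>' (map (map_prod f id) l') p\<bar>) ` fst ` (set (map (map_prod f id) l) \<union> set (map (map_prod f id) l'))
    = (\<lambda>p. \<bar>kval \<delta>' (map (map_prod f id) l) (f p) - kval \<delta>' (map (map_prod f id) l') (f p)\<bar>) ` fst ` (set l \<union> set l')"
    by (simp add: image_Un image_image)
  also have "\<dots> = (\<lambda>p. \<bar>kval \<delta> l p - kval \<delta> l' p\<bar>) ` fst ` (set l \<union> set l')"
  proof (rule image_cong[OF refl])
    fix q assume q: "q \<in> fst ` (set l \<union> set l')"
    have "kval \<delta>' (map (map_prod f id) l) (f q) = kval \<delta> l q" "kval \<delta>' (map (map_prod f id) l') (f q) = kval \<delta> l' q"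
      using assms q by (intro kval_map; auto)+
    then show "\<bar>kval \<delta>' (map (map_prod f id) l) (f q) - kval \<delta>' (map (map_prod f id) l') (f q)\<bar> = \<bar>kval \<delta> l q - kval \<delta> l' q\<bar>" by simp
  qed
  finally show ?thesis unfolding kdist_def by simp
qed

lemma tower_map_trm:
  assumes "\<And>a b. a \<in> S \<Longrightarrow> b \<in> S \<Longrightarrow> d' (f a) (f b) = d a b" "set_trm t \<subseteq> S" "set_trm s \<subseteq> S"
  shows "tower d' n (map_trm f t) (map_trm f s) = tower d n t s"
  using assms(2,3)
proof (induction n arbitrary: t s)
  case 0
  then show ?case using assms(1) by (cases t; cases s) auto
next
  case (Suc n)
  have descr: "descr (tower d' n) n (map_trm f t) = map (map_prod (map_trm f) id) (descr (tower d n) n t)"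
    and sub: "p \<in> fst ` set (descr (tower d n) n t) \<Longrightarrow> set_trm p \<subseteq> S"
    if t: "set_trm t \<subseteq> S" for t p
  proof -
    have a: "p \<in> fst ` set (args t) \<Longrightarrow> set_trm p \<subseteq> S" for p
      using set_args[of _ t] t by force
    show "descr (tower d' n) n (map_trm f t) = map (map_prod (map_trm f) id) (descr (tower d n) n t)"
      using relax_map[of "args t" "tower d' n" "map_trm f" "tower d n"] Suc.IH a
      by (auto simp: descr_def lev_map_trm args_map_trm)
    show "set_trm p \<subseteq> S" if "p \<in> fst ` set (descr (tower d n) n t)"
      using that a[of p] t unfolding descr_def relax_def by (auto simp: image_comp split_def split: if_splits)
  qed
  show ?case
    unfolding tower.simps descr[OF Suc.prems(1)] descr[OF Suc.prems(2)]
  proof (rule kdist_map)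
    fix p q assume pq: "p \<in> fst ` (set (descr (tower d n) n t) \<union> set (descr (tower d n) n s))"
      "q \<in> fst ` (set (descr (tower d n) n t) \<union> set (descr (tower d n) n s))"
    have "set_trm p \<subseteq> S" if "p \<in> fst ` (set (descr (tower d n) n t) \<union> set (descr (tower d n) n s))" for p
      using that sub[OF Suc.prems(1), of p] sub[OF Suc.prems(2), of p] unfolding image_Un by blast
    then show "tower d' n (map_trm f p) (map_trm f q) = tower d n p q"
      using Suc.IH pq by blast
  qed
qed

text \<open>
  The recursion for \<open>tdist\<close> refers to \<open>d\<close> only at leaves of the two trees. This gives the
  action of isometries on trees, and it also reduces trees over sections to trees with natural numbers as leaves.
\<close>
lemma tdist_map_trm:
  assumes "\<And>a b. a \<in> S \<Longrightarrow> b \<in> S \<Longrightarrow> d' (f a) (f b) = d a b" "set_trm t \<subseteq> S" "set_trm s \<subseteq> S"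
  shows "tdist d' (map_trm f t) (map_trm f s) = tdist d t s"
  unfolding tdist_def lev_map_trm by (rule tower_map_trm) (use assms in auto)

section \<open>Dependence of the tree distance on the leaves\<close>

lemma slack_perturb:
  assumes pm: "pseudometric_on Q \<delta>" and sub: "f ` fst ` set l \<subseteq> Q" "g ` fst ` set l \<subseteq> Q"
    and close: "\<And>t. t \<in> fst ` set l \<Longrightarrow> \<delta> (f t) (g t) \<le> e" and e: "0 \<le> e"
  shows "slack \<delta> (map (map_prod f id) l) \<le> slack \<delta> (map (map_prod g id) l) + 2 * e"
proof (rule slack_leI)
  show "0 \<le> slack \<delta> (map (map_prod g id) l) + 2 * e" using slack_nonneg[of \<delta>] e by (simp add: add_nonneg_nonneg)
  fix p r q s assume p: "(p, r) \<in> set (map (map_prod f id) l)" and q: "(q, s) \<in> set (map (map_prod f id) l)"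
  obtain p' where p': "(p', r) \<in> set l" "p = f p'" using p by auto
  obtain q' where q': "(q', s) \<in> set l" "q = f q'" using q by auto
  have fst: "p' \<in> fst ` set l" "q' \<in> fst ` set l" using p' q' by force+
  then have Q: "f p' \<in> Q" "g p' \<in> Q" "f q' \<in> Q" "g q' \<in> Q" using sub by blast+
  have "(g p', r) \<in> set (map (map_prod g id) l)" "(g q', s) \<in> set (map (map_prod g id) l)"
    using p' q' by force+
  then have "\<delta> (g p') (g q') - of_rat r - of_rat s \<le> slack \<delta> (map (map_prod g id) l)"
    by (rule slack_ge)
  moreover have "\<delta> (f p') (f q') \<le> \<delta> (f p') (g p') + \<delta> (g p') (f q')"
    "\<delta> (g p') (f q') \<le> \<delta> (g p') (g q') + \<delta> (g q') (f q')" "\<delta> (g q') (f q') = \<delta> (f q') (g q')"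
    using pseudometric_onD(4)[OF pm] pseudometric_onD(5)[OF pm] Q by blast+
  ultimately show "\<delta> p q - of_rat r - of_rat s \<le> slack \<delta> (map (map_prod g id) l) + 2 * e"
    using close[OF fst(1)] close[OF fst(2)] p'(2) q'(2) by simp
qed

lemma kval_perturb:
  assumes pm: "pseudometric_on Q \<delta>" and sub: "f ` fst ` set l \<subseteq> Q" "g ` fst ` set l \<subseteq> Q"
    and close: "\<And>t. t \<in> fst ` set l \<Longrightarrow> \<delta> (f t) (g t) \<le> e" and e: "0 \<le> e" and p: "p \<in> Q"
  shows "kval \<delta> (relax \<delta> (map (map_prod f id) l)) p \<le> kval \<delta> (relax \<delta> (map (map_prod g id) l)) p + 3 * e"
proof (cases rule: disjE[OF kval_cases[of \<delta> "relax \<delta> (map (map_prod g id) l)" p]])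
  case 1
  then show ?thesis using kval_le_1[of \<delta> "relax \<delta> (map (map_prod f id) l)" p] e by simp
next
  case 2
  then obtain q w where qw: "(q, w) \<in> set (relax \<delta> (map (map_prod g id) l))"
    "kval \<delta> (relax \<delta> (map (map_prod g id) l)) p = w + \<delta> q p" by blast
  then obtain q' r where q': "(q', r) \<in> set l" "q = g q'" "w = of_rat r + slack \<delta> (map (map_prod g id) l)"
    unfolding relax_def by auto
  have fst: "q' \<in> fst ` set l" using q' by force
  then have Q: "f q' \<in> Q" "g q' \<in> Q" using sub by blast+
  have "(f q', of_rat r + slack \<delta> (map (map_prod f id) l)) \<in> set (relax \<delta> (map (map_prod f id) l))"
    unfolding relax_def using q'(1) by force
  from kval_le[OF this, of \<delta> p] have
    "kval \<delta> (relax \<delta> (map (map_prod f id) l)) p \<le> of_rat r + slack \<delta> (map (map_prod f id) l) + \<delta> (f q') p" .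
  moreover have "\<delta> (f q') p \<le> \<delta> (f q') (g q') + \<delta> (g q') p"
    using pseudometric_onD(5)[OF pm] Q p by blast
  ultimately show ?thesis
    using slack_perturb[OF pm sub close e] close[OF fst] qw(2) q'(2,3) by simp
qed

text \<open>
  Moving the children of a node by at most \<open>e\<close> changes the slack by at most \<open>2 e\<close> and each distance to a
  child by at most \<open>e\<close>; this is the source of the factor 3 per level in \<open>tdist_perturb\<close>.
\<close>
lemma kdist_perturb:
  assumes pm: "pseudometric_on Q \<delta>" and sub: "f ` fst ` set l \<subseteq> Q" "g ` fst ` set l \<subseteq> Q"
    and close: "\<And>t. t \<in> fst ` set l \<Longrightarrow> \<delta> (f t) (g t) \<le> e" and e: "0 \<le> e"
  shows "kdist \<delta> (relax \<delta> (map (map_prod f id) l)) (relax \<delta> (map (map_prod g id) l)) \<le> 3 * e"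
proof (rule kdist_leI[OF pm])
  show "0 \<le> 3 * e" using e by simp
  fix p assume "p \<in> fst ` (set (relax \<delta> (map (map_prod f id) l)) \<union> set (relax \<delta> (map (map_prod g id) l)))"
  then have p: "p \<in> Q" using sub by (force simp: relax_def)
  have "\<delta> (g t) (f t) \<le> e" if t: "t \<in> fst ` set l" for t
  proof -
    have "f t \<in> Q" "g t \<in> Q" using t sub by blast+
    then show ?thesis using close[OF t] pseudometric_onD(4)[OF pm] by metis
  qed
  then have "kval \<delta> (relax \<delta> (map (map_prod g id) l)) p \<le> kval \<delta> (relax \<delta> (map (map_prod f id) l)) p + 3 * e"
    by (intro kval_perturb[OF pm sub(2,1) _ e p])
  then show "\<bar>kval \<delta> (relax \<delta> (map (map_prod f id) l)) p - kval \<delta> (relax \<delta> (map (map_prod g id) l)) p\<bar> \<le> 3 * e"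
    using kval_perturb[OF pm sub close e p] by linarith
qed

lemma tdist_perturb:
  assumes d: "pseudometric_on UNIV d" and e: "0 \<le> e"
    and close: "\<And>i. i \<in> set_trm t \<Longrightarrow> d (b i) (c i) \<le> e"
  shows "tdist d (map_trm b t) (map_trm c t) \<le> 3 ^ lev t * e"
  using close
proof (induction t rule: measure_induct_rule[of lev])
  case (less t)
  show ?case
  proof (cases t)
    case (Pt a)
    then show ?thesis using less.prems d by simp
  next
    case (Kat l)
    obtain n where n: "lev t = Suc n" using Kat by (cases "lev t") auto
    have lv: "lev p \<le> n" if p: "p \<in> fst ` set l" for p using lev_args[of _ t] n p Kat by force
    have "tower d n (map_trm b p) (map_trm c p) \<le> 3 ^ n * e" if p: "p \<in> fst ` set l" for p
    proof -
      have "tower d n (map_trm b p) (map_trm c p) = tdist d (map_trm b p) (map_trm c p)"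
        using lv[OF p] by (intro tower_eq_tdist[OF d]) (auto simp: lev_map_trm)
      also have "\<dots> \<le> 3 ^ lev p * e"
        using lv[OF p] n set_args[of _ t] Kat p by (intro less.IH less.prems) force+
      also have "\<dots> \<le> 3 ^ n * e" using lv[OF p] e by (intro mult_right_mono power_increasing) auto
      finally show ?thesis .
    qed
    moreover have "map_trm b ` fst ` set l \<subseteq> {t. lev t \<le> n}" "map_trm c ` fst ` set l \<subseteq> {t. lev t \<le> n}"
      using lv unfolding image_subset_iff by (simp_all add: lev_map_trm)
    ultimately have "kdist (tower d n) (relax (tower d n) (map (map_prod (map_trm b) id) l))
        (relax (tower d n) (map (map_prod (map_trm c) id) l)) \<le> 3 * (3 ^ n * e)"
      using e by (intro kdist_perturb[OF pseudometric_on_tower[OF d]]) auto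
    moreover have "tdist d (map_trm b t) (map_trm c t) = tower d (Suc n) (map_trm b t) (map_trm c t)"
      using n by (intro tower_eq_tdist[OF d, symmetric]) (auto simp: lev_map_trm)
    moreover have "descr (tower d n) n (map_trm f t) = relax (tower d n) (map (map_prod (map_trm f) id) l)" for f :: "'b \<Rightarrow> 'a"
      using n Kat by (simp add: descr_def lev_map_trm args_map_trm del: lev.simps trm.map)
    ultimately show ?thesis using n by simp
  qed
qed

lemma measurable_Max_insert:
  fixes f :: "'w \<Rightarrow> 'i \<Rightarrow> real"
  assumes "finite A" "\<And>i. i \<in> A \<Longrightarrow> (\<lambda>w. f w i) \<in> borel_measurable W"
  shows "(\<lambda>w. Max (insert c (f w ` A))) \<in> borel_measurable W \<and>
    (\<lambda>w. Min (insert c (f w ` A))) \<in> borel_measurable W"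
  using assms
proof (induction A)
  case (insert a A)
  have "Max (insert c (f w ` insert a A)) = max (f w a) (Max (insert c (f w ` A)))"
    "Min (insert c (f w ` insert a A)) = min (f w a) (Min (insert c (f w ` A)))" for w
    using insert.hyps by (simp_all add: insert_commute[of c])
  moreover have "(\<lambda>w. Max (insert c (f w ` A))) \<in> borel_measurable W"
    "(\<lambda>w. Min (insert c (f w ` A))) \<in> borel_measurable W" "(\<lambda>w. f w a) \<in> borel_measurable W"
    using insert.IH insert.prems by blast+
  ultimately show ?case
    by (simp_all only: borel_measurable_max borel_measurable_min)
qed simp

lemma measurable_tower:
  fixes d :: "'w \<Rightarrow> 'p \<Rightarrow> 'p \<Rightarrow> real"
  assumes "\<And>a b. (\<lambda>w. d w a b) \<in> borel_measurable W"
  shows "(\<lambda>w. tower (d w) n t s) \<in> borel_measurable W"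
proof (induction n arbitrary: t s)
  case 0
  show ?case using assms by (cases t; cases s) auto
next
  case (Suc n)
  note [measurable] = Suc
  have slack: "(\<lambda>w. slack (tower (d w) n) l) \<in> borel_measurable W" for l
    unfolding slack_def by (rule measurable_Max_insert[THEN conjunct1]) (auto simp: split_def)
  note [measurable] = slack
  have kval: "(\<lambda>w. kval (tower (d w) n) (descr (tower (d w) n) n t) p) \<in> borel_measurable W" for t p
  proof (cases "lev t \<le> n")
    case True
    then show ?thesis by (simp add: descr_def kval_def)
  next
    case False
    then have "kval (tower (d w) n) (descr (tower (d w) n) n t) p =
       Min (insert 1 ((\<lambda>(q, r). of_rat r + slack (tower (d w) n) (args t) + tower (d w) n q p) ` set (args t)))" for w
      by (simp add: descr_def kval_def relax_def image_image split_def)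
    then show ?thesis by (simp only:) (rule measurable_Max_insert[THEN conjunct2]; auto simp: split_def)
  qed
  have supp: "fst ` set (descr \<delta> n t) = (if lev t \<le> n then {t} else fst ` set (args t))" for \<delta> and t :: "'p trm"
    by (auto simp: descr_def relax_def image_image split_def)
  show ?case
    unfolding tower.simps kdist_def image_Un[of fst] supp
    by (rule measurable_Max_insert[THEN conjunct1]) (use kval in auto)
qed

lemma measurable_tdist:
  assumes "\<And>a b. (\<lambda>w. d w a b) \<in> borel_measurable W"
  shows "(\<lambda>w. tdist (d w) t s) \<in> borel_measurable W"
  unfolding tdist_def by (rule measurable_tower[OF assms])

section \<open>Selection by least index and limits\<close>

text \<open>
  A countable set of states makes selection by least index measurable: the event that index \<open>k\<close> is chosen
  involves only finitely many of the conditions \<open>S\<close>. The invariant \<open>P\<close>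
  guarantees that the choice never gets stuck.
\<close>
lemma measurable_choice_sequence:
  fixes S :: "'w \<Rightarrow> nat \<Rightarrow> 'c::countable \<Rightarrow> 'c \<Rightarrow> bool"
  assumes meas: "\<And>m s t. {w \<in> space W. S w m s t} \<in> sets W"
    and init: "\<And>w. w \<in> space W \<Longrightarrow> P w 0 s0"
    and ex: "\<And>w m s. w \<in> space W \<Longrightarrow> P w m s \<Longrightarrow> \<exists>t. S w m s t"
    and inv: "\<And>w m s t. w \<in> space W \<Longrightarrow> P w m s \<Longrightarrow> S w m s t \<Longrightarrow> P w (Suc m) t"
  obtains \<sigma> :: "'w \<Rightarrow> nat \<Rightarrow> 'c" where
    "\<And>w. \<sigma> w 0 = s0" "\<And>w m. w \<in> space W \<Longrightarrow> S w m (\<sigma> w m) (\<sigma> w (Suc m))"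
    "\<And>m. (\<lambda>w. \<sigma> w m) \<in> measurable W (count_space UNIV)"
proof
  define next' where "next' = (\<lambda>w m s. from_nat (LEAST k. S w m s (from_nat k)) :: 'c)"
  define \<sigma> where "\<sigma> = (\<lambda>w. rec_nat s0 (next' w))"
  have \<sigma>Suc: "\<sigma> w (Suc m) = next' w m (\<sigma> w m)" for w m by (simp add: \<sigma>_def)
  show \<sigma>0: "\<sigma> w 0 = s0" for w by (simp add: \<sigma>_def)
  have next': "S w m s (next' w m s)" if "w \<in> space W" "P w m s" for w m s
  proof -
    from ex[OF that] obtain t where "S w m s t" by blast
    then have "S w m s (from_nat (to_nat t))" by simp
    then show ?thesis unfolding next'_def by (rule LeastI)
  qed
  have P: "P w m (\<sigma> w m)" if "w \<in> space W" for w m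
    by (induction m) (use that init inv next' in \<open>auto simp: \<sigma>0 \<sigma>Suc\<close>)
  show "S w m (\<sigma> w m) (\<sigma> w (Suc m))" if "w \<in> space W" for w m
    using next'[OF that P[OF that]] by (simp add: \<sigma>Suc)
  have "{w \<in> space W. \<sigma> w m = s} \<in> sets W" for m s
  proof (induction m arbitrary: s)
    case 0
    then show ?case by (cases "s0 = s") (auto simp: \<sigma>0)
  next
    case (Suc m)
    have "{w \<in> space W. \<sigma> w (Suc m) = s} =
      (\<Union>t. \<Union>k\<in>{k. from_nat k = s}. {w \<in> space W. \<sigma> w m = t} \<inter> {w \<in> space W. S w m t (from_nat k)} \<inter>
          (space W - (\<Union>j<k. {w \<in> space W. S w m t (from_nat j)})))" (is "?L = ?R")
    proof (intro equalityI subsetI)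
      fix w assume w: "w \<in> ?L"
      define k where "k = (LEAST k. S w m (\<sigma> w m) (from_nat k))"
      have "S w m (\<sigma> w m) (from_nat k)" "from_nat k = s"
        using w next'[of w m "\<sigma> w m"] P[of w m] unfolding k_def by (auto simp: \<sigma>Suc next'_def)
      moreover have "\<not> S w m (\<sigma> w m) (from_nat j)" if "j < k" for j
        using that unfolding k_def by (rule not_less_Least)
      ultimately show "w \<in> ?R" using w by (intro UN_I[of "\<sigma> w m"] UN_I[of k]) auto
    next
      fix w assume "w \<in> ?R"
      then obtain t k where k: "from_nat k = s" "w \<in> space W" "\<sigma> w m = t" "S w m t (from_nat k)"
        "\<And>j. j < k \<Longrightarrow> \<not> S w m t (from_nat j)" by auto
      then have "(LEAST k. S w m t (from_nat k)) = k"
        by (intro Least_equality) (use not_less in blast)+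
      then show "w \<in> ?L" using k by (simp add: \<sigma>Suc next'_def)
    qed
    also have "\<dots> \<in> sets W"
    proof -
      have A: "{w \<in> space W. \<sigma> w m = t} \<inter> {w \<in> space W. S w m t (from_nat k)} \<inter>
          (space W - (\<Union>j<k. {w \<in> space W. S w m t (from_nat j)})) \<in> sets W" for t k
        by (intro sets.Int sets.Diff sets.top sets.finite_UN Suc.IH meas finite_lessThan)
      show ?thesis by (intro sets.countable_UN' countableI_type image_subsetI A)
    qed
    finally show ?case .
  qed
  then show "(\<lambda>w. \<sigma> w m) \<in> measurable W (count_space UNIV)" for m
    by (auto simp: measurable_count_space_eq2_countable vimage_def Int_def conj_commute)
qed

lemma mdist_self: "x \<in> mspace U \<Longrightarrow> mdist U x x = 0"
  by simp

lemma mdist_diff_le: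
  assumes "a \<in> mspace U" "b \<in> mspace U" "z \<in> mspace U"
  shows "\<bar>mdist U a z - mdist U b z\<bar> \<le> mdist U a b"
  using mdist_triangle[OF assms(1,2,3)] mdist_triangle[OF assms(2,1,3)] mdist_commute[of U a b] by linarith

lemma geometric_small: "0 < (e :: real) \<Longrightarrow> \<exists>n. c * (1/2) ^ n < e"
proof -
  assume e: "0 < e"
  have "(\<lambda>n. c * (1/2) ^ n) \<longlonglongrightarrow> (0::real)"
    using tendsto_mult_right_zero[OF LIMSEQ_realpow_zero[of "1/2"]] by simp
  from order_tendstoD(2)[OF this e] show ?thesis by (auto simp: eventually_sequentially)
qed

lemma geometric_sequence_limit:
  assumes U: "mcomplete_of U" and a: "\<And>n. N \<le> n \<Longrightarrow> a n \<in> mspace U"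
    and step: "\<And>n. N \<le> n \<Longrightarrow> mdist U (a n) (a (Suc n)) \<le> C * (1/2) ^ n"
  shows "\<exists>l\<in>mspace U. \<forall>n\<ge>N. mdist U (a n) l \<le> 2 * C * (1/2) ^ n"
proof -
  interpret Metric_space "mspace U" "mdist U" by (rule Metric_space_mspace_mdist)
  have "0 \<le> mdist U (a N) (a (Suc N))" by simp
  then have C: "0 \<le> C" using step[of N] by (smt (verit) mult_neg_pos zero_less_power half_gt_zero_iff le_refl zero_less_one)
  have far: "mdist U (a n) (a (n + k)) \<le> 2 * C * ((1/2) ^ n - (1/2) ^ (n + k))" if "N \<le> n" for n k
  proof (induction k)
    case (Suc k)
    have "mdist U (a n) (a (Suc (n + k))) \<le> mdist U (a n) (a (n + k)) + mdist U (a (n + k)) (a (Suc (n + k)))"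
      using that a by (intro mdist_triangle) auto
    also have "\<dots> \<le> 2 * C * ((1/2) ^ n - (1/2) ^ (n + k)) + C * (1/2) ^ (n + k)"
      using Suc step[of "n + k"] that by simp
    also have "\<dots> = 2 * C * ((1/2) ^ n - (1/2) ^ (n + Suc k))" by (simp add: field_simps)
    finally show ?case by simp
  qed (use that a in simp)
  have far': "mdist U (a n) (a m) \<le> 2 * C * (1/2) ^ n" if "N \<le> n" "n \<le> m" for n m
  proof -
    have "2 * C * ((1/2) ^ n - (1/2) ^ m) \<le> 2 * C * (1/2) ^ n" using C by (intro mult_left_mono) auto
    then show ?thesis using far[of n "m - n"] that by simp
  qed
  have lim: "(\<lambda>n. 2 * C * (1/2) ^ n) \<longlonglongrightarrow> 0"
    using tendsto_mult_right_zero[OF LIMSEQ_realpow_zero[of "1/2"]] by simp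
  have "MCauchy (\<lambda>n. a (N + n))"
    unfolding MCauchy_def
  proof (intro conjI allI impI)
    show "range (\<lambda>n. a (N + n)) \<subseteq> mspace U" using a by auto
    fix e :: real assume e: "0 < e"
    then obtain K where K: "\<And>n. K \<le> n \<Longrightarrow> 2 * C * (1/2) ^ n < e"
      using order_tendstoD(2)[OF lim e] by (auto simp: eventually_sequentially)
    have "mdist U (a (N + n)) (a (N + n')) < e" if "K \<le> n" "n \<le> n'" for n n'
      using far'[of "N + n" "N + n'"] K[of "N + n"] that by simp
    then show "\<exists>K. \<forall>n n'. K \<le> n \<longrightarrow> K \<le> n' \<longrightarrow> mdist U (a (N + n)) (a (N + n')) < e"
      by (metis nle_le mdist_commute)
  qed
  then obtain l where "limitin mtopology (\<lambda>n. a (N + n)) l sequentially"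
    using U unfolding mcomplete_of_def mcomplete_def by blast
  then have l: "l \<in> mspace U" "\<And>e. 0 < e \<Longrightarrow> \<exists>K. \<forall>n\<ge>K. mdist U (a (N + n)) l < e"
    unfolding limit_metric_sequentially by blast+
  have "mdist U (a n) l \<le> 2 * C * (1/2) ^ n" if n: "N \<le> n" for n
  proof (rule field_le_epsilon)
    fix e :: real assume "0 < e"
    then obtain K where K: "\<And>k. K \<le> k \<Longrightarrow> mdist U (a (N + k)) l < e" using l(2) by blast
    define m where "m = N + max n K"
    have "mdist U (a n) l \<le> mdist U (a n) (a m) + mdist U (a m) l"
      using a n l(1) by (intro mdist_triangle) (auto simp: m_def)
    also have "\<dots> \<le> 2 * C * (1/2) ^ n + e"
    proof -
      have "n \<le> m" unfolding m_def by linarith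
      then show ?thesis
      using far'[OF n, of m] K[of "max n K"] by (simp add: m_def)
    qed
    finally show "mdist U (a n) l \<le> 2 * C * (1/2) ^ n + e" .
  qed
  then show ?thesis using l(1) by blast
qed

section \<open>Finite isometric embeddings into the Urysohn sphere\<close>

definition approx_ext :: "('c \<Rightarrow> 'c \<Rightarrow> real) \<Rightarrow> bool" where
  "approx_ext \<delta> \<longleftrightarrow> (\<forall>F u e. finite F \<and> (\<forall>p\<in>F. 0 \<le> u p \<and> u p \<le> 1) \<and>
     (\<forall>p\<in>F. \<forall>q\<in>F. \<bar>u p - u q\<bar> \<le> \<delta> p q \<and> \<delta> p q \<le> u p + u q) \<and> 0 < e \<longrightarrow>
     (\<exists>t. \<forall>p\<in>F. \<bar>\<delta> t p - u p\<bar> \<le> e))"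

lemma approx_extD:
  assumes "approx_ext \<delta>" "finite F" "\<And>p. p \<in> F \<Longrightarrow> 0 \<le> u p \<and> u p \<le> 1"
    "\<And>p q. p \<in> F \<Longrightarrow> q \<in> F \<Longrightarrow> \<bar>u p - u q\<bar> \<le> \<delta> p q \<and> \<delta> p q \<le> u p + u q" "0 < e"
  shows "\<exists>t. \<forall>p\<in>F. \<bar>\<delta> t p - u p\<bar> \<le> e"
  using assms unfolding approx_ext_def by blast

lemma approx_ext_tdist: "pseudometric_on UNIV d \<Longrightarrow> approx_ext (tdist d)"
  unfolding approx_ext_def using approximate_extension by blast

definition exact_on :: "'u metric \<Rightarrow> ('c \<Rightarrow> 'c \<Rightarrow> real) \<Rightarrow> 'c set \<Rightarrow> ('c \<Rightarrow> 'u) \<Rightarrow> bool" where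
  "exact_on U \<delta> I z \<longleftrightarrow> z ` I \<subseteq> mspace U \<and> (\<forall>a\<in>I. \<forall>b\<in>I. mdist U (z a) (z b) = \<delta> a b)"

lemma exact_onD:
  assumes "exact_on U \<delta> I z" 
  shows "a \<in> I \<Longrightarrow> z a \<in> mspace U" "a \<in> I \<Longrightarrow> b \<in> I \<Longrightarrow> mdist U (z a) (z b) = \<delta> a b"
  using assms unfolding exact_on_def by blast+

context
  fixes U :: "'u metric"
  assumes U: "urysohn_sphere U"
begin

lemma urysohn_le_1: "x \<in> mspace U \<Longrightarrow> y \<in> mspace U \<Longrightarrow> mdist U x y \<le> 1"
  using U unfolding urysohn_sphere_def diameter_le1_def by blast

text \<open>
  The extension property for families of points. Repetitions in the family \<open>p\<close> are harmless, as the
  Lipschitz condition forces \<open>u\<close> to agree on equal points.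
\<close>
lemma urysohn_realize:
  fixes p :: "'k \<Rightarrow> 'u" and u :: "'k \<Rightarrow> real"
  assumes K: "finite K" and p: "\<And>k. k \<in> K \<Longrightarrow> p k \<in> mspace U"
    and u: "\<And>k. k \<in> K \<Longrightarrow> 0 \<le> u k \<and> u k \<le> 1"
    and lip: "\<And>k l. k \<in> K \<Longrightarrow> l \<in> K \<Longrightarrow> \<bar>u k - u l\<bar> \<le> mdist U (p k) (p l) \<and> mdist U (p k) (p l) \<le> u k + u l"
  shows "\<exists>z\<in>mspace U. \<forall>k\<in>K. mdist U z (p k) = u k"
proof -
  define v where "v = (\<lambda>q. u (SOME k. k \<in> K \<and> p k = q))"
  have v: "v (p k) = u k" if k: "k \<in> K" for k
  proof -
    have "(SOME l. l \<in> K \<and> p l = p k) \<in> K \<and> p (SOME l. l \<in> K \<and> p l = p k) = p k"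
      by (rule someI[of _ k]) (use k in simp)
    then have "\<bar>v (p k) - u k\<bar> \<le> mdist U (p k) (p k)"
      unfolding v_def using lip[of "SOME l. l \<in> K \<and> p l = p k" k] k by simp
    then show ?thesis using mdist_self[OF p[OF k]] by simp
  qed
  have "finite (p ` K) \<and> p ` K \<subseteq> mspace U \<and> v \<in> p ` K \<rightarrow> {0..1} \<and>
        (\<forall>a \<in> p ` K. \<forall>b \<in> p ` K. \<bar>v a - v b\<bar> \<le> mdist U a b) \<and>
        (\<forall>a \<in> p ` K. \<forall>b \<in> p ` K. mdist U a b \<le> v a + v b)"
    using K p u lip v by auto
  then have "\<exists>z \<in> mspace U. \<forall>a \<in> p ` K. mdist U z a = v a"
    using U unfolding urysohn_sphere_def by blast
  then show ?thesis using v by auto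
qed

lemma urysohn_nonempty: "mspace U \<noteq> {}"
  using urysohn_realize[of "{} :: nat set" "\<lambda>_. undefined" "\<lambda>_. 0"] by blast

lemma urysohn_dense_sequence:
  obtains D :: "nat \<Rightarrow> 'u" where "\<And>n. D n \<in> mspace U"
    "\<And>z e. z \<in> mspace U \<Longrightarrow> 0 < e \<Longrightarrow> \<exists>n. mdist U z (D n) < e"
proof -
  interpret Metric_space "mspace U" "mdist U" by (rule Metric_space_mspace_mdist)
  obtain C where C: "countable C" "C \<subseteq> mspace U" "mtopology closure_of C = mspace U"
    using U unfolding urysohn_sphere_def separable_space_def mtopology_of_def by auto
  have dense: "\<exists>y\<in>C. mdist U z y < e" if "z \<in> mspace U" "0 < e" for z e
    using C(3) that unfolding metric_closure_of by (force simp: in_mball)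
  then have "C \<noteq> {}" using urysohn_nonempty zero_less_one by blast
  show thesis
  proof
    show "from_nat_into C n \<in> mspace U" for n using from_nat_into[OF \<open>C \<noteq> {}\<close>] C(2) by blast
    show "\<exists>n. mdist U z (from_nat_into C n) < e" if "z \<in> mspace U" "0 < e" for z e
      using dense[OF that] from_nat_into_surj[OF C(1)] by metis
  qed
qed

context
  fixes \<delta> :: "'c \<Rightarrow> 'c \<Rightarrow> real"
  assumes \<delta>: "pseudometric_on UNIV \<delta>"
begin

lemma delta:
  "\<delta> a a = 0" "0 \<le> \<delta> a b" "\<delta> a b \<le> 1" "\<delta> a b = \<delta> b a" "\<delta> a c \<le> \<delta> a b + \<delta> b c"
  using \<delta> unfolding pseudometric_on_def by blast+

text \<open>
  The point \<open>i\<close> can be added to an exact embedding next to any target \<open>w\<close> whose distances to the image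
  are nearly right. The value required at \<open>w\<close> is the actual largest error \<open>m\<close>, not the bound \<open>c\<close>, because
  for \<open>m\<close> the Katetov inequalities follow from the triangle inequality.
\<close>
lemma exact_insert_near:
  assumes z: "exact_on U \<delta> I z" and I: "finite I" and i: "i \<notin> I" and w: "w \<in> mspace U" and c: "0 \<le> c"
    and close: "\<And>a. a \<in> I \<Longrightarrow> \<bar>\<delta> i a - mdist U w (z a)\<bar> \<le> c"
  shows "\<exists>y\<in>mspace U. exact_on U \<delta> (insert i I) (z(i := y)) \<and> mdist U y w \<le> c"
proof -
  note zD = exact_onD[OF z]
  define m where "m = Max (insert 0 ((\<lambda>a. \<bar>\<delta> i a - mdist U w (z a)\<bar>) ` I))"
  have m0: "0 \<le> m" unfolding m_def using I by (intro Max_ge) auto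
  have m_ge: "\<bar>\<delta> i a - mdist U w (z a)\<bar> \<le> m" if "a \<in> I" for a unfolding m_def using I that by (intro Max_ge) auto
  have m_le: "m \<le> b" if "0 \<le> b" "\<And>a. a \<in> I \<Longrightarrow> \<bar>\<delta> i a - mdist U w (z a)\<bar> \<le> b" for b
    unfolding m_def using I that by (subst Max_le_iff) auto
  have m1: "m \<le> 1"
  proof (rule m_le)
    fix a assume "a \<in> I"
    then show "\<bar>\<delta> i a - mdist U w (z a)\<bar> \<le> 1"
      using delta(2)[of i a] delta(3)[of i a] mdist_nonneg[of U w "z a"] urysohn_le_1[OF w zD(1), of a] by linarith
  qed simp
  have mk: "m \<le> \<delta> i a + mdist U w (z a)" if a: "a \<in> I" for a
  proof (rule m_le)
    show "0 \<le> \<delta> i a + mdist U w (z a)" using delta(2)[of i a] by simp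
    fix b assume b: "b \<in> I"
    have "mdist U w (z b) \<le> mdist U w (z a) + \<delta> a b" "mdist U w (z a) \<le> mdist U w (z b) + \<delta> b a"
      using mdist_triangle[OF w zD(1)[OF a] zD(1)[OF b]] mdist_triangle[OF w zD(1)[OF b] zD(1)[OF a]] zD(2) a b by auto
    then show "\<bar>\<delta> i b - mdist U w (z b)\<bar> \<le> \<delta> i a + mdist U w (z a)"
      using delta(5)[of i b a] delta(5)[of a b i] delta(4)[of a i] delta(4)[of b i] delta(4)[of a b] mdist_triangle[OF zD(1)[OF a] w zD(1)[OF b]]
       mdist_commute[of U w "z a"] zD(2)[OF a b] by linarith
  qed
  define p where "p = (\<lambda>k. case k of None \<Rightarrow> w | Some a \<Rightarrow> z a)"
  define u where "u = (\<lambda>k. case k of None \<Rightarrow> m | Some a \<Rightarrow> \<delta> i a)"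
  have "\<exists>y\<in>mspace U. \<forall>k\<in>insert None (Some ` I). mdist U y (p k) = u k"
  proof (rule urysohn_realize)
    show "finite (insert None (Some ` I))" using I by simp
    show "p k \<in> mspace U" if "k \<in> insert None (Some ` I)" for k using that zD(1) w by (auto simp: p_def)
    show "0 \<le> u k \<and> u k \<le> 1" if "k \<in> insert None (Some ` I)" for k using that m0 m1 delta(2,3) by (auto simp: u_def)
    have sym: "mdist U (z a) w = mdist U w (z a)" for a by (rule mdist_commute)
    have A: "\<bar>m - \<delta> i a\<bar> \<le> mdist U w (z a)" "mdist U w (z a) \<le> m + \<delta> i a" if "a \<in> I" for a
      using m_ge[OF that] mk[OF that] m0 by linarith+
    have B: "\<bar>\<delta> i a - \<delta> i b\<bar> \<le> \<delta> a b" "\<delta> a b \<le> \<delta> i a + \<delta> i b" for a b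
      using delta(5)[of i a b] delta(5)[of i b a] delta(5)[of a b i] delta(4)[of a b] delta(4)[of a i] by linarith+
    show "\<bar>u k - u l\<bar> \<le> mdist U (p k) (p l) \<and> mdist U (p k) (p l) \<le> u k + u l"
      if "k \<in> insert None (Some ` I)" "l \<in> insert None (Some ` I)" for k l
      using that A B m0 w by (cases k; cases l) (auto simp: u_def p_def sym zD(2) mdist_self abs_minus_commute add.commute)
  qed
  then obtain y where y: "y \<in> mspace U" "mdist U y w = m" "\<And>a. a \<in> I \<Longrightarrow> mdist U y (z a) = \<delta> i a"
    by (auto simp: p_def u_def)
  have sym: "mdist U (z a) y = \<delta> a i" if "a \<in> I" for a using y(3)[OF that] mdist_commute[of U y] delta(4)[of i a] by simp
  have "exact_on U \<delta> (insert i I) (z(i := y))"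
    using y zD i delta(1) sym unfolding exact_on_def by auto
  moreover have "m \<le> c" by (rule m_le[OF c close])
  ultimately show ?thesis using y by auto
qed

text \<open>
  Each newly corrected point may be off by \<open>e\<close> more than the previous ones, whence the bound \<open>e * length s\<close>.
  The definition of \<open>good_match\<close> anticipates this loss by dividing by the length.
\<close>
lemma exact_from_approximate:
  fixes D :: "'j \<Rightarrow> 'u"
  assumes "\<And>j. D j \<in> mspace U" and "0 \<le> e"
    and "\<And>i j i' j'. (i, j) \<in> set s \<Longrightarrow> (i', j') \<in> set s \<Longrightarrow> \<bar>\<delta> i i' - mdist U (D j) (D j')\<bar> \<le> e"
  shows "\<exists>z. exact_on U \<delta> (fst ` set s) z \<and> (\<forall>(i, j)\<in>set s. mdist U (z i) (D j) \<le> e * length s)"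
  using assms(3)
proof (induction s)
  case Nil
  then show ?case by (auto simp: exact_on_def)
next
  case (Cons ij s)
  obtain i j where ij: "ij = (i, j)" by force
  obtain z where z: "exact_on U \<delta> (fst ` set s) z" "\<And>i j. (i, j) \<in> set s \<Longrightarrow> mdist U (z i) (D j) \<le> e * length s"
    using Cons.IH Cons.prems by (fastforce simp: ij)
  note zD = exact_onD[OF z(1)]
  have len: "e * length s \<le> e * length (ij # s)" using assms(2) by (intro mult_left_mono) auto
  show ?case
  proof (cases "i \<in> fst ` set s")
    case True
    then obtain j' where j': "(i, j') \<in> set s" by force
    have "mdist U (z i) (D j) \<le> mdist U (z i) (D j') + mdist U (D j') (D j)"
      using zD(1)[OF True] assms(1) by (intro mdist_triangle)
    moreover have "mdist U (D j') (D j) \<le> e" using Cons.prems[of i j' i j] j' delta(1)[of i] by (simp add: ij)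
    ultimately have "mdist U (z i) (D j) \<le> e * length (ij # s)" using z(2)[OF j'] by (simp add: algebra_simps)
    moreover have "mdist U (z a) (D b) \<le> e * length (ij # s)" if "(a, b) \<in> set s" for a b
      using z(2)[OF that] len by linarith
    ultimately show ?thesis
      using z(1) True by (intro exI[of _ z]) (auto simp: ij insert_absorb simp del: length_Cons)
  next
    case False
    have "\<exists>y\<in>mspace U. exact_on U \<delta> (insert i (fst ` set s)) (z(i := y)) \<and> mdist U y (D j) \<le> e * length (ij # s)"
    proof (rule exact_insert_near[OF z(1) _ False assms(1)])
      show "0 \<le> e * length (ij # s)" using assms(2) by simp
      fix a assume a: "a \<in> fst ` set s"
      then obtain j' where j': "(a, j') \<in> set s" by force
      have "\<bar>\<delta> i a - mdist U (D j) (D j')\<bar> \<le> e" using Cons.prems[of i j a j'] j' by (simp add: ij)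
      moreover have "mdist U (D j) (D j') \<le> mdist U (D j) (z a) + mdist U (z a) (D j')"
        "mdist U (D j) (z a) \<le> mdist U (D j) (D j') + mdist U (D j') (z a)"
        using zD(1)[OF a] assms(1) by (intro mdist_triangle; simp)+
      ultimately show "\<bar>\<delta> i a - mdist U (D j) (z a)\<bar> \<le> e * length (ij # s)"
        using z(2)[OF j'] mdist_commute[of U "z a" "D j'"] by (simp add: algebra_simps)
    qed simp
    then obtain y where y: "exact_on U \<delta> (insert i (fst ` set s)) (z(i := y))" "mdist U y (D j) \<le> e * length (ij # s)" by blast
    moreover have "mdist U ((z(i := y)) a) (D b) \<le> e * length (ij # s)" if "(a, b) \<in> set s" for a b
      using z(2)[OF that] len that False by force
    ultimately show ?thesis by (intro exI[of _ "z(i := y)"]) (auto simp: ij fun_upd_same simp del: fun_upd_apply length_Cons)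
  qed
qed

lemma exact_grow_domain:
  assumes "exact_on U \<delta> I z" "finite I" "finite J"
  shows "\<exists>z'. exact_on U \<delta> (I \<union> J) z' \<and> (\<forall>a\<in>I. z' a = z a)"
  using assms(3)
proof (induction J)
  case (insert i J)
  then obtain z' where z': "exact_on U \<delta> (I \<union> J) z'" "\<forall>a\<in>I. z' a = z a" by blast
  show ?case
  proof (cases "i \<in> I \<union> J")
    case True
    then show ?thesis using z' by (intro exI[of _ z']) (simp add: insert_absorb)
  next
    case False
    obtain w where w: "w \<in> mspace U" using urysohn_nonempty by blast
    have "\<exists>y\<in>mspace U. exact_on U \<delta> (insert i (I \<union> J)) (z'(i := y)) \<and> mdist U y w \<le> 2"
    proof (rule exact_insert_near[OF z'(1) _ False w])
      fix a assume "a \<in> I \<union> J"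
      then show "\<bar>\<delta> i a - mdist U w (z' a)\<bar> \<le> 2"
        using delta(2)[of i a] delta(3)[of i a] mdist_nonneg[of U w "z' a"] urysohn_le_1[OF w exact_onD(1)[OF z'(1)], of a] by linarith
    qed (use assms insert in auto)
    then show ?thesis using z'(2) False by (metis Un_iff Un_insert_right fun_upd_apply)
  qed
qed (use assms in auto)

text \<open>
  The back step: the approximate extension property provides a point of the source that looks like the
  target \<open>w\<close>, and \<open>exact_insert_near\<close> places it close to \<open>w\<close>.
\<close>
lemma exact_grow_range:
  assumes "exact_on U \<delta> I z" "finite I" "finite V" "V \<subseteq> mspace U" "0 < e" and ext: "approx_ext \<delta>"
  shows "\<exists>I' z'. finite I' \<and> I \<subseteq> I' \<and> exact_on U \<delta> I' z' \<and> (\<forall>a\<in>I. z' a = z a) \<and> (\<forall>w\<in>V. \<exists>k\<in>I'. mdist U (z' k) w \<le> e)"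
  using assms(3,4)
proof (induction V)
  case (insert w V)
  then obtain I' z' where I: "finite I'" "I \<subseteq> I'" "exact_on U \<delta> I' z'" "\<forall>a\<in>I. z' a = z a" "\<forall>w\<in>V. \<exists>k\<in>I'. mdist U (z' k) w \<le> e"
    by auto
  note zD = exact_onD[OF I(3)]
  have w: "w \<in> mspace U" using insert by simp
  have "\<exists>k. \<forall>a\<in>I'. \<bar>\<delta> k a - mdist U w (z' a)\<bar> \<le> e"
  proof (rule approx_extD[OF ext I(1) _ _ assms(5)])
    fix p q assume pq: "p \<in> I'" "q \<in> I'"
    show "\<bar>mdist U w (z' p) - mdist U w (z' q)\<bar> \<le> \<delta> p q \<and> \<delta> p q \<le> mdist U w (z' p) + mdist U w (z' q)"
      using mdist_triangle[OF w zD(1)[OF pq(1)] zD(1)[OF pq(2)]] mdist_triangle[OF w zD(1)[OF pq(2)] zD(1)[OF pq(1)]]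
        mdist_triangle[OF zD(1)[OF pq(1)] w zD(1)[OF pq(2)]] zD(2)[OF pq] zD(2)[OF pq(2,1)] delta(4)[of p q] mdist_commute[of U w "z' p"]
      by linarith
  qed (use urysohn_le_1[OF w zD(1)] in auto)
  then obtain k where k: "\<And>a. a \<in> I' \<Longrightarrow> \<bar>\<delta> k a - mdist U w (z' a)\<bar> \<le> e" by blast
  show ?case
  proof (cases "k \<in> I'")
    case True
    then have "mdist U (z' k) w \<le> e" using k[OF True] delta(1)[of k] mdist_commute[of U w] by simp
    then show ?thesis using I True by (intro exI[of _ I'] exI[of _ z']) auto
  next
    case False
    obtain y where y: "exact_on U \<delta> (insert k I') (z'(k := y))" "mdist U y w \<le> e"
      using exact_insert_near[OF I(3,1) False w _ k] assms(5) by auto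
    have "\<exists>l\<in>insert k I'. mdist U ((z'(k := y)) l) v \<le> e" if v: "v \<in> insert w V" for v
    proof (cases "v = w")
      case True
      then show ?thesis using y(2) by auto
    next
      case neq: False
      then obtain l where "l \<in> I'" "mdist U (z' l) v \<le> e" using v I(5) by blast
      then show ?thesis using False by (intro bexI[of _ l]) auto
    qed
    moreover have "\<forall>a\<in>I. (z'(k := y)) a = z a" using I(2,4) False by auto
    ultimately show ?thesis
      using I(1,2) y(1) by (intro exI[of _ "insert k I'"] exI[of _ "z'(k := y)"]) blast
  qed
qed (use assms in blast)

end

end

section \<open>Back and forth with a parameter\<close>

text \<open>
  The states of the back-and-forth are finite matchings between the source and the indices of a dense
  sequence \<open>D\<close> of the sphere. They never contain exact images, so there are only countably many of them
  and goodness is a finite Boolean combination of inequalities for \<open>\<delta>\<close>.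
\<close>
definition good_match :: "'u metric \<Rightarrow> (nat \<Rightarrow> 'u) \<Rightarrow> ('c \<Rightarrow> 'c \<Rightarrow> real) \<Rightarrow> nat \<Rightarrow> ('c \<times> nat) list \<Rightarrow> bool" where
  "good_match U D \<delta> m s \<longleftrightarrow>
     (\<forall>(i, j)\<in>set s. \<forall>(i', j')\<in>set s. \<bar>\<delta> i i' - mdist U (D j) (D j')\<bar> \<le> (1/2) ^ m / (1 + length s))"

definition refines_match :: "'u metric \<Rightarrow> (nat \<Rightarrow> 'u) \<Rightarrow> nat \<Rightarrow> ('c::countable \<times> nat) list \<Rightarrow> ('c \<times> nat) list \<Rightarrow> bool" where
  "refines_match U D m s t \<longleftrightarrow>
     (\<forall>(i, j)\<in>set s. \<exists>j'. (i, j') \<in> set t \<and> mdist U (D j) (D j') \<le> 2 * (1/2) ^ m) \<and>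
     (\<forall>n\<le>m. from_nat n \<in> fst ` set t) \<and>
     (\<forall>n\<le>m. \<exists>(i, j)\<in>set t. mdist U (D n) (D j) \<le> (1/2) ^ m)"

lemma good_matchD:
  assumes "good_match U D \<delta> m s" "(i, j) \<in> set s" "(i', j') \<in> set s"
  shows "\<bar>\<delta> i i' - mdist U (D j) (D j')\<bar> \<le> (1/2) ^ m / (1 + length s)"
    and "\<bar>\<delta> i i' - mdist U (D j) (D j')\<bar> \<le> (1/2) ^ m"
proof -
  show 1: "\<bar>\<delta> i i' - mdist U (D j) (D j')\<bar> \<le> (1/2) ^ m / (1 + length s)"
    using assms unfolding good_match_def by blast
  have "(1/2) ^ m / (1 + real (length s)) \<le> (1/2) ^ m / 1" by (intro divide_left_mono) auto
  then show "\<bar>\<delta> i i' - mdist U (D j) (D j')\<bar> \<le> (1/2) ^ m" using 1 by simp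
qed

text \<open>
  First replace the matching by an exact embedding \<open>z\<close> close to it, then enlarge \<open>z\<close> in both directions,
  and finally approximate the points of \<open>z\<close> by members of \<open>D\<close>.
\<close>
lemma good_match_extends:
  fixes U :: "'u metric" and \<delta> :: "'c::countable \<Rightarrow> 'c \<Rightarrow> real"
  assumes U: "urysohn_sphere U" and \<delta>: "pseudometric_on UNIV \<delta>" and ext: "approx_ext \<delta>"
    and D: "\<And>n. D n \<in> mspace U" and dense: "\<And>z e. z \<in> mspace U \<Longrightarrow> 0 < e \<Longrightarrow> \<exists>n. mdist U z (D n) < e"
    and s: "good_match U D \<delta> m s"
  shows "\<exists>t. good_match U D \<delta> (Suc m) t \<and> refines_match U D m s t"
proof -
  define e where "e = (1/2) ^ m / (1 + real (length s))"
  have e0: "0 \<le> e" by (simp add: e_def)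
  have e_len: "e * length s \<le> (1/2) ^ m" 
  proof -
    have "e * length s \<le> e * (1 + real (length s))" using e0 by (intro mult_left_mono) auto
    also have "\<dots> = (1/2) ^ m" unfolding e_def using of_nat_0_le_iff[of "length s"] by (simp del: of_nat_0_le_iff)
    finally show ?thesis .
  qed
  obtain z0 where z0: "exact_on U \<delta> (fst ` set s) z0" "\<And>i j. (i, j) \<in> set s \<Longrightarrow> mdist U (z0 i) (D j) \<le> e * length s"
  proof -
    have "\<bar>\<delta> i i' - mdist U (D j) (D j')\<bar> \<le> e" if "(i, j) \<in> set s" "(i', j') \<in> set s" for i j i' j'
      using good_matchD(1)[OF s that] by (simp add: e_def)
    then show thesis using exact_from_approximate[OF U \<delta>, of D e s] D e0 that by blast
  qed
  obtain z1 where z1: "exact_on U \<delta> (fst ` set s \<union> from_nat ` {..m}) z1" "\<forall>a\<in>fst ` set s. z1 a = z0 a"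
    using exact_grow_domain[OF U \<delta> z0(1), of "from_nat ` {..m}"] by auto
  have half: "0 < (1/2 :: real) ^ Suc m" by simp
  obtain I z where I: "finite I" "fst ` set s \<union> from_nat ` {..m} \<subseteq> I" "exact_on U \<delta> I z"
      "\<forall>a\<in>fst ` set s \<union> from_nat ` {..m}. z a = z1 a" "\<forall>w\<in>D ` {..m}. \<exists>k\<in>I. mdist U (z k) w \<le> (1/2) ^ Suc m"
  proof -
    have "finite (fst ` set s \<union> from_nat ` {..m})" "finite (D ` {..m})" "D ` {..m} \<subseteq> mspace U" using D by auto
    from exact_grow_range[OF U \<delta> z1(1) this half ext] show thesis using that by blast
  qed
  note zD = exact_onD[OF I(3)]
  obtain l where l: "set l = I" using finite_list[OF I(1)] by blast
  \<comment> \<open>Both points of a pair move by \<open>\<eta>\<close>, so \<open>2 * \<eta>\<close> has to be the tolerance of stage \<open>m + 1\<close> for a list of this length.\<close>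
  define \<eta> where "\<eta> = (1/2) ^ Suc m / (1 + real (length l)) / 2"
  have "2 * (x / 2) = x" for x :: real by simp
  then have \<eta>2: "2 * \<eta> = (1/2) ^ Suc m / (1 + real (length l))" unfolding \<eta>_def .
  have \<eta>0: "0 < \<eta>" unfolding \<eta>_def by (intro divide_pos_pos) auto
  have "(1/2) ^ Suc m / (1 + real (length l)) \<le> (1/2) ^ Suc m / 1" by (intro divide_left_mono) auto
  also have "\<dots> = (1/2) ^ m / 2" by simp
  finally have "\<eta> \<le> (1/2) ^ m / 2 / 2" unfolding \<eta>_def by (rule divide_right_mono) simp
  also have "\<dots> = (1/2) ^ m / 4" by simp
  finally have \<eta>1: "\<eta> \<le> (1/2) ^ m / 4" .
  have "\<forall>i\<in>I. \<exists>j. mdist U (z i) (D j) < \<eta>" using dense zD(1) \<eta>0 by blast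
  then obtain J where J: "\<And>i. i \<in> I \<Longrightarrow> mdist U (z i) (D (J i)) < \<eta>" by metis
  define t where "t = map (\<lambda>i. (i, J i)) l"
  have t: "(i, j) \<in> set t \<longleftrightarrow> i \<in> I \<and> j = J i" for i j using l by (auto simp: t_def)
  have "good_match U D \<delta> (Suc m) t"
    unfolding good_match_def
  proof (clarify)
    fix i j i' j' assume "(i, j) \<in> set t" "(i', j') \<in> set t"
    then have i: "i \<in> I" "j = J i" "i' \<in> I" "j' = J i'" by (auto simp: t)
    have "mdist U (D j) (D j') \<le> mdist U (D j) (z i) + mdist U (z i) (D j')"
      "mdist U (z i) (D j') \<le> mdist U (z i) (z i') + mdist U (z i') (D j')"
      "mdist U (z i) (z i') \<le> mdist U (z i) (D j) + mdist U (D j) (z i')"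
      "mdist U (D j) (z i') \<le> mdist U (D j) (D j') + mdist U (D j') (z i')"
      using zD(1) i D by (intro mdist_triangle; simp)+
    then have "\<bar>\<delta> i i' - mdist U (D j) (D j')\<bar> \<le> 2 * \<eta>"
      using J[OF i(1), folded i(2)] J[OF i(3), folded i(4)] zD(2)[OF i(1,3)] mdist_commute[of U "z i" "D j"] mdist_commute[of U "z i'" "D j'"]
      by linarith
    then show "\<bar>\<delta> i i' - mdist U (D j) (D j')\<bar> \<le> (1/2) ^ Suc m / (1 + length t)"
      by (simp only: \<eta>2 t_def length_map of_nat_add of_nat_1)
  qed
  moreover have "refines_match U D m s t"
    unfolding refines_match_def
  proof (intro conjI allI impI ballI)
    fix ij assume ij: "ij \<in> set s"
    obtain i j where ij': "ij = (i, j)" by force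
    have iI: "i \<in> I" "z i = z0 i" using ij ij' I(2,4) z1(2) by force+
    have "mdist U (D j) (D (J i)) \<le> mdist U (D j) (z i) + mdist U (z i) (D (J i))"
      using zD(1)[OF iI(1)] D by (intro mdist_triangle)
    then have "mdist U (D j) (D (J i)) \<le> 2 * (1/2) ^ m"
      using z0(2)[OF ij[unfolded ij']] e_len J[OF iI(1)] \<eta>1 mdist_commute[of U "D j" "z i"] zero_less_power[of "1/2 :: real" m]
      unfolding iI(2) by linarith
    then show "case ij of (i, j) \<Rightarrow> \<exists>j'. (i, j') \<in> set t \<and> mdist U (D j) (D j') \<le> 2 * (1/2) ^ m"
      using iI by (auto simp: ij' t)
  next
    fix n assume n: "n \<le> m"
    show "from_nat n \<in> fst ` set t" using I(2) n l by (force simp: t_def image_image)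
    obtain k where k: "k \<in> I" "mdist U (z k) (D n) \<le> (1/2) ^ Suc m" using I(5) n by auto
    have "mdist U (D n) (D (J k)) \<le> mdist U (D n) (z k) + mdist U (z k) (D (J k))"
      using zD(1)[OF k(1)] D by (intro mdist_triangle)
    then have "mdist U (D n) (D (J k)) \<le> (1/2) ^ m"
      using k(2) J[OF k(1)] \<eta>1 mdist_commute[of U "D n" "z k"] zero_less_power[of "1/2 :: real" m]
      unfolding power_Suc by linarith
    then show "\<exists>(i, j)\<in>set t. mdist U (D n) (D j) \<le> (1/2) ^ m" using k(1) t by blast
  qed
  ultimately show ?thesis by blast
qed

text \<open>
  The image of \<open>i\<close> is the limit of its partners in the successive matchings. The tolerances are
  summable, and measurability passes to the limit. Every member of \<open>D\<close> is approximated again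
  at all later stages, which makes the image dense.
\<close>
lemma uniform_back_and_forth:
  fixes U :: "'u metric" and \<delta> :: "'w \<Rightarrow> 'c::countable \<Rightarrow> 'c \<Rightarrow> real"
  assumes U: "urysohn_sphere U" 
    and \<delta>: "\<And>w. w \<in> space W \<Longrightarrow> pseudometric_on UNIV (\<delta> w)" and ext: "\<And>w. w \<in> space W \<Longrightarrow> approx_ext (\<delta> w)"
    and meas: "\<And>i j. (\<lambda>w. \<delta> w i j) \<in> borel_measurable W"
  obtains \<Phi> :: "'w \<Rightarrow> 'c \<Rightarrow> 'u" where
    "\<And>w i. w \<in> space W \<Longrightarrow> \<Phi> w i \<in> mspace U"
    "\<And>w i j. w \<in> space W \<Longrightarrow> mdist U (\<Phi> w i) (\<Phi> w j) = \<delta> w i j"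
    "\<And>w z e. w \<in> space W \<Longrightarrow> z \<in> mspace U \<Longrightarrow> 0 < e \<Longrightarrow> \<exists>i. mdist U (\<Phi> w i) z < e"
    "\<And>i z. z \<in> mspace U \<Longrightarrow> (\<lambda>w. mdist U (\<Phi> w i) z) \<in> borel_measurable W"
proof -
  obtain D :: "nat \<Rightarrow> 'u" where D: "\<And>n. D n \<in> mspace U"
    and dense: "\<And>z e. z \<in> mspace U \<Longrightarrow> 0 < e \<Longrightarrow> \<exists>n. mdist U z (D n) < e"
    using urysohn_dense_sequence[OF U] by blast
  define S where "S = (\<lambda>w m s t. good_match U D (\<delta> w) (Suc m) t \<and> refines_match U D m s t)"
  have S_meas: "{w \<in> space W. S w m s t} \<in> sets W" for m and s t :: "('c \<times> nat) list"
  proof -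
    note [measurable] = meas
    have "Measurable.pred W (\<lambda>w. good_match U D (\<delta> w) (Suc m) t)"
      unfolding good_match_def split_def by (intro pred_intros_finite finite_set) measurable
    then show ?thesis unfolding S_def by measurable
  qed
  obtain \<sigma> where \<sigma>: "\<And>w. \<sigma> w 0 = []" "\<And>w m. w \<in> space W \<Longrightarrow> S w m (\<sigma> w m) (\<sigma> w (Suc m))"
    and \<sigma>_meas: "\<And>m. (\<lambda>w. \<sigma> w m) \<in> measurable W (count_space UNIV)"
  proof (rule measurable_choice_sequence[of W S "\<lambda>w m s. good_match U D (\<delta> w) m s" "[]", OF S_meas])
    show "good_match U D (\<delta> w) 0 []" for w by (simp add: good_match_def)
    show "\<exists>t. S w m s t" if "w \<in> space W" "good_match U D (\<delta> w) m s" for w m s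
      unfolding S_def by (rule good_match_extends[OF U \<delta> ext D dense]) (use that in auto)
  qed (auto simp: S_def)
  have good: "good_match U D (\<delta> w) m (\<sigma> w m)" if "w \<in> space W" for w m
    by (cases m) (use \<sigma>(2)[OF that] \<sigma>(1) in \<open>auto simp: S_def good_match_def\<close>)
  have ref: "refines_match U D m (\<sigma> w m) (\<sigma> w (Suc m))" if "w \<in> space W" for w m
    using \<sigma>(2)[OF that] by (simp add: S_def)
  define J where "J = (\<lambda>w i m. the (map_of (\<sigma> w m) i))"
  define dom where "dom = (\<lambda>w m. fst ` set (\<sigma> w m))"
  have J: "(i, J w i m) \<in> set (\<sigma> w m)" if "i \<in> dom w m" for w i m
  proof -
    have "map_of (\<sigma> w m) i \<noteq> None" using that by (simp add: dom_def map_of_eq_None_iff)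
    then obtain j where "map_of (\<sigma> w m) i = Some j" by blast
    then show ?thesis unfolding J_def using map_of_SomeD by fastforce
  qed
  have dom_Suc: "i \<in> dom w (Suc m)" if w: "w \<in> space W" and i: "i \<in> dom w m" for w i m
  proof -
    obtain j where "(i, j) \<in> set (\<sigma> w (Suc m))"
      using ref[OF w, of m] J[OF i] unfolding refines_match_def by blast
    then show ?thesis unfolding dom_def by force
  qed
  have dom_mono: "i \<in> dom w n" if "w \<in> space W" "i \<in> dom w m" "m \<le> n" for w i m n
    using that(3) by (induction n rule: dec_induct) (use that dom_Suc in auto)
  have dom_ex: "i \<in> dom w (Suc (to_nat i))" if "w \<in> space W" for w i
  proof -
    have "from_nat (to_nat i) \<in> fst ` set (\<sigma> w (Suc (to_nat i)))"
      using ref[OF that, of "to_nat i"] unfolding refines_match_def by blast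
    then show ?thesis by (simp add: dom_def)
  qed
  \<comment> \<open>A refinement moves the partner of \<open>i\<close> by at most \<open>2 * (1/2) ^ m\<close>; another partner of \<open>i\<close> in the same matching is within its tolerance, because \<open>\<delta> i i = 0\<close>.\<close>
  have J_step: "mdist U (D (J w i m)) (D (J w i (Suc m))) \<le> 3 * (1/2) ^ m" if w: "w \<in> space W" and i: "i \<in> dom w m" for w i m
  proof -
    obtain j where j: "(i, j) \<in> set (\<sigma> w (Suc m))" "mdist U (D (J w i m)) (D j) \<le> 2 * (1/2) ^ m"
      using ref[OF w] J[OF i] unfolding refines_match_def by blast
    have "\<bar>\<delta> w i i - mdist U (D j) (D (J w i (Suc m)))\<bar> \<le> (1/2) ^ Suc m"
      by (rule good_matchD(2)[OF good[OF w] j(1) J[OF dom_Suc[OF w i]]])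
    moreover have "\<delta> w i i = 0" using \<delta>[OF w] by (simp add: pseudometric_on_def)
    moreover have "mdist U (D (J w i m)) (D (J w i (Suc m))) \<le> mdist U (D (J w i m)) (D j) + mdist U (D j) (D (J w i (Suc m)))"
      by (intro mdist_triangle D)
    ultimately show ?thesis using j(2) zero_less_power[of "1/2 :: real" m] unfolding power_Suc by linarith
  qed
  have "\<exists>l\<in>mspace U. \<forall>n. i \<in> dom w n \<longrightarrow> mdist U (D (J w i n)) l \<le> 6 * (1/2) ^ n" if w: "w \<in> space W" for w i
  proof -
    define N where "N = (LEAST n. i \<in> dom w n)"
    have N: "i \<in> dom w N" unfolding N_def using dom_ex[OF w] by (rule LeastI)
    have le: "N \<le> n" if "i \<in> dom w n" for n unfolding N_def using that by (rule Least_le)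
    have "mcomplete_of U" using U by (simp add: urysohn_sphere_def)
    then show ?thesis
      using geometric_sequence_limit[of U N "\<lambda>n. D (J w i n)" 3, OF _ D J_step[OF w dom_mono[OF w N]]] le by auto
  qed
  then obtain \<Phi> where \<Phi>: "\<And>w i. w \<in> space W \<Longrightarrow> \<Phi> w i \<in> mspace U"
    "\<And>w i n. w \<in> space W \<Longrightarrow> i \<in> dom w n \<Longrightarrow> mdist U (D (J w i n)) (\<Phi> w i) \<le> 6 * (1/2) ^ n"
    by metis
  have lim0: "(\<lambda>n. c * (1/2) ^ n) \<longlonglongrightarrow> (0::real)" for c
    using tendsto_mult_right_zero[OF LIMSEQ_realpow_zero[of "1/2"]] by simp
  have small: "\<exists>n\<ge>k. c * (1/2) ^ n < (e::real)" if "0 < e" for c e k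
    using order_tendstoD(2)[OF lim0[of c] that] unfolding eventually_sequentially by (metis nle_le)
  show thesis
  proof (rule that[of \<Phi>, OF \<Phi>(1)])
    show "mdist U (\<Phi> w i) (\<Phi> w j) = \<delta> w i j" if w: "w \<in> space W" for w i j
    proof -
      have "\<bar>mdist U (\<Phi> w i) (\<Phi> w j) - \<delta> w i j\<bar> \<le> e" if "0 < e" for e
      proof -
        obtain n where n: "max (Suc (to_nat i)) (Suc (to_nat j)) \<le> n" "13 * (1/2) ^ n < e" using small[OF \<open>0 < e\<close>] by blast
        have ij: "i \<in> dom w n" "j \<in> dom w n" using dom_mono[OF w dom_ex[OF w]] n(1) by auto
        have "\<bar>\<delta> w i j - mdist U (D (J w i n)) (D (J w j n))\<bar> \<le> (1/2) ^ n"
          by (rule good_matchD(2)[OF good[OF w] J[OF ij(1)] J[OF ij(2)]])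
        moreover have "\<bar>mdist U (D (J w i n)) (D (J w j n)) - mdist U (\<Phi> w i) (D (J w j n))\<bar> \<le> mdist U (D (J w i n)) (\<Phi> w i)"
          by (rule mdist_diff_le) (use D \<Phi> w in auto)
        moreover have "\<bar>mdist U (D (J w j n)) (\<Phi> w i) - mdist U (\<Phi> w j) (\<Phi> w i)\<bar> \<le> mdist U (D (J w j n)) (\<Phi> w j)"
          by (rule mdist_diff_le) (use D \<Phi> w in auto)
        ultimately show ?thesis
          using \<Phi>(2)[OF w ij(1)] \<Phi>(2)[OF w ij(2)] n(2) mdist_commute[of U "\<Phi> w i"] by simp
      qed
      then show ?thesis by (metis abs_le_zero_iff dense_ge eq_iff_diff_eq_0)
    qed
    show "\<exists>i. mdist U (\<Phi> w i) z < e" if w: "w \<in> space W" and z: "z \<in> mspace U" and e: "0 < e" for w z e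
    proof -
      obtain n where n: "mdist U z (D n) < e / 2" using dense[OF z] e by (meson half_gt_zero)
      have "0 < e / 2" using e by simp
      from small[OF this] obtain m where m: "n \<le> m" "5 * (1/2) ^ m < e / 2" by blast
      obtain i j where ij: "(i, j) \<in> set (\<sigma> w (Suc m))" "mdist U (D n) (D j) \<le> (1/2) ^ m"
        using ref[OF w, of m] m(1) unfolding refines_match_def by blast
      have i: "i \<in> dom w (Suc m)" using ij by (force simp: dom_def)
      have "\<bar>\<delta> w i i - mdist U (D j) (D (J w i (Suc m)))\<bar> \<le> (1/2) ^ Suc m"
        by (rule good_matchD(2)[OF good[OF w] ij(1) J[OF i]])
      then have "mdist U (D j) (D (J w i (Suc m))) \<le> (1/2) ^ Suc m" using \<delta>[OF w] by (simp add: pseudometric_on_def)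
      moreover have "mdist U z (\<Phi> w i) \<le> mdist U z (D n) + mdist U (D n) (\<Phi> w i)"
        "mdist U (D n) (\<Phi> w i) \<le> mdist U (D n) (D j) + mdist U (D j) (\<Phi> w i)"
        "mdist U (D j) (\<Phi> w i) \<le> mdist U (D j) (D (J w i (Suc m))) + mdist U (D (J w i (Suc m))) (\<Phi> w i)"
        using D \<Phi>(1)[OF w] z by (intro mdist_triangle; simp)+
      ultimately have "mdist U z (\<Phi> w i) < e / 2 + (1/2) ^ m + ((1/2) ^ Suc m + 6 * (1/2) ^ Suc m)"
        using n ij(2) \<Phi>(2)[OF w i] by linarith
      also have "\<dots> \<le> e / 2 + 5 * (1/2) ^ m" by simp
      finally have "mdist U z (\<Phi> w i) < e" using m(2) by simp
      then show ?thesis by (metis mdist_commute)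
    qed
    show "(\<lambda>w. mdist U (\<Phi> w i) z) \<in> borel_measurable W" if z: "z \<in> mspace U" for i z
    proof (rule borel_measurable_LIMSEQ_real)
      show "(\<lambda>w. mdist U (D (J w i n)) z) \<in> borel_measurable W" for n
        unfolding J_def by (rule measurable_compose[OF \<sigma>_meas]) simp
      show "(\<lambda>n. mdist U (D (J w i n)) z) \<longlonglongrightarrow> mdist U (\<Phi> w i) z" if w: "w \<in> space W" for w
      proof (rule LIM_zero_cancel, rule tendsto_sandwich)
        have bound: "\<bar>mdist U (D (J w i n)) z - mdist U (\<Phi> w i) z\<bar> \<le> 6 * (1/2) ^ n" if "Suc (to_nat i) \<le> n" for n
          using mdist_diff_le[OF D \<Phi>(1)[OF w] z, of "J w i n" i] \<Phi>(2)[OF w dom_mono[OF w dom_ex[OF w] that]] by linarith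
        show "\<forall>\<^sub>F n in sequentially. - (6 * (1/2) ^ n) \<le> mdist U (D (J w i n)) z - mdist U (\<Phi> w i) z"
          "\<forall>\<^sub>F n in sequentially. mdist U (D (J w i n)) z - mdist U (\<Phi> w i) z \<le> 6 * (1/2) ^ n"
          using bound by (intro eventually_sequentiallyI[of "Suc (to_nat i)"]; force simp: abs_le_iff)+
        show "(\<lambda>n. - (6 * (1/2) ^ n) :: real) \<longlonglongrightarrow> 0" using tendsto_minus[OF lim0[of 6]] by simp
      qed (rule lim0)
    qed
  qed
qed

section \<open>Points and isometries determined by distances\<close>

text \<open>
  A Katetov function with infimum 0 on a subset of a complete space is the distance to a point: take the limit
  of points at which it tends to 0. Both the extension of an isometry from a dense set
  and the embedding of trees over \<open>M\<^sub>x\<close> are obtained from this.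
\<close>
lemma point_from_distances:
  assumes U: "mcomplete_of U" and \<alpha>: "\<And>i. i \<in> I \<Longrightarrow> \<alpha> i \<in> mspace U"
    and v: "\<And>i j. i \<in> I \<Longrightarrow> j \<in> I \<Longrightarrow> \<bar>v i - v j\<bar> \<le> mdist U (\<alpha> i) (\<alpha> j) \<and> mdist U (\<alpha> i) (\<alpha> j) \<le> v i + v j"
    and inf: "\<And>e. 0 < e \<Longrightarrow> \<exists>i\<in>I. v i < e"
  shows "\<exists>w\<in>mspace U. \<forall>i\<in>I. mdist U w (\<alpha> i) = v i"
proof -
  have "\<forall>n. \<exists>i\<in>I. v i < (1/2) ^ n" using inf by simp
  then obtain k where k: "\<And>n. k n \<in> I" "\<And>n. v (k n) < (1/2) ^ n" by metis
  have "mdist U (\<alpha> (k n)) (\<alpha> (k (Suc n))) \<le> 2 * (1/2) ^ n" for n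
  proof -
    have "(1/2 :: real) ^ Suc n \<le> (1/2) ^ n" by simp
    then show ?thesis using v[OF k(1)[of n] k(1)[of "Suc n"]] k(2)[of n] k(2)[of "Suc n"] by linarith
  qed
  then obtain w where w: "w \<in> mspace U" "\<And>n. mdist U (\<alpha> (k n)) w \<le> 4 * (1/2) ^ n"
    using geometric_sequence_limit[OF U, of 0 "\<lambda>n. \<alpha> (k n)" 2] \<alpha>[OF k(1)] by auto
  have "mdist U w (\<alpha> i) = v i" if i: "i \<in> I" for i
  proof -
    have "\<bar>mdist U w (\<alpha> i) - v i\<bar> \<le> 5 * (1/2) ^ n" for n
    proof -
      have "\<bar>mdist U w (\<alpha> i) - mdist U (\<alpha> (k n)) (\<alpha> i)\<bar> \<le> mdist U w (\<alpha> (k n))"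
        using w \<alpha> i k by (intro mdist_diff_le) auto
      then show ?thesis using v[OF k(1)[of n] i] k(2)[of n] w(2)[of n] mdist_commute[of U w "\<alpha> (k n)"] by linarith
    qed
    moreover have "(\<lambda>n. 5 * (1/2) ^ n :: real) \<longlonglongrightarrow> 0"
      using tendsto_mult_right_zero[OF LIMSEQ_realpow_zero[of "1/2"]] by simp
    ultimately have "\<bar>mdist U w (\<alpha> i) - v i\<bar> \<le> 0" using LIMSEQ_le_const by blast
    then show ?thesis by simp
  qed
  then show ?thesis using w(1) by blast
qed

lemma point_determined_by_distances:
  assumes "\<And>i. i \<in> I \<Longrightarrow> \<alpha> i \<in> mspace U" "\<And>e. 0 < e \<Longrightarrow> \<exists>i\<in>I. mdist U w (\<alpha> i) < e"
    and "w \<in> mspace U" "w' \<in> mspace U" "\<And>i. i \<in> I \<Longrightarrow> mdist U w' (\<alpha> i) = mdist U w (\<alpha> i)"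
  shows "w' = w"
proof -
  have "mdist U w' w \<le> e" if e: "0 < e" for e
  proof -
    obtain i where i: "i \<in> I" "mdist U w (\<alpha> i) < e / 2" using assms(2)[OF half_gt_zero[OF e]] by blast
    have "mdist U w' w \<le> mdist U w' (\<alpha> i) + mdist U (\<alpha> i) w" using assms i by (intro mdist_triangle) auto
    then show ?thesis using assms(5)[OF i(1)] i(2) mdist_commute[of U w "\<alpha> i"] by linarith
  qed
  then have "mdist U w' w \<le> 0" by (rule field_le_epsilon) simp
  then have "mdist U w' w = 0" using mdist_nonneg[of U w' w] by linarith
  then show ?thesis using assms by simp
qed

lemma isometry_groupD:
  assumes "g \<in> isometry_group U"
  shows "a \<in> mspace U \<Longrightarrow> g a \<in> mspace U" "a \<in> mspace U \<Longrightarrow> b \<in> mspace U \<Longrightarrow> mdist U (g a) (g b) = mdist U a b"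
    "bij_betw g (mspace U) (mspace U)" "g \<in> extensional (mspace U)"
  using assms by (auto simp: isometry_group_def PiE_iff)

lemma isometry_unique_on_dense:
  assumes g: "g \<in> isometry_group U" and h: "h \<in> isometry_group U"
    and p: "\<And>i. i \<in> I \<Longrightarrow> p i \<in> mspace U"
    and dense: "\<And>z e. z \<in> mspace U \<Longrightarrow> 0 < e \<Longrightarrow> \<exists>i\<in>I. mdist U (p i) z < e"
    and eq: "\<And>i. i \<in> I \<Longrightarrow> g (p i) = h (p i)"
  shows "g = h"
proof (rule extensionalityI[OF isometry_groupD(4)[OF g] isometry_groupD(4)[OF h]])
  fix z assume z: "z \<in> mspace U"
  show "g z = h z"
  proof (rule point_determined_by_distances[of I "\<lambda>i. h (p i)"])
    show "\<exists>i\<in>I. mdist U (h z) (h (p i)) < e" if "0 < e" for e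
      using dense[OF z that] isometry_groupD(2)[OF h] p z by (metis mdist_commute)
    show "mdist U (g z) (h (p i)) = mdist U (h z) (h (p i))" if "i \<in> I" for i
      using eq[OF that] isometry_groupD(2)[OF g z p[OF that]] isometry_groupD(2)[OF h z p[OF that]] by simp
  qed (use p z isometry_groupD(1)[OF g] isometry_groupD(1)[OF h] in auto)
qed

lemma dense_isometry_extends:
  assumes U: "mcomplete_of U"
    and p: "\<And>i. i \<in> I \<Longrightarrow> p i \<in> mspace U" and q: "\<And>i. i \<in> I \<Longrightarrow> q i \<in> mspace U"
    and iso: "\<And>i j. i \<in> I \<Longrightarrow> j \<in> I \<Longrightarrow> mdist U (p i) (p j) = mdist U (q i) (q j)"
    and p_dense: "\<And>z e. z \<in> mspace U \<Longrightarrow> 0 < e \<Longrightarrow> \<exists>i\<in>I. mdist U (p i) z < e"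
    and q_dense: "\<And>z e. z \<in> mspace U \<Longrightarrow> 0 < e \<Longrightarrow> \<exists>i\<in>I. mdist U (q i) z < e"
  shows "\<exists>g\<in>isometry_group U. \<forall>i\<in>I. g (p i) = q i"
proof -
  have transport: "\<exists>w\<in>mspace U. \<forall>i\<in>I. mdist U w (q i) = mdist U z (p i)"
    if z: "z \<in> mspace U" and p: "\<And>i. i \<in> I \<Longrightarrow> p i \<in> mspace U" and q: "\<And>i. i \<in> I \<Longrightarrow> q i \<in> mspace U"
      and iso: "\<And>i j. i \<in> I \<Longrightarrow> j \<in> I \<Longrightarrow> mdist U (p i) (p j) = mdist U (q i) (q j)"
      and dense: "\<And>z e. z \<in> mspace U \<Longrightarrow> 0 < e \<Longrightarrow> \<exists>i\<in>I. mdist U (p i) z < e" for z p q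
  proof (rule point_from_distances[OF U q])
    fix i j assume ij: "i \<in> I" "j \<in> I"
    show "\<bar>mdist U z (p i) - mdist U z (p j)\<bar> \<le> mdist U (q i) (q j) \<and> mdist U (q i) (q j) \<le> mdist U z (p i) + mdist U z (p j)"
      using mdist_diff_le[OF p[OF ij(1)] p[OF ij(2)] z] mdist_triangle[OF p[OF ij(1)] z p[OF ij(2)]] iso[OF ij]
        mdist_commute[of U z] by simp
  next
    fix e :: real assume "0 < e"
    then show "\<exists>i\<in>I. mdist U z (p i) < e" using dense[OF z] by (metis mdist_commute)
  qed auto
  define g where "g = (\<lambda>z\<in>mspace U. SOME w. w \<in> mspace U \<and> (\<forall>i\<in>I. mdist U w (q i) = mdist U z (p i)))"
  have g: "g z \<in> mspace U" "i \<in> I \<Longrightarrow> mdist U (g z) (q i) = mdist U z (p i)" if z: "z \<in> mspace U" for z i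
  proof -
    have "\<exists>w\<in>mspace U. \<forall>i\<in>I. mdist U w (q i) = mdist U z (p i)"
      by (rule transport[OF z p q iso p_dense])
    then have "\<exists>w. w \<in> mspace U \<and> (\<forall>i\<in>I. mdist U w (q i) = mdist U z (p i))" by blast
    from someI_ex[OF this] show "g z \<in> mspace U" "i \<in> I \<Longrightarrow> mdist U (g z) (q i) = mdist U z (p i)"
      using z by (auto simp: g_def)
  qed
  have gp: "g (p i) = q i" if i: "i \<in> I" for i
  proof -
    have "mdist U (g (p i)) (q i) = 0" using g(2)[OF p[OF i] i] mdist_self[OF p[OF i]] by simp
    then show ?thesis using g(1)[OF p[OF i]] q[OF i] by simp
  qed
  have g_iso: "mdist U (g z) (g w) = mdist U z w" if zw: "z \<in> mspace U" "w \<in> mspace U" for z w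
  proof -
    have approx: "\<bar>mdist U (g z) (g w) - mdist U z w\<bar> \<le> 0 + e" if e: "0 < e" for e
    proof -
      obtain i where i: "i \<in> I" "mdist U (p i) z < e / 2" using p_dense[OF zw(1), of "e / 2"] e by auto
      have "\<bar>mdist U (g z) (g w) - mdist U (q i) (g w)\<bar> \<le> mdist U (g z) (q i)"
        by (rule mdist_diff_le) (use g zw q i in auto)
      moreover have "\<bar>mdist U z w - mdist U (p i) w\<bar> \<le> mdist U z (p i)"
        by (rule mdist_diff_le) (use zw p i in auto)
      moreover have "mdist U (q i) (g w) = mdist U (p i) w" using g(2)[OF zw(2) i(1)] by (simp add: mdist_commute)
      moreover have "mdist U (g z) (q i) = mdist U z (p i)" using g(2)[OF zw(1) i(1)] .
      ultimately show ?thesis using i(2) mdist_commute[of U "p i" z] by linarith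
    qed
    have "\<bar>mdist U (g z) (g w) - mdist U z w\<bar> \<le> 0" by (rule field_le_epsilon[OF approx])
    then show ?thesis by simp
  qed
  have "w \<in> g ` mspace U" if w: "w \<in> mspace U" for w
  proof -
    have "\<exists>z\<in>mspace U. \<forall>i\<in>I. mdist U z (p i) = mdist U w (q i)"
      by (rule transport[OF w q p iso[symmetric] q_dense])
    then obtain z where z: "z \<in> mspace U" "\<And>i. i \<in> I \<Longrightarrow> mdist U z (p i) = mdist U w (q i)" by blast
    have "g z = w"
    proof (rule point_determined_by_distances[of I q])
      show "\<exists>i\<in>I. mdist U w (q i) < e" if "0 < e" for e using q_dense[OF w that] by (metis mdist_commute)
      show "mdist U (g z) (q i) = mdist U w (q i)" if "i \<in> I" for i using g(2)[OF z(1) that] z(2)[OF that] by simp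
    qed (use q g z w in auto)
    then show ?thesis using z(1) by blast
  qed
  then have "g ` mspace U = mspace U" using g(1) by blast
  moreover have "inj_on g (mspace U)"
  proof (rule inj_onI)
    fix z w assume zw: "z \<in> mspace U" "w \<in> mspace U" "g z = g w"
    then have "mdist U z w = 0" using g_iso[OF zw(1,2)] mdist_self[OF g(1)[OF zw(1)]] by simp
    then show "z = w" using zw by simp
  qed
  ultimately have "g \<in> isometry_group U"
    using g(1) g_iso unfolding isometry_group_def bij_betw_def by (auto simp: g_def)
  then show ?thesis using gp by blast
qed

section \<open>Borel maps into isometry groups and spaces of structures\<close>

lemma sets_borel_of_open: "openin T V \<Longrightarrow> V \<in> sets (borel_of T)"
  unfolding borel_of_def by (subst sets_measure_of) (auto dest: openin_subset)

lemma measurable_borel_ofI: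
  assumes "h \<in> space W \<rightarrow> topspace T" "\<And>V. openin T V \<Longrightarrow> h -` V \<inter> space W \<in> sets W"
  shows "h \<in> measurable W (borel_of T)"
  unfolding borel_of_def
proof (rule measurable_measure_of)
  show "{V. openin T V} \<subseteq> Pow (topspace T)" using openin_subset by blast
qed (use assms in auto)

text \<open>
  The real functions in \<open>E\<close> form a subbasis of \<open>T\<close> in the sense that they detect neighbourhoods. When \<open>E\<close>
  is countable, measurability into the Borel sets of \<open>T\<close> can be tested on \<open>E\<close>, although
  the product topologies in question have uncountably many factors.
\<close>
definition controls :: "'t topology \<Rightarrow> ('t \<Rightarrow> real) set \<Rightarrow> bool" where
  "controls T E \<longleftrightarrow> (\<forall>V u. openin T V \<and> u \<in> V \<longrightarrow>
     (\<exists>F \<epsilon>. finite F \<and> F \<subseteq> E \<and> 0 < \<epsilon> \<and> (\<forall>v\<in>topspace T. (\<forall>e\<in>F. \<bar>e v - e u\<bar> < \<epsilon>) \<longrightarrow> v \<in> V)))"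

lemma controlsD:
  assumes "controls T E" "openin T V" "u \<in> V"
  obtains F \<epsilon> where "finite F" "F \<subseteq> E" "0 < \<epsilon>" "\<And>v. v \<in> topspace T \<Longrightarrow> (\<And>e. e \<in> F \<Longrightarrow> \<bar>e v - e u\<bar> < \<epsilon>) \<Longrightarrow> v \<in> V"
  using assms unfolding controls_def by metis

text \<open>
  Boxes with rational centers and a rational radius on finite subsets of \<open>E\<close> are countable in number, and
  every open set is a union of them.
\<close>
lemma measurable_borel_of_controls:
  fixes T :: "'t topology"
  assumes T: "controls T E" and E: "countable E" and h: "h \<in> space W \<rightarrow> topspace T"
    and meas: "\<And>e. e \<in> E \<Longrightarrow> (\<lambda>w. e (h w)) \<in> borel_measurable W"
  shows "h \<in> measurable W (borel_of T)"
  unfolding borel_of_def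
proof (rule measurable_measure_of)
  show "{V. openin T V} \<subseteq> Pow (topspace T)" using openin_subset by blast
  fix V assume "V \<in> {V. openin T V}"
  then have V: "openin T V" by simp
  define box :: "(('t \<Rightarrow> real) \<times> rat) list \<Rightarrow> rat \<Rightarrow> 't set" where
    "box = (\<lambda>l \<delta>. {v \<in> topspace T. \<forall>(e, q)\<in>set l. \<bar>e v - of_rat q\<bar> < of_rat \<delta>})"
  define K where "K = {(l, \<delta>). l \<in> lists (E \<times> UNIV) \<and> box l \<delta> \<subseteq> V}"
  have "K \<subseteq> lists (E \<times> UNIV) \<times> UNIV" unfolding K_def by blast
  moreover have "countable (lists (E \<times> (UNIV :: rat set)) \<times> (UNIV :: rat set))"
    using E by (intro countable_SIGMA countable_lists) auto
  ultimately have K: "countable K" by (rule countable_subset)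
  have "u \<in> (\<Union>(l, \<delta>)\<in>K. box l \<delta>)" if u: "u \<in> V" for u
  proof -
    obtain F \<epsilon> where F: "finite F" "F \<subseteq> E" "0 < \<epsilon>" 
      "\<And>v. v \<in> topspace T \<Longrightarrow> (\<And>e. e \<in> F \<Longrightarrow> \<bar>e v - e u\<bar> < \<epsilon>) \<Longrightarrow> v \<in> V"
      using controlsD[OF T V u] by metis
    obtain \<delta> where \<delta>: "0 < real_of_rat \<delta>" "real_of_rat \<delta> < \<epsilon> / 2" using of_rat_dense[of 0 "\<epsilon> / 2"] F(3) by auto
    have "\<exists>q. \<bar>e u - real_of_rat q\<bar> < of_rat \<delta>" for e
      using of_rat_dense[of "e u" "e u + of_rat \<delta>"] \<delta>(1) by (smt (verit))
    then obtain q where q: "\<And>e. \<bar>e u - real_of_rat (q e)\<bar> < of_rat \<delta>" by metis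
    obtain l where l: "set l = F" using finite_list[OF F(1)] by blast
    have "box (map (\<lambda>e. (e, q e)) l) \<delta> \<subseteq> V"
    proof
      fix v assume v: "v \<in> box (map (\<lambda>e. (e, q e)) l) \<delta>"
      then have "\<bar>e v - real_of_rat (q e)\<bar> < of_rat \<delta>" if "e \<in> F" for e using that l by (auto simp: box_def)
      then have "\<bar>e v - e u\<bar> < \<epsilon>" if "e \<in> F" for e using q[of e] \<delta>(2) that by (smt (verit) field_sum_of_halves)
      then show "v \<in> V" using F(4) v by (auto simp: box_def)
    qed
    moreover have "u \<in> box (map (\<lambda>e. (e, q e)) l) \<delta>" using q u openin_subset[OF V] by (auto simp: box_def)
    moreover have "map (\<lambda>e. (e, q e)) l \<in> lists (E \<times> UNIV)" using l F(2) by auto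
    ultimately show ?thesis unfolding K_def by blast
  qed
  then have "V = (\<Union>(l, \<delta>)\<in>K. box l \<delta>)" unfolding K_def by auto
  then have "h -` V \<inter> space W = (\<Union>(l, \<delta>)\<in>K. h -` box l \<delta> \<inter> space W)" by auto
  also have "\<dots> \<in> sets W"
  proof (intro sets.countable_UN' K image_subsetI)
    fix k assume k: "k \<in> K"
    obtain l \<delta> where l: "k = (l, \<delta>)" by force
    have lE: "e \<in> E" if "(e, q) \<in> set l" for e q using k that unfolding K_def l by auto
    have "h -` box l \<delta> \<inter> space W = {w \<in> space W. \<forall>p\<in>set l. \<bar>fst p (h w) - of_rat (snd p)\<bar> < of_rat \<delta>}"
      using h by (auto simp: box_def split_def Pi_iff)
    also have "\<dots> \<in> sets W"
    proof (rule sets.sets_Collect_finite_All)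
      show "{w \<in> space W. \<bar>fst p (h w) - of_rat (snd p)\<bar> < of_rat \<delta>} \<in> sets W" if "p \<in> set l" for p
      proof -
        have [measurable]: "(\<lambda>w. fst p (h w)) \<in> borel_measurable W" using meas lE[of "fst p" "snd p"] that by simp
        show ?thesis by measurable
      qed
    qed simp
    finally show "(case k of (l, \<delta>) \<Rightarrow> h -` box l \<delta> \<inter> space W) \<in> sets W" by (simp add: l)
  qed
  finally show "h -` V \<inter> space W \<in> sets W" .
qed (rule h)

lemma controls_prod_topology:
  assumes "controls T E" "controls T' E'"
  shows "controls (prod_topology T T') ((\<lambda>e. e \<circ> fst) ` E \<union> (\<lambda>e. e \<circ> snd) ` E')"
  unfolding controls_def
proof (intro allI impI, elim conjE)
  fix V u assume V: "openin (prod_topology T T') V" and u: "u \<in> V"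
  obtain A B where AB: "openin T A" "openin T' B" "fst u \<in> A" "snd u \<in> B" "A \<times> B \<subseteq> V"
    using V u unfolding openin_prod_topology_alt by (metis prod.collapse)
  obtain F \<epsilon> where F: "finite F" "F \<subseteq> E" "0 < \<epsilon>" "\<And>v. v \<in> topspace T \<Longrightarrow> (\<And>e. e \<in> F \<Longrightarrow> \<bar>e v - e (fst u)\<bar> < \<epsilon>) \<Longrightarrow> v \<in> A"
    using controlsD[OF assms(1) AB(1,3)] by metis
  obtain F' \<epsilon>' where F': "finite F'" "F' \<subseteq> E'" "0 < \<epsilon>'" "\<And>v. v \<in> topspace T' \<Longrightarrow> (\<And>e. e \<in> F' \<Longrightarrow> \<bar>e v - e (snd u)\<bar> < \<epsilon>') \<Longrightarrow> v \<in> B"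
    using controlsD[OF assms(2) AB(2,4)] by metis
  show "\<exists>G \<eta>. finite G \<and> G \<subseteq> (\<lambda>e. e \<circ> fst) ` E \<union> (\<lambda>e. e \<circ> snd) ` E' \<and> 0 < \<eta> \<and>
    (\<forall>v\<in>topspace (prod_topology T T'). (\<forall>e\<in>G. \<bar>e v - e u\<bar> < \<eta>) \<longrightarrow> v \<in> V)"
  proof (intro exI[of _ "(\<lambda>e. e \<circ> fst) ` F \<union> (\<lambda>e. e \<circ> snd) ` F'"] exI[of _ "min \<epsilon> \<epsilon>'"] conjI ballI impI)
    fix v assume v: "v \<in> topspace (prod_topology T T')"
      "\<forall>e\<in>(\<lambda>e. e \<circ> fst) ` F \<union> (\<lambda>e. e \<circ> snd) ` F'. \<bar>e v - e u\<bar> < min \<epsilon> \<epsilon>'"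
    have "\<bar>e (fst v) - e (fst u)\<bar> < \<epsilon>" if "e \<in> F" for e using bspec[OF v(2), of "e \<circ> fst"] that by simp
    then have "fst v \<in> A" using v(1) by (intro F(4)) auto
    moreover have "\<bar>e (snd v) - e (snd u)\<bar> < \<epsilon>'" if "e \<in> F'" for e using bspec[OF v(2), of "e \<circ> snd"] that by simp
    then have "snd v \<in> B" using v(1) by (intro F'(4)) auto
    ultimately show "v \<in> V" using AB(5) by (metis mem_Times_iff subsetD)
  qed (use F F' in auto)
qed

text \<open>
  Isometries are equicontinuous, so a neighbourhood of \<open>g\<close> can be described by approximate values at points
  of a dense sequence.
\<close>
lemma controls_isometry_group:
  fixes D :: "nat \<Rightarrow> 'u"
  assumes D: "\<And>n. D n \<in> mspace U" and dense: "\<And>z e. z \<in> mspace U \<Longrightarrow> 0 < e \<Longrightarrow> \<exists>n. mdist U z (D n) < e"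
  shows "controls (isometry_group_topology U) {\<lambda>g. mdist U (g (D i)) (D j) | i j. True}"
  unfolding controls_def
proof (intro allI impI, elim conjE)
  interpret Metric_space "mspace U" "mdist U" by (rule Metric_space_mspace_mdist)
  fix V g assume V: "openin (isometry_group_topology U) V" and g: "g \<in> V"
  obtain V' where V': "openin (product_topology (\<lambda>_. mtopology_of U) (mspace U)) V'" "V = V' \<inter> isometry_group U"
    using V unfolding isometry_group_topology_def openin_subtopology by blast
  obtain W where W: "finite {a \<in> mspace U. W a \<noteq> mspace U}" "\<And>a. a \<in> mspace U \<Longrightarrow> openin (mtopology_of U) (W a)"
    "g \<in> Pi\<^sub>E (mspace U) W" "Pi\<^sub>E (mspace U) W \<subseteq> V'"
  proof -
    have "g \<in> V'" using g V'(2) by simp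
    from V'(1)[unfolded openin_product_topology_alt topspace_mtopology_of, rule_format, OF this]
    show thesis using that by blast
  qed
  have gI: "g \<in> isometry_group U" using g V' by blast
  have g_in: "a \<in> mspace U \<Longrightarrow> g a \<in> mspace U" for a using gI by (auto simp: isometry_group_def)
  have isoD: "h a \<in> mspace U" "mdist U (h a) (h b) = mdist U a b"
    if "h \<in> isometry_group U" "a \<in> mspace U" "b \<in> mspace U" for h a b
    using that by (auto simp: isometry_group_def)
  define B where "B = {a \<in> mspace U. W a \<noteq> mspace U}"
  have "\<exists>r>0. \<forall>y\<in>mspace U. mdist U (g a) y < r \<longrightarrow> y \<in> W a" if a: "a \<in> mspace U" for a
  proof -
    have "openin mtopology (W a)" using W(2)[OF a] by (simp add: mtopology_of_def)
    moreover have "g a \<in> W a" using W(3) a by (rule PiE_mem)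
    ultimately obtain r where "r > 0" "mball (g a) r \<subseteq> W a" unfolding openin_mtopology by blast
    then show ?thesis using g_in[OF a] by (intro exI[of _ r]) (auto simp: subset_iff)
  qed
  then obtain r where r: "\<And>a. a \<in> mspace U \<Longrightarrow> 0 < r a" "\<And>a y. a \<in> mspace U \<Longrightarrow> y \<in> mspace U \<Longrightarrow> mdist U (g a) y < r a \<Longrightarrow> y \<in> W a"
    by metis
  have "\<exists>i. mdist U a (D i) < r a / 5" if "a \<in> mspace U" for a using dense[OF that, of "r a / 5"] r(1)[OF that] by simp
  then obtain i where i: "\<And>a. a \<in> mspace U \<Longrightarrow> mdist U a (D (i a)) < r a / 5" by metis
  have "\<exists>j. mdist U (g (D (i a))) (D j) < r a / 5" if "a \<in> mspace U" for a
    using dense[OF g_in[OF D], of "r a / 5"] r(1)[OF that] by simp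
  then obtain j where j: "\<And>a. a \<in> mspace U \<Longrightarrow> mdist U (g (D (i a))) (D (j a)) < r a / 5" by metis
  define \<epsilon> where "\<epsilon> = Min (insert 1 ((\<lambda>a. r a / 5) ` B))"
  have B: "finite B" using W(1) by (simp add: B_def)
  have \<epsilon>0: "0 < \<epsilon>" unfolding \<epsilon>_def using B r(1) by (subst Min_gr_iff) (auto simp: B_def)
  have \<epsilon>_le: "\<epsilon> \<le> r a / 5" if "a \<in> B" for a unfolding \<epsilon>_def using B that by (intro Min_le) auto
  show "\<exists>F \<epsilon>. finite F \<and> F \<subseteq> {\<lambda>g. mdist U (g (D i)) (D j) | i j. True} \<and> 0 < \<epsilon> \<and>
     (\<forall>h\<in>topspace (isometry_group_topology U). (\<forall>e\<in>F. \<bar>e h - e g\<bar> < \<epsilon>) \<longrightarrow> h \<in> V)"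
  proof (intro exI[of _ "(\<lambda>a g. mdist U (g (D (i a))) (D (j a))) ` B"] exI[of _ \<epsilon>] conjI ballI impI)
    fix h assume "h \<in> topspace (isometry_group_topology U)"
      and close: "\<forall>e\<in>(\<lambda>a g. mdist U (g (D (i a))) (D (j a))) ` B. \<bar>e h - e g\<bar> < \<epsilon>"
    then have h: "h \<in> isometry_group U" by simp
    have "h a \<in> W a" if a: "a \<in> mspace U" for a
    proof (cases "a \<in> B")
      case True
      have "\<bar>mdist U (h (D (i a))) (D (j a)) - mdist U (g (D (i a))) (D (j a))\<bar> < \<epsilon>" using close True by simp
      moreover have "mdist U (g a) (h a) \<le> mdist U (g a) (g (D (i a))) + mdist U (g (D (i a))) (h a)"
        "mdist U (g (D (i a))) (h a) \<le> mdist U (g (D (i a))) (D (j a)) + mdist U (D (j a)) (h a)"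
        "mdist U (D (j a)) (h a) \<le> mdist U (D (j a)) (h (D (i a))) + mdist U (h (D (i a))) (h a)"
        using isoD(1)[OF gI] isoD(1)[OF h] D a by (intro mdist_triangle; simp)+
      ultimately have "mdist U (g a) (h a) < r a"
        using isoD(2)[OF gI a D[of "i a"]] isoD(2)[OF h a D[of "i a"]] i[OF a] j[OF a] \<epsilon>_le[OF True] r(1)[OF a]
          mdist_commute[of U "D (j a)" "h (D (i a))"] mdist_commute[of U "h (D (i a))" "h a"]
        by linarith
      then show ?thesis using r(2)[OF a isoD(1)[OF h a a]] by simp
    next
      case False
      then show ?thesis using a isoD(1)[OF h a a] by (simp add: B_def)
    qed
    then have "h \<in> Pi\<^sub>E (mspace U) W" using h by (auto simp: isometry_group_def PiE_iff)
    then show "h \<in> V" using W(4) V'(2) h by blast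
  qed (use B \<epsilon>0 in auto)
qed

lemma ModD:
  assumes "N \<in> Mod U L" "R \<in> rels L"
  shows "N R \<in> tuples U (length (arity L R)) \<rightarrow>\<^sub>E {0..1}"
    and "a \<in> tuples U (length (arity L R)) \<Longrightarrow> b \<in> tuples U (length (arity L R)) \<Longrightarrow>
      \<bar>N R a - N R b\<bar> \<le> (\<Sum>i<length (arity L R). mdist U (a i) (b i))"
  using assms unfolding Mod_def by fastforce+

definition dense_tuple :: "(nat \<Rightarrow> 'u) \<Rightarrow> nat list \<Rightarrow> nat \<Rightarrow> 'u" where
  "dense_tuple D js = (\<lambda>i\<in>{..<length js}. D (js ! i))"

lemma dense_tuple_approximates:
  assumes dense: "\<And>z e. z \<in> mspace U \<Longrightarrow> 0 < e \<Longrightarrow> \<exists>n. mdist U z (D n) < e"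
    and a: "a \<in> tuples U n" and e: "0 < e"
  shows "\<exists>js. length js = n \<and> (\<Sum>i<n. mdist U (a i) (dense_tuple D js i)) < e"
proof -
  have e': "0 < e / (1 + real n)" using e by simp
  have "\<exists>j. mdist U (a i) (D j) < e / (1 + real n)" if "i < n" for i
    using a that by (intro dense e') (auto simp: tuples_def)
  then obtain j where j: "\<And>i. i < n \<Longrightarrow> mdist U (a i) (D (j i)) < e / (1 + real n)" by metis
  have "(\<Sum>i<n. mdist U (a i) (D (j i))) \<le> (\<Sum>i<n. e / (1 + real n))" using j by (intro sum_mono) (simp add: less_imp_le)
  also have "\<dots> < e" using e by (simp add: field_simps)
  finally show ?thesis by (intro exI[of _ "map j [0..<n]"]) (simp add: dense_tuple_def)
qed

text \<open>
  Structures are uniformly Lipschitz, so evaluations at tuples from a dense sequence suffice.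
\<close>
lemma controls_Mod_topology:
  fixes D :: "nat \<Rightarrow> 'u" and L :: "(unit, 'r) language"
  assumes D: "\<And>n. D n \<in> mspace U" and dense: "\<And>z e. z \<in> mspace U \<Longrightarrow> 0 < e \<Longrightarrow> \<exists>n. mdist U z (D n) < e"
  shows "controls (Mod_topology U L) {\<lambda>N. N R (dense_tuple D js) | R js. R \<in> rels L \<and> length js = length (arity L R)}"
  unfolding controls_def
proof (intro allI impI, elim conjE)
  define T where "T = (\<lambda>R. product_topology (\<lambda>_. euclideanreal) (tuples U (length (arity L R))))"
  fix V N assume V: "openin (Mod_topology U L) V" and N: "N \<in> V"
  obtain V' where V': "openin (product_topology T (rels L)) V'" "V = V' \<inter> Mod U L"
    using V unfolding Mod_topology_def openin_subtopology T_def by blast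
  have NM: "N \<in> Mod U L" using N V' by blast
  obtain W where W: "finite {R \<in> rels L. W R \<noteq> topspace (T R)}" "\<And>R. R \<in> rels L \<Longrightarrow> openin (T R) (W R)"
    "N \<in> Pi\<^sub>E (rels L) W" "Pi\<^sub>E (rels L) W \<subseteq> V'"
  proof -
    have "N \<in> V'" using N V'(2) by simp
    from V'(1)[unfolded openin_product_topology_alt, rule_format, OF this]
    show thesis using that by blast
  qed
  define B where "B = {R \<in> rels L. W R \<noteq> topspace (T R)}"
  let ?n = "\<lambda>R. length (arity L R)"
  have "\<exists>Y. finite {a \<in> tuples U (?n R). Y a \<noteq> UNIV} \<and> (\<forall>a\<in>tuples U (?n R). open (Y a)) \<and> 
     N R \<in> Pi\<^sub>E (tuples U (?n R)) Y \<and> Pi\<^sub>E (tuples U (?n R)) Y \<subseteq> W R" if R: "R \<in> rels L" for R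
  proof -
    have "N R \<in> W R" using W(3) R by (rule PiE_mem)
    from W(2)[OF R, unfolded T_def openin_product_topology_alt, rule_format, OF this]
    show ?thesis by simp
  qed
  then have "\<forall>R\<in>rels L. \<exists>Y. finite {a \<in> tuples U (?n R). Y a \<noteq> UNIV} \<and> (\<forall>a\<in>tuples U (?n R). open (Y a)) \<and> 
     N R \<in> Pi\<^sub>E (tuples U (?n R)) Y \<and> Pi\<^sub>E (tuples U (?n R)) Y \<subseteq> W R" by (rule ballI)
  from bchoice[OF this] obtain Y where Y0: "\<forall>R\<in>rels L. finite {a \<in> tuples U (?n R). Y R a \<noteq> UNIV} \<and>
     (\<forall>a\<in>tuples U (?n R). open (Y R a)) \<and> N R \<in> Pi\<^sub>E (tuples U (?n R)) (Y R) \<and> Pi\<^sub>E (tuples U (?n R)) (Y R) \<subseteq> W R" ..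
  have Y: "finite {a \<in> tuples U (?n R). Y R a \<noteq> UNIV}" "a \<in> tuples U (?n R) \<Longrightarrow> open (Y R a)"
    "N R \<in> Pi\<^sub>E (tuples U (?n R)) (Y R)" "Pi\<^sub>E (tuples U (?n R)) (Y R) \<subseteq> W R" if "R \<in> rels L" for R a
    using Y0[rule_format, OF that] by simp_all
  define P where "P = (SIGMA R:B. {a \<in> tuples U (?n R). Y R a \<noteq> UNIV})"
  have P: "finite P" unfolding P_def using W(1) Y(1) by (intro finite_SigmaI) (auto simp: B_def)
  have PD: "R \<in> rels L" "a \<in> tuples U (?n R)" if "(R, a) \<in> P" for R a using that by (auto simp: P_def B_def)
  have "\<exists>r>0. \<forall>y. \<bar>y - N R a\<bar> < r \<longrightarrow> y \<in> Y R a" if "(R, a) \<in> P" for R a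
  proof -
    have "open (Y R a)" "N R a \<in> Y R a"
      using Y(2)[OF PD[OF that]] PiE_mem[OF Y(3)[OF PD(1)[OF that]] PD(2)[OF that]] by simp_all
    then show ?thesis unfolding open_dist dist_real_def by blast
  qed
  then obtain r where r: "\<And>R a. (R, a) \<in> P \<Longrightarrow> 0 < r R a" "\<And>R a y. (R, a) \<in> P \<Longrightarrow> \<bar>y - N R a\<bar> < r R a \<Longrightarrow> y \<in> Y R a"
    by metis
  have "\<exists>js. length js = ?n R \<and> (\<Sum>i<?n R. mdist U (a i) (dense_tuple D js i)) < r R a / 3" if "(R, a) \<in> P" for R a
    using dense_tuple_approximates[OF dense PD(2)[OF that], of "r R a / 3"] r(1)[OF that] by simp
  then obtain js where js: "\<And>R a. (R, a) \<in> P \<Longrightarrow> length (js R a) = ?n R"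
    "\<And>R a. (R, a) \<in> P \<Longrightarrow> (\<Sum>i<?n R. mdist U (a i) (dense_tuple D (js R a) i)) < r R a / 3" by metis
  define \<epsilon> where "\<epsilon> = Min (insert 1 ((\<lambda>(R, a). r R a / 3) ` P))"
  have \<epsilon>0: "0 < \<epsilon>" unfolding \<epsilon>_def using P r(1) by (subst Min_gr_iff) auto
  have \<epsilon>_le: "\<epsilon> \<le> r R a / 3" if "(R, a) \<in> P" for R a unfolding \<epsilon>_def using P that by (intro Min_le) force+
  show "\<exists>F \<epsilon>. finite F \<and> F \<subseteq> {\<lambda>N. N R (dense_tuple D js) | R js. R \<in> rels L \<and> length js = length (arity L R)} \<and> 0 < \<epsilon> \<and>
     (\<forall>N'\<in>topspace (Mod_topology U L). (\<forall>e\<in>F. \<bar>e N' - e N\<bar> < \<epsilon>) \<longrightarrow> N' \<in> V)"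
  proof (intro exI[of _ "(\<lambda>(R, a) N. N R (dense_tuple D (js R a))) ` P"] exI[of _ \<epsilon>] conjI ballI impI)
    show "(\<lambda>(R, a) N. N R (dense_tuple D (js R a))) ` P \<subseteq> {\<lambda>N. N R (dense_tuple D js) | R js. R \<in> rels L \<and> length js = length (arity L R)}"
    proof (rule image_subsetI)
      fix x assume "x \<in> P"
      moreover obtain R a where "x = (R, a)" by force
      ultimately show "(case x of (R, a) \<Rightarrow> \<lambda>N. N R (dense_tuple D (js R a))) \<in>
          {\<lambda>N. N R (dense_tuple D js) | R js. R \<in> rels L \<and> length js = length (arity L R)}"
        using js(1)[of R a] PD(1)[of R a] by auto
    qed
    fix N' assume "N' \<in> topspace (Mod_topology U L)"
      and close: "\<forall>e\<in>(\<lambda>(R, a) N. N R (dense_tuple D (js R a))) ` P. \<bar>e N' - e N\<bar> < \<epsilon>"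
    then have N': "N' \<in> Mod U L" by simp
    have N'Y: "N' R a \<in> Y R a" if P: "(R, a) \<in> P" for R a
    proof -
      have t: "dense_tuple D (js R a) \<in> tuples U (?n R)" using js(1)[OF P] D by (auto simp: tuples_def dense_tuple_def)
      have "\<bar>N' R (dense_tuple D (js R a)) - N R (dense_tuple D (js R a))\<bar> < \<epsilon>" using close P by force
      then have "\<bar>N' R a - N R a\<bar> < r R a"
        using ModD(2)[OF N' PD(1)[OF P] PD(2)[OF P] t] ModD(2)[OF NM PD(1)[OF P] PD(2)[OF P] t] js(2)[OF P] \<epsilon>_le[OF P] r(1)[OF P]
        by linarith
      then show ?thesis by (rule r(2)[OF P])
    qed
    have "N' R \<in> W R" if R: "R \<in> rels L" for R
    proof (cases "R \<in> B")
      case True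
      have "N' R a \<in> Y R a" if a: "a \<in> tuples U (?n R)" for a
        using N'Y[of R a] True a by (cases "Y R a = UNIV") (auto simp: P_def)
      then have "N' R \<in> Pi\<^sub>E (tuples U (?n R)) (Y R)" using ModD(1)[OF N' R] by (auto simp: PiE_iff)
      then show ?thesis using Y(4)[OF R] by blast
    next
      case False
      then show ?thesis using R ModD(1)[OF N' R] by (auto simp: B_def T_def PiE_iff)
    qed
    then have "N' \<in> Pi\<^sub>E (rels L) W" using N' by (auto simp: Mod_def PiE_iff)
    then show "N' \<in> V" using W(4) V'(2) N' by blast
  qed (use P \<epsilon>0 in auto)
qed

section \<open>Sections of metric-etale spaces\<close>

lemma metric_etaleD:
  assumes "metric_etale_space X A"
  shows "mspace (met A) = topspace (tp A)" "mcomplete_of (met A)"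
    "a \<in> topspace (tp A) \<Longrightarrow> b \<in> topspace (tp A) \<Longrightarrow> mdist (met A) a b \<le> 1"
    "continuous_map (tp A) X (proj A)" "openin (tp A) V \<Longrightarrow> openin X (proj A ` V)"
    "a \<in> topspace (tp A) \<Longrightarrow> b \<in> topspace (tp A) \<Longrightarrow> proj A a \<noteq> proj A b \<Longrightarrow> mdist (met A) a b = 1"
  using assms unfolding metric_etale_space_def topometric_def diameter_le1_def open_map_def by auto

lemma etale_small_box:
  assumes A: "metric_etale_space X A" and ab: "a \<in> topspace (tp A)" "b \<in> topspace (tp A)" "proj A a = proj A b"
    and r: "mdist (met A) a b < r"
  obtains V V' where "openin (tp A) V" "openin (tp A) V'" "a \<in> V" "b \<in> V'"
    "\<And>v v'. v \<in> V \<Longrightarrow> v' \<in> V' \<Longrightarrow> proj A v = proj A v' \<Longrightarrow> mdist (met A) v v' < r"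
proof -
  let ?G = "{(a, b). a \<in> topspace (tp A) \<and> b \<in> topspace (tp A) \<and> proj A a = proj A b \<and> mdist (met A) a b < r}"
  have "0 < r" using r mdist_nonneg[of "met A" a b] by linarith
  then have "openin (subtopology (prod_topology (tp A) (tp A)) {(a, b). proj A a = proj A b}) ?G"
    using A unfolding metric_etale_space_def by blast
  then obtain T where T: "openin (prod_topology (tp A) (tp A)) T" "?G = T \<inter> {(a, b). proj A a = proj A b}"
    unfolding openin_subtopology by blast
  have "(a, b) \<in> T" using ab r T(2) by blast
  then obtain V V' where V: "openin (tp A) V" "openin (tp A) V'" "a \<in> V" "b \<in> V'" "V \<times> V' \<subseteq> T"
    using T(1)[unfolded openin_prod_topology_alt, rule_format, of a b] by blast
  show thesis
  proof (rule that[OF V(1-4)])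
    fix v v' assume v: "v \<in> V" "v' \<in> V'" "proj A v = proj A v'"
    then have "(v, v') \<in> ?G" unfolding T(2) using V(5) by blast
    then show "mdist (met A) v v' < r" by simp
  qed
qed

text \<open>
  This openness turns a condition on the distance of \<open>f a\<close> and \<open>b\<close> into a subbasic open set of
  isomorphisms: \<open>f\<close> maps some point of one open set into the thickening of another.
\<close>
lemma openin_fiberwise_thickening:
  assumes A: "metric_etale_space X A" and V: "openin (tp A) V"
  shows "openin (tp A) {a \<in> topspace (tp A). \<exists>b\<in>V. proj A a = proj A b \<and> mdist (met A) a b < r}" (is "openin _ ?T")
proof (subst openin_subopen, intro ballI)
  fix a assume "a \<in> ?T"
  then obtain b where a: "a \<in> topspace (tp A)" and b: "b \<in> V" "proj A a = proj A b" "mdist (met A) a b < r" by blast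
  have bt: "b \<in> topspace (tp A)" using openin_subset[OF V] b by blast
  obtain S S' where S: "openin (tp A) S" "openin (tp A) S'" "a \<in> S" "b \<in> S'"
    "\<And>v v'. v \<in> S \<Longrightarrow> v' \<in> S' \<Longrightarrow> proj A v = proj A v' \<Longrightarrow> mdist (met A) v v' < r"
    using etale_small_box[OF A a bt b(2,3)] by metis
  have "openin X (proj A ` (S' \<inter> V))" using metric_etaleD(5)[OF A] S(2) V by blast
  then have "openin (tp A) {a \<in> topspace (tp A). proj A a \<in> proj A ` (S' \<inter> V)}"
    using metric_etaleD(4)[OF A] openin_continuous_map_preimage by blast
  then have "openin (tp A) (S \<inter> {a \<in> topspace (tp A). proj A a \<in> proj A ` (S' \<inter> V)})" using S(1) by blast
  moreover have "a \<in> S \<inter> {a \<in> topspace (tp A). proj A a \<in> proj A ` (S' \<inter> V)}" using a b S by auto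
  moreover have "S \<inter> {a \<in> topspace (tp A). proj A a \<in> proj A ` (S' \<inter> V)} \<subseteq> ?T" using S(5) by blast
  ultimately show "\<exists>T. openin (tp A) T \<and> a \<in> T \<and> T \<subseteq> ?T" by blast
qed

lemma second_countable_basis_sequence:
  assumes "second_countable T"
  shows "\<exists>B :: nat \<Rightarrow> 'a set. (\<forall>k. openin T (B k)) \<and> (\<forall>V a. openin T V \<and> a \<in> V \<longrightarrow> (\<exists>k. a \<in> B k \<and> B k \<subseteq> V))"
proof -
  obtain \<B> where \<B>: "countable \<B>" "\<And>V. V \<in> \<B> \<Longrightarrow> openin T V" "\<And>V a. openin T V \<Longrightarrow> a \<in> V \<Longrightarrow> \<exists>B\<in>\<B>. a \<in> B \<and> B \<subseteq> V"
    using assms unfolding second_countable_def by metis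
  have c: "countable (insert {} \<B>)" using \<B>(1) by simp
  show ?thesis
  proof (intro exI[of _ "from_nat_into (insert {} \<B>)"] conjI allI impI; (elim conjE)?)
    show "openin T (from_nat_into (insert {} \<B>) k)" for k
      using from_nat_into[of "insert {} \<B>" k] \<B>(2) by auto
    show "\<exists>k. a \<in> from_nat_into (insert {} \<B>) k \<and> from_nat_into (insert {} \<B>) k \<subseteq> V" if V: "openin T V" "a \<in> V" for V a
    proof -
      obtain b where b: "b \<in> \<B>" "a \<in> b" "b \<subseteq> V" using \<B>(3)[OF V] by blast
      obtain k where "from_nat_into (insert {} \<B>) k = b" using from_nat_into_surj[OF c, of b] b(1) by auto
      then show ?thesis using b by blast
    qed
  qed
qed

lemma fiberD: "a \<in> fiber A x \<longleftrightarrow> a \<in> topspace (tp A) \<and> proj A a = x"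
  by (simp add: fiber_def)

text \<open>
  \<open>s k\<close> is a section over the projection of the basic set \<open>B k\<close>. The index \<open>\<kappa> k x n\<close> is a Borel
  approximation of it: every point of \<open>B (\<kappa> k x n)\<close> over \<open>x\<close> is close to \<open>s k x\<close>. The points \<open>s k x\<close> themselves come
  from the axiom of choice; measurability of what depends on them is derived from that of \<open>\<kappa>\<close>.
\<close>
definition section_system :: "'x topology \<Rightarrow> ('x, 'a) space_over \<Rightarrow> (nat \<Rightarrow> 'a set) \<Rightarrow> (nat \<Rightarrow> 'x \<Rightarrow> nat \<Rightarrow> nat) \<Rightarrow> (nat \<Rightarrow> 'x \<Rightarrow> 'a) \<Rightarrow> bool" where
  "section_system X A B \<kappa> s \<longleftrightarrow>
    (\<forall>k. openin (tp A) (B k)) \<and>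
    (\<forall>k n. (\<lambda>x. \<kappa> k x n) \<in> measurable (borel_of X) (count_space UNIV)) \<and>
    (\<forall>k. \<forall>x\<in>proj A ` B k. s k x \<in> fiber A x \<and>
       (\<forall>n. (\<exists>b\<in>B (\<kappa> k x n). b \<in> fiber A x) \<and> (\<forall>b\<in>B (\<kappa> k x n). b \<in> fiber A x \<longrightarrow> mdist (met A) b (s k x) \<le> 3 * (1/2) ^ n))) \<and>
    (\<forall>x. \<forall>a\<in>fiber A x. \<forall>e>0. \<exists>k. x \<in> proj A ` B k \<and> mdist (met A) a (s k x) < e)"

lemma section_systemD:
  assumes "section_system X A B \<kappa> s"
  shows "openin (tp A) (B k)" "(\<lambda>x. \<kappa> k x n) \<in> measurable (borel_of X) (count_space UNIV)"
    "x \<in> proj A ` B k \<Longrightarrow> s k x \<in> fiber A x"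
    "x \<in> proj A ` B k \<Longrightarrow> \<exists>b\<in>B (\<kappa> k x n). b \<in> fiber A x"
    "x \<in> proj A ` B k \<Longrightarrow> b \<in> B (\<kappa> k x n) \<Longrightarrow> b \<in> fiber A x \<Longrightarrow> mdist (met A) b (s k x) \<le> 3 * (1/2) ^ n"
    "a \<in> fiber A x \<Longrightarrow> 0 < e \<Longrightarrow> \<exists>k. x \<in> proj A ` B k \<and> mdist (met A) a (s k x) < e"
  using assms unfolding section_system_def by blast+

text \<open>
  Openness of the relation \<open>d a b < r\<close> in the fiber product provides basic neighbourhoods of small fiber
  diameter. Starting from \<open>B k\<close>, choose a decreasing sequence of such sets over \<open>x\<close>; the condition that
  a basic set has a point over \<open>x\<close> is open in \<open>x\<close> because the projection is open.
\<close>
lemma shrinking_sections: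
  assumes A: "metric_etale_space X A" and sc: "second_countable (tp A)"
  shows "\<exists>B \<kappa> s. section_system X A B \<kappa> s"
proof -
  let ?d = "mdist (met A)"
  obtain B where B0: "(\<forall>k :: nat. openin (tp A) (B k)) \<and> (\<forall>V a. openin (tp A) V \<and> a \<in> V \<longrightarrow> (\<exists>k. a \<in> B k \<and> B k \<subseteq> V))"
    using second_countable_basis_sequence[OF sc] ..
  note B = B0[THEN conjunct1, rule_format] B0[THEN conjunct2, rule_format, OF conjI]
  have Bt: "b \<in> topspace (tp A)" if "b \<in> B k" for b k using openin_subset[OF B(1)] that by blast
  define small where "small = (\<lambda>n V. \<forall>a\<in>V. \<forall>b\<in>V. proj A a = proj A b \<longrightarrow> ?d a b < (1/2) ^ n)"
  have small_ex: "\<exists>k. a \<in> B k \<and> B k \<subseteq> V \<and> small n (B k)" if V: "openin (tp A) V" "a \<in> V" for V a n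
  proof -
    have a: "a \<in> topspace (tp A)" using openin_subset[OF V(1)] V(2) by blast
    have "?d a a = 0" by (rule mdist_self) (simp add: metric_etaleD(1)[OF A] a)
    then have "?d a a < (1/2) ^ n" by simp
    then obtain S S' where S: "openin (tp A) S" "openin (tp A) S'" "a \<in> S" "a \<in> S'"
      "\<And>v v'. v \<in> S \<Longrightarrow> v' \<in> S' \<Longrightarrow> proj A v = proj A v' \<Longrightarrow> ?d v v' < (1/2) ^ n"
      using etale_small_box[OF A a a refl] by metis
    have "openin (tp A) (V \<inter> (S \<inter> S'))" "a \<in> V \<inter> (S \<inter> S')" using V S by auto
    from B(2)[OF this] obtain k where "a \<in> B k" "B k \<subseteq> V \<inter> (S \<inter> S')" by blast
    then show ?thesis unfolding small_def using S(5) by blast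
  qed
  define S where "S = (\<lambda>x n k k'. x \<in> proj A ` B k \<longrightarrow> x \<in> proj A ` B k' \<and> B k' \<subseteq> B k \<and> small n (B k'))"
  have "\<exists>\<sigma>. (\<forall>x. \<sigma> x 0 = k) \<and> (\<forall>x\<in>topspace X. \<forall>n. S x n (\<sigma> x n) (\<sigma> x (Suc n))) \<and>
     (\<forall>n. (\<lambda>x. \<sigma> x n) \<in> measurable (borel_of X) (count_space UNIV))" for k
  proof (rule measurable_choice_sequence[of "borel_of X" S "\<lambda>_ _ _. True" k])
    show "{x \<in> space (borel_of X). S x n k k'} \<in> sets (borel_of X)" for n k k'
    proof -
      have o: "proj A ` B k \<in> sets (borel_of X)" for k using metric_etaleD(5)[OF A B(1)] by (rule sets_borel_of_open)
      show ?thesis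
      proof (cases "B k' \<subseteq> B k \<and> small n (B k')")
        case True
        then have "{x \<in> space (borel_of X). S x n k k'} = (space (borel_of X) - proj A ` B k) \<union> (proj A ` B k' \<inter> space (borel_of X))"
          unfolding S_def by auto
        then show ?thesis using o by (simp only: sets.Un sets.Diff sets.Int sets.top)
      next
        case False
        then have "{x \<in> space (borel_of X). S x n k k'} = (space (borel_of X) - proj A ` B k)" unfolding S_def by auto
        then show ?thesis using o by (simp only: sets.Diff sets.top)
      qed
    qed
    show "\<exists>k'. S x n k k'" for x n k
    proof (cases "x \<in> proj A ` B k")
      case True
      then obtain a where a: "a \<in> B k" "proj A a = x" by blast
      then obtain k' where "a \<in> B k'" "B k' \<subseteq> B k" "small n (B k')" using small_ex[OF B(1)] by metis
      then show ?thesis unfolding S_def using a by blast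
    qed (simp add: S_def)
  qed (auto simp del: One_nat_def)
  then obtain \<sigma> where \<sigma>: "\<And>k x. \<sigma> k x 0 = k" "\<And>k x n. x \<in> topspace X \<Longrightarrow> S x n (\<sigma> k x n) (\<sigma> k x (Suc n))"
    "\<And>k n. (\<lambda>x. \<sigma> k x n) \<in> measurable (borel_of X) (count_space UNIV)" by metis
  have proj_in: "x \<in> topspace X" if "x \<in> proj A ` B k" for x k
    using openin_subset[OF metric_etaleD(5)[OF A B(1)]] that by blast
  have in_proj: "x \<in> proj A ` B (\<sigma> k x n)" if x: "x \<in> proj A ` B k" for k x n
    by (induction n) (use x \<sigma>(1) \<sigma>(2)[OF proj_in[OF x]] in \<open>auto simp: S_def\<close>)
  have shrink: "B (\<sigma> k x (Suc n)) \<subseteq> B (\<sigma> k x n)" "small n (B (\<sigma> k x (Suc n)))" if x: "x \<in> proj A ` B k" for k x n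
    using \<sigma>(2)[OF proj_in[OF x], of n k] in_proj[OF x, of n] by (simp_all add: S_def)
  have sub: "B (\<sigma> k x n) \<subseteq> B k" if x: "x \<in> proj A ` B k" for k x n
    by (induction n) (use shrink(1)[OF x] \<sigma>(1) in auto)
  have "\<exists>l\<in>fiber A x. (\<forall>n. \<forall>b\<in>B (\<sigma> k x (Suc n)). b \<in> fiber A x \<longrightarrow> ?d b l \<le> 3 * (1/2) ^ n)"
    if x: "x \<in> proj A ` B k" for k x
  proof -
    have "\<forall>n. \<exists>a. a \<in> B (\<sigma> k x (Suc n)) \<and> proj A a = x" using in_proj[OF x] by blast
    then obtain a where a: "\<And>n. a n \<in> B (\<sigma> k x (Suc n))" "\<And>n. proj A (a n) = x" by metis
    have at: "a n \<in> mspace (met A)" for n using Bt[OF a(1)] metric_etaleD(1)[OF A] by simp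
    have close: "?d b c < (1/2) ^ n" if "b \<in> B (\<sigma> k x (Suc n))" "c \<in> B (\<sigma> k x (Suc n))" "proj A b = proj A c" for b c n
      using shrink(2)[OF x] that unfolding small_def by blast
    have "?d (a n) (a (Suc n)) \<le> 1 * (1/2) ^ n" for n
      using close[OF a(1) subsetD[OF shrink(1)[OF x] a(1)], of n] a(2) by (simp add: less_imp_le)
    then obtain l where l: "l \<in> mspace (met A)" "\<And>n. ?d (a n) l \<le> 2 * (1/2) ^ n"
      using geometric_sequence_limit[OF metric_etaleD(2)[OF A], of 0 a 1] at by auto
    \<comment> \<open>A distance below 1 keeps the limit in the fiber.\<close>
    have "?d (a 2) l < 1" using l(2)[of 2] by (simp add: power2_eq_square)
    then have "proj A (a 2) = proj A l"
      using metric_etaleD(6)[OF A, of "a 2" l] at l(1) metric_etaleD(1)[OF A] by fastforce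
    then have lf: "l \<in> fiber A x" using l(1) metric_etaleD(1)[OF A] a(2) by (simp add: fiberD)
    have "?d b l \<le> 3 * (1/2) ^ n" if b: "b \<in> B (\<sigma> k x (Suc n))" "b \<in> fiber A x" for b n
    proof -
      have "?d b l \<le> ?d b (a n) + ?d (a n) l"
        using at l(1) b metric_etaleD(1)[OF A] by (intro mdist_triangle) (auto simp: fiberD)
      moreover have "?d b (a n) < (1/2) ^ n" using close[OF b(1) a(1)] b(2) a(2) by (simp add: fiberD)
      ultimately show ?thesis using l(2)[of n] by linarith
    qed
    then show ?thesis using lf by blast
  qed
  then have lim: "\<exists>l. l \<in> fiber A x \<and> (\<forall>n. \<forall>b\<in>B (\<sigma> k x (Suc n)). b \<in> fiber A x \<longrightarrow> ?d b l \<le> 3 * (1/2) ^ n)"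
    if "x \<in> proj A ` B k" for k x using that by blast
  define s where "s = (\<lambda>k x. SOME l. l \<in> fiber A x \<and> (\<forall>n. \<forall>b\<in>B (\<sigma> k x (Suc n)). b \<in> fiber A x \<longrightarrow> ?d b l \<le> 3 * (1/2) ^ n))"
  have s: "s k x \<in> fiber A x" "b \<in> B (\<sigma> k x (Suc n)) \<Longrightarrow> b \<in> fiber A x \<Longrightarrow> ?d b (s k x) \<le> 3 * (1/2) ^ n"
    if x: "x \<in> proj A ` B k" for k x n b
    using someI_ex[OF lim[OF x]] unfolding s_def by simp_all
  have ex: "\<exists>b\<in>B (\<sigma> k x n). b \<in> fiber A x" if "x \<in> proj A ` B k" for k x n
    using in_proj[OF that, of n] Bt by (auto simp: fiberD)
  have dense: "\<exists>k. x \<in> proj A ` B k \<and> ?d a (s k x) < e" if a: "a \<in> fiber A x" and e: "0 < e" for x a e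
  proof -
    obtain n where n: "4 * (1/2) ^ n < e" using geometric_small[OF e] by blast
    have at: "a \<in> topspace (tp A)" "proj A a = x" using a by (auto simp: fiberD)
    obtain k where k: "a \<in> B k" "small n (B k)" using small_ex[OF openin_topspace at(1)] by blast
    then have x: "x \<in> proj A ` B k" using at(2) by blast
    obtain b where b: "b \<in> B (\<sigma> k x (Suc n))" "b \<in> fiber A x" using ex[OF x] by blast
    have "?d a b < (1/2) ^ n" using k sub[OF x] b at(2) unfolding small_def fiberD by blast
    moreover have "?d a (s k x) \<le> ?d a b + ?d b (s k x)"
      using at b s(1)[OF x] metric_etaleD(1)[OF A] by (intro mdist_triangle) (auto simp: fiberD)
    ultimately have "?d a (s k x) < e" using s(2)[OF x b] n by linarith
    then show ?thesis using x by blast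
  qed
  show ?thesis
    unfolding section_system_def
    by (rule exI[of _ B], rule exI[of _ "\<lambda>k x n. \<sigma> k x (Suc n)"], rule exI[of _ s])
      (intro conjI allI ballI impI;
        (rule B(1) | rule \<sigma>(3) | (erule s(1)) | (erule ex) | (erule s(2), assumption+) | (rule dense; assumption)))
qed

section \<open>The sorts of a fiber as one metric space\<close>

text \<open>
  The extra point \<open>None\<close> serves as the value of a section outside its domain and keeps the space nonempty.
\<close>
definition points :: "('s, 'r) language \<Rightarrow> ('s, 'r, 'x, 'a) etale_structure \<Rightarrow> 'x \<Rightarrow> ('s \<times> 'a) option set" where
  "points L M x = insert None {Some (P, a) | P a. P \<in> sorts L \<and> a \<in> fiber (srt M P) x}"

text \<open>
  One metric on the whole type: inside a sort, points over different base points are already at distance 1,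
  and any two distinct values without a common sort are put at distance 1. In this way distances of
  trees do not depend on the fiber in which they are computed.
\<close>
definition pdist :: "('s, 'r) language \<Rightarrow> ('s, 'r, 'x, 'a) etale_structure \<Rightarrow> ('s \<times> 'a) option \<Rightarrow> ('s \<times> 'a) option \<Rightarrow> real" where
  "pdist L M p q =
     (if \<exists>P\<in>sorts L. \<exists>a\<in>topspace (tp (srt M P)). \<exists>b\<in>topspace (tp (srt M P)). p = Some (P, a) \<and> q = Some (P, b)
      then mdist (met (srt M (fst (the p)))) (snd (the p)) (snd (the q))
      else if p = q then 0 else 1)"

definition lift_iso :: "('s \<Rightarrow> 'a \<Rightarrow> 'a) \<Rightarrow> ('s \<times> 'a) option \<Rightarrow> ('s \<times> 'a) option" where
  "lift_iso f = map_option (\<lambda>(P, a). (P, f P a))"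

lemma lift_iso_simps [simp]: "lift_iso f None = None" "lift_iso f (Some (P, a)) = Some (P, f P a)"
  by (simp_all add: lift_iso_def)

lemma sort_lift_iso [simp]: "map_option fst (lift_iso f p) = map_option fst p"
  by (cases p) auto

locale etale =
  fixes L0 :: "('s, 'r) language" and X :: "'x topology" and M :: "('s, 'r, 'x, 'a) etale_structure"
  assumes etale: "metric_etale_structure L0 X M" and sc: "second_countable_structure L0 X M"
begin

lemma sort_etale: "P \<in> sorts L0 \<Longrightarrow> metric_etale_space X (srt M P)"
  using etale unfolding metric_etale_structure_def by blast

lemma is_lang: "is_language L0"
  using etale unfolding metric_etale_structure_def by blast

lemma sort_second_countable: "P \<in> sorts L0 \<Longrightarrow> second_countable (tp (srt M P))"
  using sc unfolding second_countable_structure_def by blast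

lemma countable_sorts: "countable (sorts L0)" and countable_rels: "countable (rels L0)"
  using sc unfolding second_countable_structure_def countable_language_def by blast+

lemma arity_sorts: "R \<in> rels L0 \<Longrightarrow> i < length (arity L0 R) \<Longrightarrow> arity L0 R ! i \<in> sorts L0"
  using is_lang unfolding is_language_def by (meson nth_mem subsetD)

lemma mspace_sort: "P \<in> sorts L0 \<Longrightarrow> mspace (met (srt M P)) = topspace (tp (srt M P))"
  using metric_etaleD(1)[OF sort_etale] .

abbreviation "dP \<equiv> pdist L0 M"

lemma pdist_same:
  "P \<in> sorts L0 \<Longrightarrow> a \<in> topspace (tp (srt M P)) \<Longrightarrow> b \<in> topspace (tp (srt M P)) \<Longrightarrow>
     dP (Some (P, a)) (Some (P, b)) = mdist (met (srt M P)) a b"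
  unfolding pdist_def by auto

lemma pdist_cases:
  obtains (same) P a b where "P \<in> sorts L0" "a \<in> topspace (tp (srt M P))" "b \<in> topspace (tp (srt M P))"
      "p = Some (P, a)" "q = Some (P, b)" "dP p q = mdist (met (srt M P)) a b"
  | (discrete) "dP p q = (if p = q then 0 else 1)" 
      "\<not> (\<exists>P\<in>sorts L0. \<exists>a\<in>topspace (tp (srt M P)). \<exists>b\<in>topspace (tp (srt M P)). p = Some (P, a) \<and> q = Some (P, b))"
proof (cases "\<exists>P\<in>sorts L0. \<exists>a\<in>topspace (tp (srt M P)). \<exists>b\<in>topspace (tp (srt M P)). p = Some (P, a) \<and> q = Some (P, b)")
  case True
  then show ?thesis using same pdist_same by blast
next
  case False
  then have "dP p q = (if p = q then 0 else 1)" unfolding pdist_def by (rule if_not_P)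
  then show ?thesis using discrete False by blast
qed

lemma pdist_refl: "dP p p = 0"
  by (cases p p rule: pdist_cases) (use mspace_sort in auto)

lemma pdist_range: "0 \<le> dP p q" "dP p q \<le> 1"
  by (cases p q rule: pdist_cases; use metric_etaleD(3)[OF sort_etale] in auto)+

lemma pdist_sym: "dP p q = dP q p"
proof (cases p q rule: pdist_cases)
  case (same P a b)
  then show ?thesis using pdist_same[of P b a] by (simp add: mdist_commute)
next
  case discrete
  then show ?thesis by (cases q p rule: pdist_cases) auto
qed

lemma pdist_triangle: "dP p s \<le> dP p q + dP q s"
proof (cases "dP p q = 1 \<or> dP q s = 1")
  case True
  then show ?thesis using pdist_range[of p q] pdist_range[of q s] pdist_range[of p s] by linarith
next
  case False
  show ?thesis
  proof (cases p q rule: pdist_cases)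
    case pq: (same P a b)
    show ?thesis
    proof (cases q s rule: pdist_cases)
      case qs: (same Q b' c)
      then have "P = Q" "b = b'" using pq by auto
      then show ?thesis
        using pq qs pdist_same[of P a c] mdist_triangle[of a "met (srt M P)" b c] mspace_sort[of P] by simp
    next
      case discrete
      then show ?thesis using False by (auto split: if_splits)
    qed
  next
    case discrete
    then show ?thesis using False by (auto split: if_splits)
  qed
qed

lemma pseudometric_pdist: "pseudometric_on UNIV dP"
  unfolding pseudometric_on_def
  by (intro conjI ballI) (rule pdist_refl pdist_range pdist_sym pdist_triangle)+

lemma pdist_sort: "dP p q < 1 \<Longrightarrow> map_option fst p = map_option fst q"
  by (cases p q rule: pdist_cases) (auto split: if_splits)

lemma pdist_other_sort: "map_option fst p \<noteq> map_option fst q \<Longrightarrow> dP p q = 1"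
  using pdist_sort[of p q] pdist_range(2)[of p q] by linarith

lemma pdist_zero_iff: "p \<in> points L0 M x \<Longrightarrow> q \<in> points L0 M y \<Longrightarrow> dP p q = 0 \<longleftrightarrow> p = q"
  by (cases p q rule: pdist_cases) (auto simp: mspace_sort)

lemma points_Some: "Some (P, a) \<in> points L0 M x \<longleftrightarrow> P \<in> sorts L0 \<and> a \<in> fiber (srt M P) x"
  by (auto simp: points_def)

lemma points_None: "None \<in> points L0 M x"
  by (simp add: points_def)

end

lemma restricted_eqI: "C \<subseteq> D \<Longrightarrow> (\<And>x. x \<in> D \<Longrightarrow> x \<in> A \<longleftrightarrow> x \<in> C) \<Longrightarrow> A \<inter> D = C"
  by blast

section \<open>Borel dependence of distances\<close>

lemma openin_generated_iso:
  "openin X V \<Longrightarrow> openin (iso_morphism_topology L X M) {(x, y, f) \<in> iso_morphisms L X M. x \<in> V}"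
  "openin X V \<Longrightarrow> openin (iso_morphism_topology L X M) {(x, y, f) \<in> iso_morphisms L X M. y \<in> V}"
  "P \<in> sorts L \<Longrightarrow> openin (tp (srt M P)) S \<Longrightarrow> openin (tp (srt M P)) T \<Longrightarrow>
    openin (iso_morphism_topology L X M) {(x, y, f) \<in> iso_morphisms L X M.
          f P ` (S \<inter> fiber (srt M P) x) \<inter> (T \<inter> fiber (srt M P) y) \<noteq> {}}"
  unfolding iso_morphism_topology_def
  by (rule topology_generated_by_Basis, rule UnI1, rule UnI1, rule CollectI, rule exI, rule conjI, rule refl, assumption)
    (rule topology_generated_by_Basis, rule UnI1, rule UnI2, rule CollectI, rule exI, rule conjI, rule refl, assumption,
     rule topology_generated_by_Basis, rule UnI2, rule CollectI, intro exI conjI, rule refl)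

lemma measurable_iso_source: "(\<lambda>(x, y, f). x) \<in> measurable (borel_of (iso_morphism_topology L X M)) (borel_of X)"
  and measurable_iso_target: "(\<lambda>(x, y, f). y) \<in> measurable (borel_of (iso_morphism_topology L X M)) (borel_of X)"
proof -
  have 1: "(\<lambda>(x, y, f). x) -` V \<inter> iso_morphisms L X M = {(x, y, f) \<in> iso_morphisms L X M. x \<in> V}"
    and 2: "(\<lambda>(x, y, f). y) -` V \<inter> iso_morphisms L X M = {(x, y, f) \<in> iso_morphisms L X M. y \<in> V}" for V by auto
  show "(\<lambda>(x, y, f). x) \<in> measurable (borel_of (iso_morphism_topology L X M)) (borel_of X)"
  proof (rule measurable_borel_ofI)
    show "(\<lambda>(x, y, f). x) \<in> space (borel_of (iso_morphism_topology L X M)) \<rightarrow> topspace X" by (auto simp: iso_morphisms_def)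
    show "(\<lambda>(x, y, f). x) -` V \<inter> space (borel_of (iso_morphism_topology L X M)) \<in> sets (borel_of (iso_morphism_topology L X M))"
      if "openin X V" for V
      using sets_borel_of_open[OF openin_generated_iso(1)[OF that]] by (simp add: 1)
  qed
  show "(\<lambda>(x, y, f). y) \<in> measurable (borel_of (iso_morphism_topology L X M)) (borel_of X)"
  proof (rule measurable_borel_ofI)
    show "(\<lambda>(x, y, f). y) \<in> space (borel_of (iso_morphism_topology L X M)) \<rightarrow> topspace X" by (auto simp: iso_morphisms_def)
    show "(\<lambda>(x, y, f). y) -` V \<inter> space (borel_of (iso_morphism_topology L X M)) \<in> sets (borel_of (iso_morphism_topology L X M))"
      if "openin X V" for V
      using sets_borel_of_open[OF openin_generated_iso(2)[OF that]] by (simp add: 2)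
  qed
qed

lemma iso_morphismsD:
  assumes "(x, y, f) \<in> iso_morphisms L X M"
  shows "x \<in> topspace X" "y \<in> topspace X" "f \<in> fiber_isomorphisms L M x y"
    "P \<in> sorts L \<Longrightarrow> bij_betw (f P) (fiber (srt M P) x) (fiber (srt M P) y)"
    "P \<in> sorts L \<Longrightarrow> a \<in> fiber (srt M P) x \<Longrightarrow> f P a \<in> fiber (srt M P) y"
    "P \<in> sorts L \<Longrightarrow> a \<in> fiber (srt M P) x \<Longrightarrow> b \<in> fiber (srt M P) x \<Longrightarrow>
      mdist (met (srt M P)) (f P a) (f P b) = mdist (met (srt M P)) a b"
proof -
  show "x \<in> topspace X" "y \<in> topspace X" and f: "f \<in> fiber_isomorphisms L M x y"
    using assms by (auto simp: iso_morphisms_def)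
  show b: "bij_betw (f P) (fiber (srt M P) x) (fiber (srt M P) y)" if "P \<in> sorts L"
    using f that by (simp add: fiber_isomorphisms_def)
  show "f P a \<in> fiber (srt M P) y" if "P \<in> sorts L" "a \<in> fiber (srt M P) x"
    using b[OF that(1)] that(2) bij_betwE by blast
  show "mdist (met (srt M P)) (f P a) (f P b) = mdist (met (srt M P)) a b"
    if "P \<in> sorts L" "a \<in> fiber (srt M P) x" "b \<in> fiber (srt M P) x"
    using f that by (simp add: fiber_isomorphisms_def)
qed

text \<open>
  All sorts together: \<open>s x c\<close> runs through a dense sequence in the space of points over \<open>x\<close>, and
  \<open>B P (\<kappa> x c n)\<close> is the \<open>n\<close>th basic set approximating \<open>s x c\<close> when this point has sort \<open>P\<close>.
\<close>
locale etale_sections = etale L0 X M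
  for L0 :: "('s, 'r) language" and X :: "'x topology" and M :: "('s, 'r, 'x, 'a) etale_structure" +
  fixes s :: "'x \<Rightarrow> nat \<Rightarrow> ('s \<times> 'a) option" and \<kappa> :: "'x \<Rightarrow> nat \<Rightarrow> nat \<Rightarrow> nat" and B :: "'s \<Rightarrow> nat \<Rightarrow> 'a set"
  assumes B: "\<And>P k. P \<in> sorts L0 \<Longrightarrow> openin (tp (srt M P)) (B P k)"
    and s_points: "\<And>x c. x \<in> topspace X \<Longrightarrow> s x c \<in> points L0 M x"
    and s_sort: "\<And>c p. {x \<in> topspace X. map_option fst (s x c) = p} \<in> sets (borel_of X)"
    and \<kappa>_meas: "\<And>c n. (\<lambda>x. \<kappa> x c n) \<in> measurable (borel_of X) (count_space UNIV)"
    and cell_ex: "\<And>x c P a n. x \<in> topspace X \<Longrightarrow> s x c = Some (P, a) \<Longrightarrow> \<exists>b\<in>B P (\<kappa> x c n). b \<in> fiber (srt M P) x"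
    and cell_close: "\<And>x c P a n b. x \<in> topspace X \<Longrightarrow> s x c = Some (P, a) \<Longrightarrow> b\<in>B P (\<kappa> x c n) \<Longrightarrow> b \<in> fiber (srt M P) x \<Longrightarrow>
       mdist (met (srt M P)) b a \<le> 3 * (1/2) ^ n"
    and s_dense: "\<And>x p e. x \<in> topspace X \<Longrightarrow> p \<in> points L0 M x \<Longrightarrow> 0 < e \<Longrightarrow> \<exists>c. dP p (s x c) < e"
begin

abbreviation "MX \<equiv> borel_of (iso_morphism_topology L0 X M)"

lemma sort_values_countable: "countable (insert None (Some ` sorts L0))"
  using countable_sorts by simp

lemma s_sort_in: "x \<in> topspace X \<Longrightarrow> map_option fst (s x c) \<in> insert None (Some ` sorts L0)"
  using s_points[of x c] by (auto simp: points_def)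

lemma s_SomeD: "x \<in> topspace X \<Longrightarrow> s x c = Some (P, a) \<Longrightarrow> P \<in> sorts L0 \<and> a \<in> fiber (srt M P) x"
  using s_points[of x c] by (simp add: points_Some)

lemma measurable_pull:
  assumes "A \<in> sets (borel_of X)"
  shows "{(x, y, f) \<in> iso_morphisms L0 X M. x \<in> A} \<in> sets MX" "{(x, y, f) \<in> iso_morphisms L0 X M. y \<in> A} \<in> sets MX"
proof -
  have "(\<lambda>(x, y, f). x) -` A \<inter> space MX = {(x, y, f) \<in> iso_morphisms L0 X M. x \<in> A}"
    "(\<lambda>(x, y, f). y) -` A \<inter> space MX = {(x, y, f) \<in> iso_morphisms L0 X M. y \<in> A}" by auto
  then show "{(x, y, f) \<in> iso_morphisms L0 X M. x \<in> A} \<in> sets MX" "{(x, y, f) \<in> iso_morphisms L0 X M. y \<in> A} \<in> sets MX"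
    using measurable_sets[OF measurable_iso_source assms, of L0 M] measurable_sets[OF measurable_iso_target assms, of L0 M] by simp_all
qed

lemma \<kappa>_level: "{x \<in> topspace X. \<kappa> x c n = k} \<in> sets (borel_of X)"
proof -
  have "(\<lambda>x. \<kappa> x c n) -` {k} \<inter> space (borel_of X) \<in> sets (borel_of X)"
    by (rule measurable_sets[OF \<kappa>_meas]) simp
  moreover have "(\<lambda>x. \<kappa> x c n) -` {k} \<inter> space (borel_of X) = {x \<in> topspace X. \<kappa> x c n = k}" by auto
  ultimately show ?thesis by simp
qed

text \<open>
  The points \<open>s x c\<close> and \<open>s y c'\<close> are within \<open>3 * (1/2) ^ n\<close> of all points of their approximating basic sets, so
  their distance is less than \<open>r\<close> iff for some \<open>n\<close> the sets contain points at distance less than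
  \<open>r - 6 * (1/2) ^ n\<close>. For fixed basic sets this is an open condition on \<open>(x, y, f)\<close>.
\<close>
lemma same_sort_distance_set:
  assumes P: "P \<in> sorts L0"
  shows "{(x, y, f) \<in> iso_morphisms L0 X M. map_option fst (s x c) = Some P \<and> map_option fst (s y c') = Some P \<and>
            dP (lift_iso f (s x c)) (s y c') < r} \<in> sets MX" (is "?L \<in> _")
proof -
  let ?d = "mdist (met (srt M P))" and ?A = "srt M P"
  define T where "T = (\<lambda>n k'. {b \<in> topspace (tp ?A). \<exists>b'\<in>B P k'. proj ?A b = proj ?A b' \<and> ?d b b' < r - 6 * (1/2) ^ n})"
  define Op where "Op = (\<lambda>n k k'. {(x, y, f) \<in> iso_morphisms L0 X M. f P ` (B P k \<inter> fiber ?A x) \<inter> (T n k' \<inter> fiber ?A y) \<noteq> {}})"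
  define G where "G = (\<lambda>n k k'. {(x, y, f) \<in> iso_morphisms L0 X M. x \<in> {x \<in> topspace X. map_option fst (s x c) = Some P}} \<inter>
     {(x, y, f) \<in> iso_morphisms L0 X M. y \<in> {y \<in> topspace X. map_option fst (s y c') = Some P}} \<inter>
     {(x, y, f) \<in> iso_morphisms L0 X M. x \<in> {x \<in> topspace X. \<kappa> x c n = k}} \<inter>
     {(x, y, f) \<in> iso_morphisms L0 X M. y \<in> {y \<in> topspace X. \<kappa> y c' n = k'}})"
  have Op: "Op n k k' \<in> sets MX" for n k k'
    unfolding Op_def T_def
    by (intro sets_borel_of_open openin_generated_iso(3) P B openin_fiberwise_thickening[OF sort_etale[OF P]])
  have G: "G n k k' \<in> sets MX" for n k k'
    unfolding G_def by (intro sets.Int measurable_pull s_sort \<kappa>_level)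
  have "?L = (\<Union>n. \<Union>k. \<Union>k'. G n k k' \<inter> Op n k k')"
  proof (intro equalityI subsetI)
    fix w assume w: "w \<in> ?L"
    obtain x y f where w': "w = (x, y, f)" by (cases w)
    have iso: "(x, y, f) \<in> iso_morphisms L0 X M" using w w' by simp
    note isoD = iso_morphismsD[OF iso]
    obtain a a' where a: "s x c = Some (P, a)" "s y c' = Some (P, a')" using w w' by auto
    have af: "a \<in> fiber ?A x" "a' \<in> fiber ?A y" using s_SomeD a isoD(1,2) by blast+
    have faf: "f P a \<in> fiber ?A y" using isoD(5)[OF P af(1)] .
    have lt: "?d (f P a) a' < r" using w w' a pdist_same[OF P, of "f P a" a'] faf af by (simp add: fiberD)
    \<comment> \<open>Passing to points of the basic sets costs \<open>6 * (1/2) ^ n\<close>, and the margin in \<open>T\<close> as much again.\<close>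
    obtain n where n: "12 * (1/2) ^ n < r - ?d (f P a) a'" using geometric_small[of "r - ?d (f P a) a'" 12] lt by auto
    obtain b where b: "b \<in> B P (\<kappa> x c n)" "b \<in> fiber ?A x" using cell_ex[OF isoD(1) a(1)] by blast
    obtain b' where b': "b' \<in> B P (\<kappa> y c' n)" "b' \<in> fiber ?A y" using cell_ex[OF isoD(2) a(2)] by blast
    have fb: "f P b \<in> fiber ?A y" using isoD(5)[OF P b(2)] .
    have "?d (f P b) b' \<le> ?d (f P b) (f P a) + ?d (f P a) b'" "?d (f P a) b' \<le> ?d (f P a) a' + ?d a' b'"
      using fb faf af b' mspace_sort[OF P] by (intro mdist_triangle; simp add: fiberD)+
    then have "?d (f P b) b' < r - 6 * (1/2) ^ n"
      using isoD(6)[OF P b(2) af(1)] cell_close[OF isoD(1) a(1) b] cell_close[OF isoD(2) a(2) b'] n mdist_commute[of "met ?A" a' b']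
      by linarith
    then have "f P b \<in> T n (\<kappa> y c' n)" using fb b' by (auto simp: T_def fiberD intro!: bexI[of _ b'])
    then have "w \<in> Op n (\<kappa> x c n) (\<kappa> y c' n)" using iso b fb w' by (auto simp: Op_def)
    moreover have "w \<in> G n (\<kappa> x c n) (\<kappa> y c' n)" using iso a isoD(1,2) w' by (simp add: G_def)
    ultimately show "w \<in> (\<Union>n. \<Union>k. \<Union>k'. G n k k' \<inter> Op n k k')" by blast
  next
    fix w assume "w \<in> (\<Union>n. \<Union>k. \<Union>k'. G n k k' \<inter> Op n k k')"
    then obtain n k k' where w: "w \<in> G n k k'" "w \<in> Op n k k'" by blast
    obtain x y f where w': "w = (x, y, f)" by (cases w)
    have iso: "(x, y, f) \<in> iso_morphisms L0 X M" using w(2) w' by (simp add: Op_def)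
    note isoD = iso_morphismsD[OF iso]
    have g: "map_option fst (s x c) = Some P" "map_option fst (s y c') = Some P" "\<kappa> x c n = k" "\<kappa> y c' n = k'"
      using w(1) w' by (auto simp: G_def)
    obtain a a' where a: "s x c = Some (P, a)" "s y c' = Some (P, a')" using g(1,2) by auto
    have af: "a \<in> fiber ?A x" "a' \<in> fiber ?A y" using s_SomeD a isoD(1,2) by blast+
    have faf: "f P a \<in> fiber ?A y" using isoD(5)[OF P af(1)] .
    obtain b where b: "b \<in> B P k" "b \<in> fiber ?A x" "f P b \<in> T n k'" "f P b \<in> fiber ?A y"
      using w(2) w' by (auto simp: Op_def)
    obtain b' where b': "b' \<in> B P k'" "proj ?A (f P b) = proj ?A b'" "?d (f P b) b' < r - 6 * (1/2) ^ n"
      using b(3) by (auto simp: T_def)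
    have b'f: "b' \<in> fiber ?A y" using b' b(4) openin_subset[OF B[OF P, of k']] by (auto simp: fiberD)
    have "?d (f P a) a' \<le> ?d (f P a) (f P b) + ?d (f P b) a'" "?d (f P b) a' \<le> ?d (f P b) b' + ?d b' a'"
      using b faf af b'f mspace_sort[OF P] by (intro mdist_triangle; simp add: fiberD)+
    moreover have "?d (f P a) (f P b) = ?d b a" using isoD(6)[OF P af(1) b(2)] by (simp add: mdist_commute)
    ultimately have "?d (f P a) a' < r"
      using cell_close[OF isoD(1) a(1), of b n] cell_close[OF isoD(2) a(2), of b' n] b b' b'f g(3,4) by simp
    then have "dP (lift_iso f (s x c)) (s y c') < r"
      using a pdist_same[OF P, of "f P a" a'] faf af by (simp add: fiberD)
    then show "w \<in> ?L" using iso a w' by simp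
  qed
  also have "\<dots> \<in> sets MX"
    by (intro sets.countable_UN' countableI_type image_subsetI sets.Int Op G)
  finally show ?thesis .
qed

lemma measurable_iso_distance:
  "(\<lambda>(x, y, f). dP (lift_iso f (s x c)) (s y c')) \<in> borel_measurable MX"
proof (rule borel_measurableI_less)
  fix r :: real
  let ?K = "insert None (Some ` sorts L0)"
  let ?V = "\<lambda>w. (case w of (x, y, f) \<Rightarrow> dP (lift_iso f (s x c)) (s y c')) < r"
  define H where "H = (\<lambda>p p'. {(x, y, f) \<in> iso_morphisms L0 X M. map_option fst (s x c) = p \<and> map_option fst (s y c') = p' \<and>
            dP (lift_iso f (s x c)) (s y c') < r})"
  have pull: "{(x, y, f) \<in> iso_morphisms L0 X M. map_option fst (s x c) = p \<and> map_option fst (s y c') = p'} \<in> sets MX" for p p'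
  proof -
    have "{(x, y, f) \<in> iso_morphisms L0 X M. map_option fst (s x c) = p \<and> map_option fst (s y c') = p'} =
       {(x, y, f) \<in> iso_morphisms L0 X M. x \<in> {x \<in> topspace X. map_option fst (s x c) = p}} \<inter>
       {(x, y, f) \<in> iso_morphisms L0 X M. y \<in> {x \<in> topspace X. map_option fst (s x c') = p'}}"
      by (auto simp: iso_morphisms_def)
    then show ?thesis using measurable_pull s_sort by (simp only: sets.Int)
  qed
  have H: "H p p' \<in> sets MX" if "p \<in> ?K" for p p'
  proof (cases "p = p'")
    case False
    then have "H p p' = (if 1 < r then {(x, y, f) \<in> iso_morphisms L0 X M. map_option fst (s x c) = p \<and> map_option fst (s y c') = p'} else {})"
      using pdist_other_sort unfolding H_def by (auto; metis sort_lift_iso)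
    then show ?thesis using pull by simp
  next
    case True
    show ?thesis
    proof (cases p)
      case None
      then have "H p p' = (if 0 < r then {(x, y, f) \<in> iso_morphisms L0 X M. map_option fst (s x c) = p \<and> map_option fst (s y c') = p'} else {})"
      proof -
        have "dP (lift_iso f (s x c)) (s y c') = 0"
          if "map_option fst (s x c) = None" "map_option fst (s y c') = None" for x y f
        proof -
          have "s x c = None" "s y c' = None" using that by simp_all
          then show ?thesis by (simp add: pdist_refl)
        qed
        then have "(x, y, f) \<in> iso_morphisms L0 X M \<and> map_option fst (s x c) = None \<and> map_option fst (s y c') = None \<and>
              dP (lift_iso f (s x c)) (s y c') < r \<longleftrightarrow>
            (x, y, f) \<in> iso_morphisms L0 X M \<and> map_option fst (s x c) = None \<and> map_option fst (s y c') = None \<and> 0 < r" for x y f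
          by metis
        then show ?thesis unfolding H_def True[symmetric] None by (simp only:) simp
      qed
      then show ?thesis using pull by simp
    next
      case (Some P)
      then show ?thesis using same_sort_distance_set[of P c c' r] that True unfolding H_def by auto
    qed
  qed
  have "{w \<in> space MX. ?V w} = (\<Union>p\<in>?K. \<Union>p'\<in>?K. H p p')"
  proof (intro equalityI subsetI)
    fix w assume w: "w \<in> {w \<in> space MX. ?V w}"
    obtain x y f where w': "w = (x, y, f)" by (cases w)
    have iso: "(x, y, f) \<in> iso_morphisms L0 X M" using w w' by simp
    have "w \<in> H (map_option fst (s x c)) (map_option fst (s y c'))" using w iso unfolding w' H_def by simp
    then show "w \<in> (\<Union>p\<in>?K. \<Union>p'\<in>?K. H p p')"
      by (rule UN_I[OF s_sort_in[OF iso_morphismsD(1)[OF iso]] UN_I[OF s_sort_in[OF iso_morphismsD(2)[OF iso]]]])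
  qed (auto simp: H_def)
  also have "\<dots> \<in> sets MX"
    by (intro sets.countable_UN' sort_values_countable image_subsetI H)
  finally show "{w \<in> space MX. ?V w} \<in> sets MX" .
qed

lemma identity_morphism: "x \<in> topspace X \<Longrightarrow> (x, x, \<lambda>P \<in> sorts L0. \<lambda>a \<in> fiber (srt M P) x. a) \<in> iso_morphisms L0 X M"
  unfolding iso_morphisms_def using fiber_isomorphisms_id[OF is_lang, of M x] by blast

text \<open>
  Distances between sections over one point are distances along the identity morphism, so their
  measurability follows from that of the unit map.
\<close>
lemma measurable_identity_morphism:
  "(\<lambda>x. (x, x, \<lambda>P \<in> sorts L0. \<lambda>a \<in> fiber (srt M P) x. a)) \<in> measurable (borel_of X) MX" (is "?i \<in> _")
proof -
  have "continuous_map X (iso_morphism_topology L0 X M) ?i"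
    unfolding iso_morphism_topology_def
  proof (rule continuous_on_generated_topo)
    let ?S = "{{(x, y, f) \<in> iso_morphisms L0 X M. x \<in> U} | U. openin X U} \<union>
      {{(x, y, f) \<in> iso_morphisms L0 X M. y \<in> U} | U. openin X U} \<union>
      {{(x, y, f) \<in> iso_morphisms L0 X M.
          f P ` (S \<inter> fiber (srt M P) x) \<inter> (T \<inter> fiber (srt M P) y) \<noteq> {}} | P S T.
        P \<in> sorts L0 \<and> openin (tp (srt M P)) S \<and> openin (tp (srt M P)) T}"
    have "\<Union> ?S = iso_morphisms L0 X M"
      using topspace_iso_morphism_topology[of L0 X M]
      unfolding iso_morphism_topology_def topology_generated_by_topspace .
    then show "?i ` topspace X \<subseteq> \<Union> ?S" using identity_morphism by (simp only: image_subset_iff) simp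
    have 1: "openin X (?i -` {(x, y, f) \<in> iso_morphisms L0 X M. x \<in> U} \<inter> topspace X)" if U: "openin X U" for U
    proof -
      have "?i -` {(x, y, f) \<in> iso_morphisms L0 X M. x \<in> U} \<inter> topspace X = U" using identity_morphism openin_subset[OF U] by auto
      then show ?thesis using U by simp
    qed
    have 2: "openin X (?i -` {(x, y, f) \<in> iso_morphisms L0 X M. y \<in> U} \<inter> topspace X)" if U: "openin X U" for U
    proof -
      have "?i -` {(x, y, f) \<in> iso_morphisms L0 X M. y \<in> U} \<inter> topspace X = U" using identity_morphism openin_subset[OF U] by auto
      then show ?thesis using U by simp
    qed
    have 3: "openin X (?i -` {(x, y, f) \<in> iso_morphisms L0 X M.
          f P ` (S \<inter> fiber (srt M P) x) \<inter> (T \<inter> fiber (srt M P) y) \<noteq> {}} \<inter> topspace X)" (is "openin X (?i -` ?V \<inter> _)")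
      if P: "P \<in> sorts L0" and ST: "openin (tp (srt M P)) S" "openin (tp (srt M P)) T" for P S T
    proof -
      have "proj (srt M P) ` (S \<inter> T) \<subseteq> topspace X"
        using openin_subset[OF metric_etaleD(5)[OF sort_etale[OF P] openin_Int[OF ST]]] .
      moreover have "x \<in> ?i -` ?V \<longleftrightarrow> x \<in> proj (srt M P) ` (S \<inter> T)" if x: "x \<in> topspace X" for x
      proof -
        have "x \<in> ?i -` ?V \<longleftrightarrow> (\<lambda>a\<in>fiber (srt M P) x. a) ` (S \<inter> fiber (srt M P) x) \<inter> (T \<inter> fiber (srt M P) x) \<noteq> {}"
          using identity_morphism[OF x] P by simp
        also have "(\<lambda>a\<in>fiber (srt M P) x. a) ` (S \<inter> fiber (srt M P) x) = S \<inter> fiber (srt M P) x" by auto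
        also have "(S \<inter> fiber (srt M P) x \<inter> (T \<inter> fiber (srt M P) x) \<noteq> {}) \<longleftrightarrow> x \<in> proj (srt M P) ` (S \<inter> T)"
        proof
          assume "S \<inter> fiber (srt M P) x \<inter> (T \<inter> fiber (srt M P) x) \<noteq> {}"
          then obtain a where "a \<in> S \<inter> fiber (srt M P) x \<inter> (T \<inter> fiber (srt M P) x)" by blast
          then have "a \<in> S" "a \<in> T" "proj (srt M P) a = x" by (auto simp: fiberD)
          then show "x \<in> proj (srt M P) ` (S \<inter> T)" by blast
        next
          assume "x \<in> proj (srt M P) ` (S \<inter> T)"
          then obtain a where a: "a \<in> S" "a \<in> T" "proj (srt M P) a = x" by blast
          then have "a \<in> fiber (srt M P) x" using openin_subset[OF ST(1)] by (auto simp: fiberD)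
          then show "S \<inter> fiber (srt M P) x \<inter> (T \<inter> fiber (srt M P) x) \<noteq> {}" using a by blast
        qed
        finally show ?thesis .
      qed
      ultimately have "?i -` ?V \<inter> topspace X = proj (srt M P) ` (S \<inter> T)" by (rule restricted_eqI)
      then show ?thesis using metric_etaleD(5)[OF sort_etale[OF P] openin_Int[OF ST]] by simp
    qed
    fix V assume "V \<in> ?S"
    then show "openin X (?i -` V \<inter> topspace X)"
    proof (elim UnE)
      assume "V \<in> {{(x, y, f) \<in> iso_morphisms L0 X M. x \<in> U} | U. openin X U}"
      then obtain U where U: "V = {(x, y, f) \<in> iso_morphisms L0 X M. x \<in> U}" "openin X U" unfolding mem_Collect_eq by (elim exE conjE)
      show ?thesis unfolding U(1) by (rule 1[OF U(2)])
    next
      assume "V \<in> {{(x, y, f) \<in> iso_morphisms L0 X M. y \<in> U} | U. openin X U}"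
      then obtain U where U: "V = {(x, y, f) \<in> iso_morphisms L0 X M. y \<in> U}" "openin X U" unfolding mem_Collect_eq by (elim exE conjE)
      show ?thesis unfolding U(1) by (rule 2[OF U(2)])
    next
      assume "V \<in> {{(x, y, f) \<in> iso_morphisms L0 X M.
          f P ` (S \<inter> fiber (srt M P) x) \<inter> (T \<inter> fiber (srt M P) y) \<noteq> {}} | P S T.
        P \<in> sorts L0 \<and> openin (tp (srt M P)) S \<and> openin (tp (srt M P)) T}"
      then obtain P S T where U: "V = {(x, y, f) \<in> iso_morphisms L0 X M.
          f P ` (S \<inter> fiber (srt M P) x) \<inter> (T \<inter> fiber (srt M P) y) \<noteq> {}}"
         "P \<in> sorts L0" "openin (tp (srt M P)) S" "openin (tp (srt M P)) T" unfolding mem_Collect_eq by (elim exE conjE)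
      show ?thesis unfolding U(1) by (rule 3[OF U(2-4)])
    qed
  qed
  then have c: "openin X {x \<in> topspace X. ?i x \<in> V}" if "openin (iso_morphism_topology L0 X M) V" for V
    using openin_continuous_map_preimage that by blast
  show ?thesis
  proof (rule measurable_borel_ofI)
    show "?i \<in> space (borel_of X) \<rightarrow> topspace (iso_morphism_topology L0 X M)" using identity_morphism by simp
    fix V assume V: "openin (iso_morphism_topology L0 X M) V"
    have "?i -` V \<inter> space (borel_of X) = {x \<in> topspace X. ?i x \<in> V}" by auto
    then show "?i -` V \<inter> space (borel_of X) \<in> sets (borel_of X)" using sets_borel_of_open[OF c[OF V]] by simp
  qed
qed

lemma measurable_section_distance: "(\<lambda>x. dP (s x c) (s x c')) \<in> borel_measurable (borel_of X)"
proof -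
  have "(\<lambda>x. (case (x, x, \<lambda>P \<in> sorts L0. \<lambda>a \<in> fiber (srt M P) x. a) of (x, y, f) \<Rightarrow> dP (lift_iso f (s x c)) (s y c')))
     \<in> borel_measurable (borel_of X)"
    by (rule measurable_compose[OF measurable_identity_morphism measurable_iso_distance])
  moreover have "lift_iso (\<lambda>P \<in> sorts L0. \<lambda>a \<in> fiber (srt M P) x. a) (s x c) = s x c" if "x \<in> topspace X" for x
    using s_points[OF that, of c] by (auto simp: points_def)
  ultimately show ?thesis by (subst measurable_cong) auto
qed

end

text \<open>
  The sections of all sorts are collected in one sequence. Outside its domain a section takes the value \<open>None\<close>.
\<close>
lemma (in etale) etale_sections_exist: "\<exists>s \<kappa> B. etale_sections L0 X M s \<kappa> B"
proof -
  have "\<forall>P\<in>sorts L0. \<exists>B \<kappa> s. section_system X (srt M P) B \<kappa> s"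
    using shrinking_sections[OF sort_etale sort_second_countable] by blast
  then obtain B \<kappa>0 s0 where sys: "\<And>P. P \<in> sorts L0 \<Longrightarrow> section_system X (srt M P) (B P) (\<kappa>0 P) (s0 P)"
    by metis
  note B = section_systemD(1)[OF sys] and \<kappa>0 = section_systemD(2)[OF sys] and s0 = section_systemD(3-6)[OF sys]
  \<comment> \<open>A natural number codes a sort and the index of one of its basic sets; 0 gives the constant section \<open>None\<close>.\<close>
  define code :: "nat \<Rightarrow> ('s \<times> nat) option" where
    "code = (\<lambda>c. case c of 0 \<Rightarrow> None | Suc c' \<Rightarrow>
       if sorts L0 = {} then None else Some (from_nat_into (sorts L0) (fst (prod_decode c')), snd (prod_decode c')))"
  have code_sort: "P \<in> sorts L0" if "code c = Some (P, k)" for c P k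
    using that from_nat_into[of "sorts L0"] by (auto simp: code_def split: nat.splits if_splits)
  have code_surj: "\<exists>c. code c = Some (P, k)" if P: "P \<in> sorts L0" for P k
  proof -
    obtain i where "from_nat_into (sorts L0) i = P" using from_nat_into_surj[OF countable_sorts P] by blast
    then show ?thesis using P by (intro exI[of _ "Suc (prod_encode (i, k))"]) (auto simp: code_def)
  qed
  define s where "s = (\<lambda>x c. case code c of None \<Rightarrow> None | Some (P, k) \<Rightarrow>
     if x \<in> proj (srt M P) ` B P k then Some (P, s0 P k x) else None)"
  define \<kappa> where "\<kappa> = (\<lambda>x c n. case code c of None \<Rightarrow> 0 | Some (P, k) \<Rightarrow> \<kappa>0 P k x n)"
  have s_Some: "\<exists>k. code c = Some (P, k) \<and> x \<in> proj (srt M P) ` B P k \<and> a = s0 P k x" if "s x c = Some (P, a)" for x c P a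
    using that by (auto simp: s_def split: option.splits if_splits)
  have 1: "s x c \<in> points L0 M x" for x c
  proof (cases "s x c")
    case (Some p)
    obtain P a where p: "p = (P, a)" by force
    then show ?thesis using Some s_Some[of x c P a] s0(1) code_sort by (auto simp: points_Some)
  qed (simp add: points_None)
  have 2: "{x \<in> topspace X. map_option fst (s x c) = p} \<in> sets (borel_of X)" for c p
  proof (cases "code c")
    case None
    then have "{x \<in> topspace X. map_option fst (s x c) = p} = (if p = None then space (borel_of X) else {})" by (auto simp: s_def)
    then show ?thesis using sets.top[of "borel_of X"] by simp
  next
    case (Some Pk)
    obtain P k where Pk: "Pk = (P, k)" by force
    have P: "P \<in> sorts L0" using code_sort Some Pk by blast
    have o: "proj (srt M P) ` B P k \<in> sets (borel_of X)"
      using metric_etaleD(5)[OF sort_etale[OF P] B[OF P]] by (rule sets_borel_of_open)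
    have "{x \<in> topspace X. map_option fst (s x c) = p} = 
      (if p = Some P then proj (srt M P) ` B P k \<inter> space (borel_of X) else if p = None then space (borel_of X) - proj (srt M P) ` B P k else {})"
      using Some Pk by (auto simp: s_def)
    then show ?thesis using o by (simp only: sets.Int sets.top sets.Diff sets.empty_sets split: if_split) simp
  qed
  have 3: "(\<lambda>x. \<kappa> x c n) \<in> measurable (borel_of X) (count_space UNIV)" for c n
    using \<kappa>0 code_sort by (cases "code c") (auto simp: \<kappa>_def)
  have 4: "(\<exists>b\<in>B P (\<kappa> x c n). b \<in> fiber (srt M P) x) \<and>
      (\<forall>b\<in>B P (\<kappa> x c n). b \<in> fiber (srt M P) x \<longrightarrow> mdist (met (srt M P)) b a \<le> 3 * (1/2) ^ n)"
    if sx: "s x c = Some (P, a)" for x c P a n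
  proof -
    obtain k where k: "code c = Some (P, k)" "x \<in> proj (srt M P) ` B P k" "a = s0 P k x" using s_Some[OF sx] by blast
    have "\<kappa> x c n = \<kappa>0 P k x n" using k(1) by (simp add: \<kappa>_def)
    then show ?thesis using s0(2,3)[OF code_sort[OF k(1)] k(2)] k(3) by simp
  qed
  have 5: "\<exists>c. dP p (s x c) < e" if p: "p \<in> points L0 M x" and e: "0 < e" for x p e
  proof (cases p)
    case None
    then show ?thesis using e pdist_refl by (intro exI[of _ 0]) (simp add: s_def code_def)
  next
    case (Some Pa)
    obtain P a where Pa: "Pa = (P, a)" by force
    have a: "P \<in> sorts L0" "a \<in> fiber (srt M P) x" using p Some Pa by (auto simp: points_Some)
    obtain k where k: "x \<in> proj (srt M P) ` B P k" "mdist (met (srt M P)) a (s0 P k x) < e" using s0(4)[OF a e] by blast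
    obtain c where c: "code c = Some (P, k)" using code_surj[OF a(1)] by blast
    have "s x c = Some (P, s0 P k x)" using c k(1) by (simp add: s_def)
    then show ?thesis using pdist_same[OF a(1), of a "s0 P k x"] a(2) s0(1)[OF a(1) k(1)] k(2) Some Pa
      by (intro exI[of _ c]) (simp add: fiberD)
  qed
  have "etale_sections L0 X M s \<kappa> B"
    by unfold_locales (use B 1 2 3 4 5 in blast)+
  then show ?thesis by blast
qed

section \<open>Borel dependence of relations\<close>

text \<open>
  Upper semicontinuity makes \<open>\<rho> < r\<close> an open condition on the fiber product. Projecting an open box is
  open because each factor projects openly and its coordinates can be chosen independently over
  each base point.
\<close>
lemma openin_relation_set:
  assumes A: "\<And>i. i < length As \<Longrightarrow> metric_etale_space X (As ! i)"
    and usc: "upper_semicontinuous_map (fprod_topology X As) \<rho>" 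
    and V: "\<And>i. i < length As \<Longrightarrow> openin (tp (As ! i)) (V i)"
  shows "openin X {x. \<exists>a. (x, a) \<in> fprod X As \<and> (\<forall>i<length As. a i \<in> V i) \<and> \<rho> (x, a) < r}" (is "openin X ?S")
proof (subst openin_subopen, intro ballI)
  let ?n = "length As"
  fix x assume "x \<in> ?S"
  then obtain a where a: "(x, a) \<in> fprod X As" "\<And>i. i < ?n \<Longrightarrow> a i \<in> V i" "\<rho> (x, a) < r" by blast
  have af: "x \<in> topspace X" "a \<in> (\<Pi>\<^sub>E i\<in>{..<?n}. fiber (As ! i) x)" using a(1) by (auto simp: fprod_def)
  have "openin (fprod_topology X As) {u \<in> topspace (fprod_topology X As). \<rho> u < r}"
    using usc unfolding upper_semicontinuous_map_def by blast
  then obtain T where T: "openin (prod_topology X (product_topology (\<lambda>i. tp (As ! i)) {..<?n})) T"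
    "{u \<in> topspace (fprod_topology X As). \<rho> u < r} = T \<inter> fprod X As"
    unfolding fprod_topology_def openin_subtopology by blast
  have "(x, a) \<in> {u \<in> topspace (fprod_topology X As). \<rho> u < r}" using a by simp
  then have "(x, a) \<in> T" unfolding T(2) by simp
  from T(1)[unfolded openin_prod_topology_alt, rule_format, OF this]
  obtain O1 O2 where O: "openin X O1" "openin (product_topology (\<lambda>i. tp (As ! i)) {..<?n}) O2" "x \<in> O1" "a \<in> O2" "O1 \<times> O2 \<subseteq> T"
    by blast
  from O(2)[unfolded openin_product_topology_alt, rule_format, OF O(4)]
  obtain W where W: "\<forall>i\<in>{..<?n}. openin (tp (As ! i)) (W i)" "a \<in> Pi\<^sub>E {..<?n} W" "Pi\<^sub>E {..<?n} W \<subseteq> O2" by blast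
  define S where "S = (\<Inter>i\<in>{..<?n}. proj (As ! i) ` (W i \<inter> V i)) \<inter> O1"
  have S: "openin X S"
  proof (cases "?n = 0")
    case True
    then show ?thesis using O(1) by (simp add: S_def)
  next
    case False
    have "openin X (proj (As ! i) ` (W i \<inter> V i))" if "i < ?n" for i
      using metric_etaleD(5)[OF A[OF that]] W(1) V[OF that] that by blast
    then have "openin X (\<Inter>i\<in>{..<?n}. proj (As ! i) ` (W i \<inter> V i))" using False by (intro openin_Inter) (auto intro: image_eqI)
    then show ?thesis unfolding S_def using O(1) by blast
  qed
  moreover have "x \<in> S"
  proof -
    have "x \<in> proj (As ! i) ` (W i \<inter> V i)" if "i < ?n" for i
    proof -
      have "a i \<in> W i \<inter> V i" "proj (As ! i) (a i) = x" using a(2)[OF that] W(2) af(2) that by (auto simp: PiE_iff fiber_def)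
      then show ?thesis by blast
    qed
    then show ?thesis using O(3) by (simp add: S_def)
  qed
  moreover have "S \<subseteq> ?S"
  proof
    fix y assume y: "y \<in> S"
    then have "\<forall>i\<in>{..<?n}. \<exists>b. b \<in> W i \<and> b \<in> V i \<and> proj (As ! i) b = y" unfolding S_def by blast
    from bchoice[OF this] obtain b0 where b0: "\<And>i. i < ?n \<Longrightarrow> b0 i \<in> W i" "\<And>i. i < ?n \<Longrightarrow> b0 i \<in> V i" "\<And>i. i < ?n \<Longrightarrow> proj (As ! i) (b0 i) = y"
      by auto
    define b where "b = (\<lambda>i\<in>{..<?n}. b0 i)"
    have yO: "y \<in> O1" using y by (simp add: S_def)
    have "b \<in> Pi\<^sub>E {..<?n} W" using b0(1) by (auto simp: b_def)
    then have bO: "b \<in> O2" using W(3) by blast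
    have bV: "b i \<in> V i" if "i < ?n" for i using b0(2)[OF that] that by (simp add: b_def)
    have "b0 i \<in> fiber (As ! i) y" if "i < ?n" for i
      using b0(2,3)[OF that] openin_subset[OF V[OF that]] by (auto simp: fiber_def)
    then have "b \<in> (\<Pi>\<^sub>E i\<in>{..<?n}. fiber (As ! i) y)" by (auto simp: b_def)
    then have "(y, b) \<in> fprod X As" using openin_subset[OF O(1)] yO by (auto simp: fprod_def)
    moreover have "(y, b) \<in> T" using O(5) yO bO by blast
    ultimately have "(y, b) \<in> {u \<in> topspace (fprod_topology X As). \<rho> u < r}" unfolding T(2) by blast
    then show "y \<in> ?S" using \<open>(y, b) \<in> fprod X As\<close> bV by auto
  qed
  ultimately show "\<exists>T. openin X T \<and> x \<in> T \<and> T \<subseteq> ?S" by blast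
qed

context etale
begin

lemma relD:
  assumes R: "R \<in> rels L0"
  shows "u \<in> fprod X (arity_spaces L0 M R) \<Longrightarrow> 0 \<le> rel M R u \<and> rel M R u \<le> 1"
    "upper_semicontinuous_map (fprod_topology X (arity_spaces L0 M R)) (rel M R)"
    "(x, a) \<in> fprod X (arity_spaces L0 M R) \<Longrightarrow> (x, b) \<in> fprod X (arity_spaces L0 M R) \<Longrightarrow>
      \<bar>rel M R (x, a) - rel M R (x, b)\<bar> \<le> (\<Sum>i<length (arity L0 R). mdist (met (srt M (arity L0 R ! i))) (a i) (b i))"
proof -
  have *: "rel M R \<in> fprod X (arity_spaces L0 M R) \<rightarrow> {0..1}"
    "upper_semicontinuous_map (fprod_topology X (arity_spaces L0 M R)) (rel M R)"
    "\<forall>u \<in> fprod X (arity_spaces L0 M R). \<forall>v \<in> fprod X (arity_spaces L0 M R). \<bar>rel M R u - rel M R v\<bar> \<le> fprod_dist (arity_spaces L0 M R) u v"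
    using etale R unfolding metric_etale_structure_def Let_def by blast+
  show "u \<in> fprod X (arity_spaces L0 M R) \<Longrightarrow> 0 \<le> rel M R u \<and> rel M R u \<le> 1" using *(1) by fastforce
  show "upper_semicontinuous_map (fprod_topology X (arity_spaces L0 M R)) (rel M R)" by fact
  assume "(x, a) \<in> fprod X (arity_spaces L0 M R)" "(x, b) \<in> fprod X (arity_spaces L0 M R)"
  then have "\<bar>rel M R (x, a) - rel M R (x, b)\<bar> \<le> fprod_dist (arity_spaces L0 M R) (x, a) (x, b)" using *(3) by blast
  also have "\<dots> \<le> (\<Sum>i<length (arity L0 R). mdist (met (srt M (arity L0 R ! i))) (a i) (b i))"
    by (simp add: fprod_dist_def arity_spaces_def)
  finally show "\<bar>rel M R (x, a) - rel M R (x, b)\<bar> \<le> (\<Sum>i<length (arity L0 R). mdist (met (srt M (arity L0 R ! i))) (a i) (b i))" .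
qed

lemma fprod_arity: "(x, a) \<in> fprod X (arity_spaces L0 M R) \<longleftrightarrow>
    x \<in> topspace X \<and> a \<in> (\<Pi>\<^sub>E i\<in>{..<length (arity L0 R)}. fiber (srt M (arity L0 R ! i)) x)"
proof -
  have "(\<Pi>\<^sub>E i\<in>{..<length (arity L0 R)}. fiber (arity_spaces L0 M R ! i) x) = (\<Pi>\<^sub>E i\<in>{..<length (arity L0 R)}. fiber (srt M (arity L0 R ! i)) x)"
    by (rule PiE_cong) (simp add: arity_spaces_def)
  then show ?thesis by (simp add: fprod_def arity_spaces_def)
qed

definition tuple_of :: "('s \<times> 'a) option list \<Rightarrow> nat \<Rightarrow> 'a" where
  "tuple_of bs = (\<lambda>i\<in>{..<length bs}. snd (the (bs ! i)))"

lemma list_pointsE: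
  assumes "set bs \<subseteq> points L0 M x" "map (map_option fst) bs = map Some Ps" "i < length Ps"
  obtains a where "bs ! i = Some (Ps ! i, a)" "a \<in> fiber (srt M (Ps ! i)) x" "Ps ! i \<in> sorts L0" "i < length bs"
proof -
  have len: "length bs = length Ps" using assms(2) by (metis length_map)
  have "map_option fst (bs ! i) = Some (Ps ! i)" using assms(2,3) len by (metis nth_map)
  then obtain a where a: "bs ! i = Some (Ps ! i, a)" by auto
  have "bs ! i \<in> points L0 M x" using assms(1,3) len by (metis nth_mem subsetD)
  then show thesis using that a assms(3) len by (simp add: points_Some)
qed

lemma tuple_of_fprod:
  assumes "x \<in> topspace X" "set bs \<subseteq> points L0 M x" "map (map_option fst) bs = map Some (arity L0 R)"
  shows "(x, tuple_of bs) \<in> fprod X (arity_spaces L0 M R)"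
proof -
  have len: "length bs = length (arity L0 R)" using assms(3) by (metis length_map)
  have "snd (the (bs ! i)) \<in> fiber (srt M (arity L0 R ! i)) x" if "i < length (arity L0 R)" for i
    using list_pointsE[OF assms(2,3) that] by (metis option.sel snd_conv)
  then show ?thesis using assms(1) by (auto simp: fprod_arity tuple_of_def len)
qed

lemma rel_tuple_lipschitz:
  assumes "R \<in> rels L0" "x \<in> topspace X" "set bs \<subseteq> points L0 M x" "map (map_option fst) bs = map Some (arity L0 R)"
    "set cs \<subseteq> points L0 M x" "map (map_option fst) cs = map Some (arity L0 R)"
  shows "\<bar>rel M R (x, tuple_of bs) - rel M R (x, tuple_of cs)\<bar> \<le> (\<Sum>i<length bs. dP (bs ! i) (cs ! i))"
proof -
  have len: "length bs = length (arity L0 R)" "length cs = length (arity L0 R)" using assms(4,6) by (metis length_map)+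
  have "mdist (met (srt M (arity L0 R ! i))) (tuple_of bs i) (tuple_of cs i) = dP (bs ! i) (cs ! i)" if i: "i < length (arity L0 R)" for i
  proof -
    obtain a where a: "bs ! i = Some (arity L0 R ! i, a)" "a \<in> fiber (srt M (arity L0 R ! i)) x" "arity L0 R ! i \<in> sorts L0"
      using list_pointsE[OF assms(3,4) i] by metis
    obtain b where b: "cs ! i = Some (arity L0 R ! i, b)" "b \<in> fiber (srt M (arity L0 R ! i)) x"
      using list_pointsE[OF assms(5,6) i] by metis
    show ?thesis using a b i len pdist_same[of "arity L0 R ! i" a b] by (simp add: tuple_of_def fiberD)
  qed
  then have "(\<Sum>i<length (arity L0 R). mdist (met (srt M (arity L0 R ! i))) (tuple_of bs i) (tuple_of cs i)) = (\<Sum>i<length bs. dP (bs ! i) (cs ! i))"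
    using len by (intro sum.cong) auto
  then show ?thesis using relD(3)[OF assms(1) tuple_of_fprod[OF assms(2-4)] tuple_of_fprod[OF assms(2,5,6)]] by simp
qed

end

context etale_sections
begin

lemma profile_set: "{x \<in> topspace X. map (map_option fst) (map (s x) cs) = ps} \<in> sets (borel_of X)"
proof (cases "length cs = length ps")
  case True
  have "{x \<in> topspace X. map (map_option fst) (map (s x) cs) = ps} =
     {x \<in> space (borel_of X). \<forall>i\<in>{..<length ps}. x \<in> {x \<in> topspace X. map_option fst (s x (cs ! i)) = ps ! i}}"
    using True by (auto simp: list_eq_iff_nth_eq)
  also have "\<dots> \<in> sets (borel_of X)"
  proof (rule sets.sets_Collect_finite_All)
    show "{x \<in> space (borel_of X). x \<in> {x \<in> topspace X. map_option fst (s x (cs ! i)) = ps ! i}} \<in> sets (borel_of X)" for i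
      using s_sort[of "cs ! i" "ps ! i"] by simp
  qed simp
  finally show ?thesis .
next
  case False
  then have "{x \<in> topspace X. map (map_option fst) (map (s x) cs) = ps} = {}" by (auto dest: arg_cong[where f = length])
  then show ?thesis by (simp only: sets.empty_sets)
qed

text \<open>
  The analogue of \<open>same_sort_distance_set\<close>: replacing the sections by points of their approximating basic sets
  changes the relation by at most \<open>3 * (1/2) ^ n\<close> per argument.
\<close>
lemma relation_set:
  assumes R: "R \<in> rels L0"
  shows "{x \<in> topspace X. map (map_option fst) (map (s x) cs) = map Some (arity L0 R) \<and> rel M R (x, tuple_of (map (s x) cs)) < r} \<in> sets (borel_of X)"
    (is "?L \<in> _")
proof (cases "length cs = length (arity L0 R)")
  case False
  then have "?L = {}" by (auto dest: arg_cong[where f = length])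
  then show ?thesis by (simp only: sets.empty_sets)
next
  case len: True
  let ?n = "length (arity L0 R)" and ?As = "arity_spaces L0 M R"
  have n: "length ?As = ?n" "\<And>i. i < ?n \<Longrightarrow> ?As ! i = srt M (arity L0 R ! i)" by (auto simp: arity_spaces_def)
  define Op where "Op = (\<lambda>n js. {x. \<exists>a. (x, a) \<in> fprod X ?As \<and> (\<forall>i<length ?As. a i \<in> B (arity L0 R ! i) (js ! i)) \<and> rel M R (x, a) < r - ?n * (3 * (1/2) ^ n)})"
  have Op: "Op n js \<in> sets (borel_of X)" for n js
    unfolding Op_def
    by (intro sets_borel_of_open openin_relation_set relD(2) R) (use n arity_sorts[OF R] sort_etale B in auto)
  define G where "G = (\<lambda>n js. {x \<in> topspace X. map (map_option fst) (map (s x) cs) = map Some (arity L0 R)} \<inter>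
     {x \<in> space (borel_of X). \<forall>i\<in>{..<?n}. x \<in> {x \<in> topspace X. \<kappa> x (cs ! i) n = js ! i}})"
  have G: "G n js \<in> sets (borel_of X)" for n js
    unfolding G_def
  proof (intro sets.Int profile_set sets.sets_Collect_finite_All)
    show "{x \<in> space (borel_of X). x \<in> {x \<in> topspace X. \<kappa> x (cs ! i) n = js ! i}} \<in> sets (borel_of X)" for i
      using \<kappa>_level[of "cs ! i" n "js ! i"] by simp
  qed simp
  have pts: "set (map (s x) cs) \<subseteq> points L0 M x" if "x \<in> topspace X" for x using s_points[OF that] by auto
  have close: "\<bar>rel M R (x, tuple_of (map (s x) cs)) - rel M R (x, a)\<bar> \<le> ?n * (3 * (1/2) ^ n)"
    if x: "x \<in> topspace X" "map (map_option fst) (map (s x) cs) = map Some (arity L0 R)" and a: "(x, a) \<in> fprod X ?As"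
      and aB: "\<And>i. i < ?n \<Longrightarrow> a i \<in> B (arity L0 R ! i) (\<kappa> x (cs ! i) n)" for x a n
  proof -
    have "\<bar>rel M R (x, tuple_of (map (s x) cs)) - rel M R (x, a)\<bar> \<le> (\<Sum>i<?n. mdist (met (srt M (arity L0 R ! i))) (tuple_of (map (s x) cs) i) (a i))"
      by (rule relD(3)[OF R tuple_of_fprod[OF x(1) pts[OF x(1)] x(2)] a])
    also have "\<dots> \<le> (\<Sum>i<?n. 3 * (1/2) ^ n)"
    proof (rule sum_mono)
      fix i assume "i \<in> {..<?n}"
      then have i: "i < ?n" by simp
      obtain b where b: "map (s x) cs ! i = Some (arity L0 R ! i, b)" using list_pointsE[OF pts[OF x(1)] x(2) i] by metis
      have sx: "s x (cs ! i) = Some (arity L0 R ! i, b)" using b i len by simp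
      have "mdist (met (srt M (arity L0 R ! i))) (a i) b \<le> 3 * (1/2) ^ n"
        using cell_close[OF x(1) sx aB[OF i]] a i by (auto simp: fprod_arity PiE_iff)
      then show "mdist (met (srt M (arity L0 R ! i))) (tuple_of (map (s x) cs) i) (a i) \<le> 3 * (1/2) ^ n"
        using sx i len by (simp add: tuple_of_def mdist_commute)
    qed
    finally show ?thesis by simp
  qed
  have "?L = (\<Union>n. \<Union>js. G n js \<inter> Op n js)"
  proof (intro equalityI subsetI)
    fix x assume "x \<in> ?L"
    then have x: "x \<in> topspace X" "map (map_option fst) (map (s x) cs) = map Some (arity L0 R)" "rel M R (x, tuple_of (map (s x) cs)) < r" by auto
    obtain n where n': "(2 * ?n * 3) * (1/2) ^ n < r - rel M R (x, tuple_of (map (s x) cs))"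
      using geometric_small[of "r - rel M R (x, tuple_of (map (s x) cs))" "2 * ?n * 3"] x(3) by auto
    have "\<exists>b. b \<in> B (arity L0 R ! i) (\<kappa> x (cs ! i) n) \<and> b \<in> fiber (srt M (arity L0 R ! i)) x" if i: "i < ?n" for i
    proof -
      obtain b where b: "map (s x) cs ! i = Some (arity L0 R ! i, b)" using list_pointsE[OF pts[OF x(1)] x(2) i] by metis
      have sx: "s x (cs ! i) = Some (arity L0 R ! i, b)" using b i len by simp
      show ?thesis using cell_ex[OF x(1) sx] by blast
    qed
    then obtain a0 where a0: "\<And>i. i < ?n \<Longrightarrow> a0 i \<in> B (arity L0 R ! i) (\<kappa> x (cs ! i) n)" "\<And>i. i < ?n \<Longrightarrow> a0 i \<in> fiber (srt M (arity L0 R ! i)) x"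
      by metis
    define a where "a = (\<lambda>i\<in>{..<?n}. a0 i)"
    have a: "(x, a) \<in> fprod X ?As" "\<And>i. i < ?n \<Longrightarrow> a i \<in> B (arity L0 R ! i) (\<kappa> x (cs ! i) n)"
      using a0 x(1) by (auto simp: fprod_arity a_def)
    have "rel M R (x, a) < r - ?n * (3 * (1/2) ^ n)" using close[OF x(1,2) a] n' by (simp add: algebra_simps abs_le_iff)
    then have "x \<in> Op n (map (\<lambda>c. \<kappa> x c n) cs)" using a len n(1) by (auto simp: Op_def)
    moreover have "x \<in> G n (map (\<lambda>c. \<kappa> x c n) cs)" using x len by (simp add: G_def)
    ultimately show "x \<in> (\<Union>n. \<Union>js. G n js \<inter> Op n js)" by blast
  next
    fix x assume "x \<in> (\<Union>n. \<Union>js. G n js \<inter> Op n js)"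
    then obtain n js where x: "x \<in> G n js" "x \<in> Op n js" by blast
    obtain a where a: "(x, a) \<in> fprod X ?As" "\<And>i. i < ?n \<Longrightarrow> a i \<in> B (arity L0 R ! i) (js ! i)" "rel M R (x, a) < r - ?n * (3 * (1/2) ^ n)"
      using x(2) n(1) by (auto simp: Op_def)
    have G': "x \<in> topspace X" "map (map_option fst) (map (s x) cs) = map Some (arity L0 R)" "\<And>i. i < ?n \<Longrightarrow> \<kappa> x (cs ! i) n = js ! i"
      using x(1) by (auto simp: G_def)
    have "rel M R (x, tuple_of (map (s x) cs)) < r" using close[OF G'(1,2) a(1), of n] a(2,3) G'(3) by (simp add: abs_le_iff)
    then show "x \<in> ?L" using G' by simp
  qed
  also have "\<dots> \<in> sets (borel_of X)" by (intro sets.countable_UN' countableI_type image_subsetI sets.Int Op G)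
  finally show ?thesis .
qed

end

section \<open>The Urysohn sphere over a fiber\<close>

lemma lift_iso_points:
  assumes f: "(x, y, f) \<in> iso_morphisms L0 X M" and p: "p \<in> points L0 M x"
  shows "lift_iso f p \<in> points L0 M y"
  using p iso_morphismsD(5)[OF f] by (auto simp: points_def)

lemma lift_iso_surj:
  assumes f: "(x, y, f) \<in> iso_morphisms L0 X M" and q: "q \<in> points L0 M y"
  shows "\<exists>p\<in>points L0 M x. lift_iso f p = q"
proof (cases q)
  case None
  then show ?thesis by (intro bexI[of _ None]) (auto simp: points_def)
next
  case (Some Pb)
  obtain P b where Pb: "Pb = (P, b)" by force
  have "P \<in> sorts L0" "b \<in> fiber (srt M P) y" using q Some Pb by (auto simp: points_def)
  then have "b \<in> f P ` fiber (srt M P) x" using bij_betw_imp_surj_on[OF iso_morphismsD(4)[OF f]] by blast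
  then obtain a where "a \<in> fiber (srt M P) x" "f P a = b" by blast
  then show ?thesis using \<open>P \<in> sorts L0\<close> Some Pb by (intro bexI[of _ "Some (P, a)"]) (auto simp: points_def)
qed

context etale
begin

lemma lift_iso_isometric:
  assumes f: "(x, y, f) \<in> iso_morphisms L0 X M" and p: "p \<in> points L0 M x" "q \<in> points L0 M x"
  shows "dP (lift_iso f p) (lift_iso f q) = dP p q"
proof (cases "map_option fst p = map_option fst q")
  case False
  then show ?thesis using pdist_other_sort by (metis sort_lift_iso)
next
  case True
  show ?thesis
  proof (cases p)
    case None
    then show ?thesis using True by (simp add: pdist_refl)
  next
    case (Some Pa)
    obtain P a where Pa: "p = Some (P, a)" using Some by (cases Pa) auto
    then obtain b where b: "q = Some (P, b)" using True by (cases q) auto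
    have *: "P \<in> sorts L0" "a \<in> fiber (srt M P) x" "b \<in> fiber (srt M P) x" using p Pa b by (auto simp: points_Some)
    have "f P a \<in> fiber (srt M P) y" "f P b \<in> fiber (srt M P) y" using iso_morphismsD(5)[OF f] * by blast+
    then show ?thesis using * iso_morphismsD(6)[OF f *] Pa b by (simp add: pdist_same fiberD)
  qed
qed

end

text \<open>
  \<open>\<Phi> x\<close> embeds the trees over the sections at \<open>x\<close>; a tree is given here by its shape, with the numbers of the sections as leaves.
\<close>
locale urysohn_model = etale_sections L0 X M s \<kappa> B
  for L0 :: "('s, 'r) language" and X :: "'x topology" and M :: "('s, 'r, 'x, 'a) etale_structure" and s \<kappa> B +
  fixes U :: "'u metric" and \<Phi> :: "'x \<Rightarrow> nat trm \<Rightarrow> 'u"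
  assumes U: "urysohn_sphere U"
    and \<Phi>_in: "\<And>x \<tau>. x \<in> topspace X \<Longrightarrow> \<Phi> x \<tau> \<in> mspace U"
    and \<Phi>_dist: "\<And>x \<tau> \<sigma>. x \<in> topspace X \<Longrightarrow> mdist U (\<Phi> x \<tau>) (\<Phi> x \<sigma>) = tdist dP (map_trm (s x) \<tau>) (map_trm (s x) \<sigma>)"
    and \<Phi>_dense: "\<And>x z e. x \<in> topspace X \<Longrightarrow> z \<in> mspace U \<Longrightarrow> 0 < e \<Longrightarrow> \<exists>\<tau>. mdist U (\<Phi> x \<tau>) z < e"
    and \<Phi>_meas: "\<And>\<tau> z. z \<in> mspace U \<Longrightarrow> (\<lambda>x. mdist U (\<Phi> x \<tau>) z) \<in> borel_measurable (borel_of X)"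
begin

abbreviation "dT \<equiv> tdist dP"
abbreviation "dU \<equiv> mdist U"

lemma U_complete: "mcomplete_of U"
  using U by (simp add: urysohn_sphere_def)

lemma dT: "dT t t = 0" "0 \<le> dT t t'" "dT t t' \<le> 1" "dT t t' = dT t' t" "dT t t'' \<le> dT t t' + dT t' t''"
  using pseudometric_on_tdist[OF pseudometric_pdist] unfolding pseudometric_on_def by blast+

lemma dT_diff: "\<bar>dT t t'' - dT t' t''\<bar> \<le> dT t t'"
  using dT(5)[of t t'' t'] dT(5)[of t' t'' t] dT(4)[of t t'] by linarith

definition Tm :: "'x \<Rightarrow> ('s \<times> 'a) option trm set" where
  "Tm x = {t. set_trm t \<subseteq> points L0 M x}"

lemma map_s_Tm: "x \<in> topspace X \<Longrightarrow> map_trm (s x) \<tau> \<in> Tm x"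
  using s_points by (auto simp: Tm_def trm.set_map)

lemma Pt_Tm: "Pt p \<in> Tm x \<longleftrightarrow> p \<in> points L0 M x"
  by (simp add: Tm_def)

text \<open>
  Moving the leaves of a tree to nearby sections moves the tree only a little, so the trees over the sections
  are dense in all trees over the fiber.
\<close>
lemma Tm_approx:
  assumes x: "x \<in> topspace X" and t: "t \<in> Tm x" and e: "0 < e"
  shows "\<exists>\<tau>. dT t (map_trm (s x) \<tau>) < e"
proof -
  define \<eta> where "\<eta> = e / (2 * 3 ^ lev t)"
  have \<eta>: "0 < \<eta>" using e by (simp add: \<eta>_def)
  have "\<forall>p\<in>points L0 M x. \<exists>c. dP p (s x c) < \<eta>" using s_dense[OF x _ \<eta>] by blast
  from bchoice[OF this] obtain c where c: "\<And>p. p \<in> points L0 M x \<Longrightarrow> dP p (s x (c p)) < \<eta>" by blast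
  have "dT (map_trm id t) (map_trm (s x \<circ> c) t) \<le> 3 ^ lev t * \<eta>"
  proof (rule tdist_perturb[OF pseudometric_pdist])
    fix p assume "p \<in> set_trm t"
    then show "dP (id p) ((s x \<circ> c) p) \<le> \<eta>" using c t by (force simp: Tm_def)
  qed (use \<eta> in simp)
  also have "\<dots> = e / 2" by (simp add: \<eta>_def)
  finally have "dT t (map_trm (s x) (map_trm c t)) < e" using e by (simp add: trm.map_id trm.map_comp)
  then show ?thesis by blast
qed

text \<open>
  The image of a tree \<open>t\<close> over the fiber is the point of the sphere with the right distances to the images of
  trees over sections.
\<close>
definition \<phi> :: "'x \<Rightarrow> ('s \<times> 'a) option trm \<Rightarrow> 'u" where
  "\<phi> x t = (SOME w. w \<in> mspace U \<and> (\<forall>\<tau>. dU w (\<Phi> x \<tau>) = dT t (map_trm (s x) \<tau>)))"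

lemma \<phi>:
  assumes x: "x \<in> topspace X" and t: "t \<in> Tm x"
  shows "\<phi> x t \<in> mspace U" "dU (\<phi> x t) (\<Phi> x \<tau>) = dT t (map_trm (s x) \<tau>)"
proof -
  have "\<exists>w\<in>mspace U. \<forall>\<tau>\<in>UNIV. dU w (\<Phi> x \<tau>) = dT t (map_trm (s x) \<tau>)"
  proof (rule point_from_distances[OF U_complete \<Phi>_in[OF x]])
    fix \<tau> \<sigma>
    show "\<bar>dT t (map_trm (s x) \<tau>) - dT t (map_trm (s x) \<sigma>)\<bar> \<le> dU (\<Phi> x \<tau>) (\<Phi> x \<sigma>) \<and>
       dU (\<Phi> x \<tau>) (\<Phi> x \<sigma>) \<le> dT t (map_trm (s x) \<tau>) + dT t (map_trm (s x) \<sigma>)"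
      unfolding \<Phi>_dist[OF x]
      using dT_diff[of "map_trm (s x) \<tau>" t "map_trm (s x) \<sigma>"] dT(5)[of "map_trm (s x) \<tau>" "map_trm (s x) \<sigma>" t]
        dT(4)[of t "map_trm (s x) \<tau>"] dT(4)[of t "map_trm (s x) \<sigma>"] by linarith
  qed (use Tm_approx[OF x t] in auto)
  then have "\<exists>w. w \<in> mspace U \<and> (\<forall>\<tau>. dU w (\<Phi> x \<tau>) = dT t (map_trm (s x) \<tau>))" by blast
  from someI_ex[OF this] show "\<phi> x t \<in> mspace U" "dU (\<phi> x t) (\<Phi> x \<tau>) = dT t (map_trm (s x) \<tau>)"
    by (simp_all add: \<phi>_def)
qed

lemma \<phi>_section: "x \<in> topspace X \<Longrightarrow> \<phi> x (map_trm (s x) \<tau>) = \<Phi> x \<tau>"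
proof -
  assume x: "x \<in> topspace X"
  have "dU (\<phi> x (map_trm (s x) \<tau>)) (\<Phi> x \<tau>) = 0" using \<phi>(2)[OF x map_s_Tm[OF x]] dT(1) by simp
  then show ?thesis using \<phi>(1)[OF x map_s_Tm[OF x]] \<Phi>_in[OF x] by simp
qed

lemma \<phi>_isometric:
  assumes x: "x \<in> topspace X" and t: "t \<in> Tm x" "t' \<in> Tm x"
  shows "dU (\<phi> x t) (\<phi> x t') = dT t t'"
proof -
  have approx: "\<bar>dU (\<phi> x t) (\<phi> x t') - dT t t'\<bar> \<le> 0 + e" if e: "0 < e" for e
  proof -
    obtain \<tau> where \<tau>: "dT t (map_trm (s x) \<tau>) < e / 2" using Tm_approx[OF x t(1), of "e / 2"] e by auto
    have "\<bar>dU (\<phi> x t) (\<phi> x t') - dU (\<Phi> x \<tau>) (\<phi> x t')\<bar> \<le> dU (\<phi> x t) (\<Phi> x \<tau>)"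
      by (intro mdist_diff_le \<phi> \<Phi>_in x t)
    moreover have "dU (\<Phi> x \<tau>) (\<phi> x t') = dT (map_trm (s x) \<tau>) t'" using \<phi>(2)[OF x t(2), of \<tau>] dT(4) mdist_commute by metis
    ultimately show ?thesis using \<phi>(2)[OF x t(1), of \<tau>] dT_diff[of t t' "map_trm (s x) \<tau>"] \<tau> by linarith
  qed
  have "\<bar>dU (\<phi> x t) (\<phi> x t') - dT t t'\<bar> \<le> 0" by (rule field_le_epsilon[OF approx])
  then show ?thesis by simp
qed

lemma \<phi>_dense:
  assumes x: "x \<in> topspace X" and "z \<in> mspace U" "0 < e"
  shows "\<exists>t\<in>Tm x. dU (\<phi> x t) z < e"
  using \<Phi>_dense[OF assms] \<phi>_section[OF x] map_s_Tm[OF x] by metis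

lemma lift_Tm: "(x, y, f) \<in> iso_morphisms L0 X M \<Longrightarrow> t \<in> Tm x \<Longrightarrow> map_trm (lift_iso f) t \<in> Tm y"
  by (auto simp: Tm_def trm.set_map intro!: lift_iso_points)

lemma lift_Tm_surj:
  assumes f: "(x, y, f) \<in> iso_morphisms L0 X M" and t: "t \<in> Tm y"
  shows "\<exists>t'\<in>Tm x. map_trm (lift_iso f) t' = t"
proof -
  have "\<forall>q\<in>points L0 M y. \<exists>p. p \<in> points L0 M x \<and> lift_iso f p = q" using lift_iso_surj[OF f] by blast
  from bchoice[OF this] obtain h where h: "\<And>q. q \<in> points L0 M y \<Longrightarrow> h q \<in> points L0 M x \<and> lift_iso f (h q) = q" by blast
  have "map_trm (lift_iso f \<circ> h) t = map_trm id t" using h t by (intro trm.map_cong) (auto simp: Tm_def)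
  then show ?thesis using h t by (intro bexI[of _ "map_trm h t"]) (auto simp: Tm_def trm.set_map trm.map_comp trm.map_id)
qed

lemma lift_dT: 
  assumes "(x, y, f) \<in> iso_morphisms L0 X M" "t \<in> Tm x" "t' \<in> Tm x"
  shows "dT (map_trm (lift_iso f) t) (map_trm (lift_iso f) t') = dT t t'"
  by (rule tdist_map_trm[of "points L0 M x"]) (use assms lift_iso_isometric in \<open>auto simp: Tm_def\<close>)

definition induced :: "'x \<times> 'x \<times> ('s \<Rightarrow> 'a \<Rightarrow> 'a) \<Rightarrow> 'u \<Rightarrow> 'u" where
  "induced = (\<lambda>(x, y, f). SOME g. g \<in> isometry_group U \<and> (\<forall>t\<in>Tm x. g (\<phi> x t) = \<phi> y (map_trm (lift_iso f) t)))"

lemma induced: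
  assumes f: "(x, y, f) \<in> iso_morphisms L0 X M"
  shows "induced (x, y, f) \<in> isometry_group U" 
    "t \<in> Tm x \<Longrightarrow> induced (x, y, f) (\<phi> x t) = \<phi> y (map_trm (lift_iso f) t)"
proof -
  note xy = iso_morphismsD(1,2)[OF f]
  have "\<exists>g\<in>isometry_group U. \<forall>t\<in>Tm x. g (\<phi> x t) = \<phi> y (map_trm (lift_iso f) t)"
  proof (rule dense_isometry_extends[OF U_complete])
    show "\<phi> x t \<in> mspace U" "\<phi> y (map_trm (lift_iso f) t) \<in> mspace U" if "t \<in> Tm x" for t
      using that \<phi>(1) xy lift_Tm[OF f] by blast+
    show "dU (\<phi> x t) (\<phi> x t') = dU (\<phi> y (map_trm (lift_iso f) t)) (\<phi> y (map_trm (lift_iso f) t'))"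
      if "t \<in> Tm x" "t' \<in> Tm x" for t t'
      using that \<phi>_isometric xy lift_Tm[OF f] lift_dT[OF f] by simp
    show "\<exists>t\<in>Tm x. dU (\<phi> x t) z < e" if "z \<in> mspace U" "0 < e" for z e
      using \<phi>_dense[OF xy(1) that] .
    show "\<exists>t\<in>Tm x. dU (\<phi> y (map_trm (lift_iso f) t)) z < e" if "z \<in> mspace U" "0 < e" for z e
      using \<phi>_dense[OF xy(2) that] lift_Tm_surj[OF f] by metis
  qed
  then have "\<exists>g. g \<in> isometry_group U \<and> (\<forall>t\<in>Tm x. g (\<phi> x t) = \<phi> y (map_trm (lift_iso f) t))" by blast
  from someI_ex[OF this] show "induced (x, y, f) \<in> isometry_group U" 
    "t \<in> Tm x \<Longrightarrow> induced (x, y, f) (\<phi> x t) = \<phi> y (map_trm (lift_iso f) t)" by (simp_all add: induced_def)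
qed

lemma induced_unique:
  assumes f: "(x, y, f) \<in> iso_morphisms L0 X M" and g: "g \<in> isometry_group U"
    and eq: "\<And>t. t \<in> Tm x \<Longrightarrow> g (\<phi> x t) = \<phi> y (map_trm (lift_iso f) t)"
  shows "induced (x, y, f) = g"
  by (rule isometry_unique_on_dense[OF induced(1)[OF f] g, of "Tm x" "\<phi> x"])
    (use \<phi>(1) \<phi>_dense iso_morphismsD(1)[OF f] induced(2)[OF f] eq in auto)

text \<open>
  Both trees have leaves in the fiber over \<open>y\<close>, namely transported and original sections. Indexing these by
  a sum type makes the tree distance a fixed expression in measurable leaf distances.
\<close>
lemma measurable_term_distance:
  "(\<lambda>(x, y, f). dT (map_trm (lift_iso f \<circ> s x) \<tau>) (map_trm (s y) \<sigma>)) \<in> borel_measurable MX"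
proof -
  define \<alpha> where "\<alpha> = (\<lambda>(x, y, f). case_sum (lift_iso f \<circ> s x) (s y))"
  have "(\<lambda>w. tdist (\<lambda>u v. dP (\<alpha> w u) (\<alpha> w v)) (map_trm Inl \<tau>) (map_trm Inr \<sigma>)) \<in> borel_measurable MX"
  proof (rule measurable_tdist)
    fix u v :: "nat + nat"
    have ll: "(\<lambda>w. dP (\<alpha> w (Inl i)) (\<alpha> w (Inl j))) \<in> borel_measurable MX" for i j
    proof -
      have m: "(\<lambda>w. dP (s ((\<lambda>(x, y, f). x) w) i) (s ((\<lambda>(x, y, f). x) w) j)) \<in> borel_measurable MX"
        by (rule measurable_compose[OF measurable_iso_source measurable_section_distance])
      have eq: "dP (\<alpha> w (Inl i)) (\<alpha> w (Inl j)) = dP (s ((\<lambda>(x, y, f). x) w) i) (s ((\<lambda>(x, y, f). x) w) j)"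
        if w: "w \<in> space MX" for w
      proof -
        obtain x y f where w': "w = (x, y, f)" by (cases w)
        have iso: "(x, y, f) \<in> iso_morphisms L0 X M" using w w' by simp
        show ?thesis
          using lift_iso_isometric[OF iso s_points s_points] iso_morphismsD(1)[OF iso] by (simp add: \<alpha>_def w')
      qed
      show ?thesis by (rule measurable_cong[THEN iffD2, OF eq m])
    qed
    have rr: "(\<lambda>w. dP (\<alpha> w (Inr i)) (\<alpha> w (Inr j))) \<in> borel_measurable MX" for i j
      using measurable_compose[OF measurable_iso_target measurable_section_distance[of i j], of L0 M]
      by (simp add: \<alpha>_def split_def)
    have lr: "(\<lambda>w. dP (\<alpha> w (Inl i)) (\<alpha> w (Inr j))) \<in> borel_measurable MX" for i j
      using measurable_iso_distance[of i j] by (simp add: \<alpha>_def split_def)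
    then have rl: "(\<lambda>w. dP (\<alpha> w (Inr i)) (\<alpha> w (Inl j))) \<in> borel_measurable MX" for i j
      by (subst pdist_sym)
    show "(\<lambda>w. dP (\<alpha> w u) (\<alpha> w v)) \<in> borel_measurable MX"
      using ll rr lr rl by (cases u; cases v) simp_all
  qed
  moreover have "tdist (\<lambda>u v. dP (\<alpha> w u) (\<alpha> w v)) (map_trm Inl \<tau>) (map_trm Inr \<sigma>) = dT (map_trm (\<alpha> w) (map_trm Inl \<tau>)) (map_trm (\<alpha> w) (map_trm Inr \<sigma>))" for w
    by (rule tdist_map_trm[of UNIV, symmetric]) auto
  ultimately show ?thesis by (simp add: trm.map_comp \<alpha>_def split_def comp_def)
qed

text \<open>
  The induced isometry maps \<open>\<Phi> x \<tau>\<close> to the tree of shape \<open>\<tau>\<close> over the transported sections. Hence the image of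
  \<open>z\<close> is within \<open>r\<close> of \<open>z'\<close> iff some path \<open>z, \<Phi> x \<tau>\<close>, its image, \<open>\<Phi> y \<sigma>, z'\<close> is shorter than \<open>r\<close>, and its
  three pieces are measurable.
\<close>
lemma measurable_induced:
  assumes z: "z \<in> mspace U" and z': "z' \<in> mspace U"
  shows "(\<lambda>w. dU (induced w z) z') \<in> borel_measurable MX"
proof (rule borel_measurableI_less)
  fix r :: real
  have m1: "(\<lambda>w. dU (\<Phi> ((\<lambda>(x, y, f). x) w) \<tau>) z) \<in> borel_measurable MX" for \<tau>
    by (rule measurable_compose[OF measurable_iso_source \<Phi>_meas[OF z]])
  have m2: "(\<lambda>w. dU (\<Phi> ((\<lambda>(x, y, f). y) w) \<sigma>) z') \<in> borel_measurable MX" for \<sigma>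
    by (rule measurable_compose[OF measurable_iso_target \<Phi>_meas[OF z']])
  define h where "h = (\<lambda>\<tau> \<sigma> (x, y, f). dU (\<Phi> x \<tau>) z + dT (map_trm (lift_iso f \<circ> s x) \<tau>) (map_trm (s y) \<sigma>) + dU (\<Phi> y \<sigma>) z')"
  have h: "h \<tau> \<sigma> \<in> borel_measurable MX" for \<tau> \<sigma>
    using borel_measurable_add[OF borel_measurable_add[OF m1[of \<tau>] measurable_term_distance[of \<tau> \<sigma>]] m2[of \<sigma>]]
    by (simp add: h_def split_def)
  have "{w \<in> space MX. dU (induced w z) z' < r} = (\<Union>\<tau>. \<Union>\<sigma>. {w \<in> space MX. h \<tau> \<sigma> w < r})"
  proof (intro equalityI subsetI)
    fix w assume w: "w \<in> {w \<in> space MX. dU (induced w z) z' < r}"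
    obtain x y f where w': "w = (x, y, f)" by (cases w)
    have iso: "(x, y, f) \<in> iso_morphisms L0 X M" using w w' by simp
    note xy = iso_morphismsD(1,2)[OF iso] and g = isometry_groupD[OF induced(1)[OF iso]]
    let ?g = "induced (x, y, f)"
    have lt: "dU (?g z) z' < r" using w w' by simp
    define e where "e = (r - dU (?g z) z') / 4"
    have e: "0 < e" using lt by (simp add: e_def)
    obtain \<tau> where \<tau>: "dU (\<Phi> x \<tau>) z < e" using \<Phi>_dense[OF xy(1) z e] by blast
    have \<tau>in: "\<Phi> x \<tau> \<in> mspace U" using \<Phi>_in[OF xy(1)] .
    obtain \<sigma> where \<sigma>: "dU (\<Phi> y \<sigma>) (?g (\<Phi> x \<tau>)) < e" using \<Phi>_dense[OF xy(2) g(1)[OF \<tau>in] e] by blast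
    have g\<Phi>: "?g (\<Phi> x \<tau>) = \<phi> y (map_trm (lift_iso f \<circ> s x) \<tau>)"
      using induced(2)[OF iso map_s_Tm[OF xy(1), of \<tau>]] by (simp add: \<phi>_section xy trm.map_comp)
    have T: "map_trm (lift_iso f \<circ> s x) \<tau> \<in> Tm y"
      using lift_Tm[OF iso map_s_Tm[OF xy(1), of \<tau>]] by (simp add: trm.map_comp)
    have d: "dT (map_trm (lift_iso f \<circ> s x) \<tau>) (map_trm (s y) \<sigma>) < e"
      using \<phi>(2)[OF xy(2) T, of \<sigma>] \<sigma> g\<Phi> by (simp add: mdist_commute)
    have "dU (\<Phi> y \<sigma>) z' \<le> dU (\<Phi> y \<sigma>) (?g (\<Phi> x \<tau>)) + dU (?g (\<Phi> x \<tau>)) z'"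
      "dU (?g (\<Phi> x \<tau>)) z' \<le> dU (?g (\<Phi> x \<tau>)) (?g z) + dU (?g z) z'"
      using \<Phi>_in xy g(1) z z' \<tau>in by (intro mdist_triangle; simp)+
    moreover have "dU (?g (\<Phi> x \<tau>)) (?g z) = dU (\<Phi> x \<tau>) z" using g(2)[OF \<tau>in z] .
    moreover have "4 * e = r - dU (?g z) z'" by (simp add: e_def)
    ultimately have "h \<tau> \<sigma> w < r" using \<tau> \<sigma> d unfolding h_def w' prod.case by linarith
    then show "w \<in> (\<Union>\<tau>. \<Union>\<sigma>. {w \<in> space MX. h \<tau> \<sigma> w < r})" using w by blast
  next
    fix w assume "w \<in> (\<Union>\<tau>. \<Union>\<sigma>. {w \<in> space MX. h \<tau> \<sigma> w < r})"
    then obtain \<tau> \<sigma> where w: "w \<in> space MX" "h \<tau> \<sigma> w < r" by blast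
    obtain x y f where w': "w = (x, y, f)" by (cases w)
    have iso: "(x, y, f) \<in> iso_morphisms L0 X M" using w w' by simp
    note xy = iso_morphismsD(1,2)[OF iso] and g = isometry_groupD[OF induced(1)[OF iso]]
    let ?g = "induced (x, y, f)"
    have \<tau>in: "\<Phi> x \<tau> \<in> mspace U" using \<Phi>_in[OF xy(1)] .
    have g\<Phi>: "?g (\<Phi> x \<tau>) = \<phi> y (map_trm (lift_iso f \<circ> s x) \<tau>)"
      using induced(2)[OF iso map_s_Tm[OF xy(1), of \<tau>]] by (simp add: \<phi>_section xy trm.map_comp)
    have T: "map_trm (lift_iso f \<circ> s x) \<tau> \<in> Tm y"
      using lift_Tm[OF iso map_s_Tm[OF xy(1), of \<tau>]] by (simp add: trm.map_comp)
    have "dU (?g z) z' \<le> dU (?g z) (?g (\<Phi> x \<tau>)) + dU (?g (\<Phi> x \<tau>)) z'"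
      "dU (?g (\<Phi> x \<tau>)) z' \<le> dU (?g (\<Phi> x \<tau>)) (\<Phi> y \<sigma>) + dU (\<Phi> y \<sigma>) z'"
      using \<Phi>_in xy g(1) z z' \<tau>in by (intro mdist_triangle; simp)+
    moreover have "dU (?g z) (?g (\<Phi> x \<tau>)) = dU (\<Phi> x \<tau>) z" using g(2)[OF z \<tau>in] by (simp add: mdist_commute)
    ultimately have "dU (?g z) z' < r"
      using w(2) \<phi>(2)[OF xy(2) T, of \<sigma>] g\<Phi> unfolding h_def w' prod.case by simp
    then show "w \<in> {w \<in> space MX. dU (induced w z) z' < r}" using w(1) w' by simp
  qed
  also have "\<dots> \<in> sets MX"
  proof (intro sets.countable_UN' countableI_type image_subsetI)
    fix \<tau> \<sigma> show "{w \<in> space MX. h \<tau> \<sigma> w < r} \<in> sets MX" using h[of \<tau> \<sigma>] by measurable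
  qed
  finally show "{w \<in> space MX. dU (induced w z) z' < r} \<in> sets MX" .
qed

end

section \<open>Coding a fiber by predicates on the sphere\<close>

lemma capped_inf:
  fixes c :: "'i \<Rightarrow> real"
  assumes "\<And>i. i \<in> S \<Longrightarrow> 0 \<le> c i"
  shows "0 \<le> Inf (insert 1 (c ` S))" "Inf (insert 1 (c ` S)) \<le> 1"
    "i \<in> S \<Longrightarrow> Inf (insert 1 (c ` S)) \<le> c i"
    "Inf (insert 1 (c ` S)) < r \<longleftrightarrow> 1 < r \<or> (\<exists>i\<in>S. c i < r)"
proof -
  have bdd: "bdd_below (insert 1 (c ` S))" using assms by (intro bdd_belowI[of _ 0]) auto
  show "0 \<le> Inf (insert 1 (c ` S))" using assms by (intro cInf_greatest) auto
  show "Inf (insert 1 (c ` S)) \<le> 1" by (intro cInf_lower bdd) simp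
  show "i \<in> S \<Longrightarrow> Inf (insert 1 (c ` S)) \<le> c i" by (intro cInf_lower bdd) simp
  show "Inf (insert 1 (c ` S)) < r \<longleftrightarrow> 1 < r \<or> (\<exists>i\<in>S. c i < r)"
    using cInf_less_iff[OF _ bdd, of r] by auto
qed

text \<open>
  \<open>Shape \<tau> ps\<close> is the graph of the operation that puts points of sorts \<open>ps\<close> at the variables of \<open>\<tau>\<close>; with
  \<open>\<tau> = Pt 0\<close> it names a sort. \<open>Rel R\<close> carries the relation \<open>R\<close>.
\<close>
datatype ('s, 'r) sym = Shape "nat trm" "'s option list" | Rel 'r

context urysohn_model
begin

definition syms :: "('s, 'r) sym set" where
  "syms = {Shape \<tau> ps | \<tau> ps. set ps \<subseteq> insert None (Some ` sorts L0) \<and> set_trm \<tau> \<subseteq> {..<length ps}} \<union> Rel ` rels L0"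

primrec profile :: "('s, 'r) sym \<Rightarrow> 's option list" where
  "profile (Shape \<tau> ps) = ps"
| "profile (Rel R) = map Some (arity L0 R)"

text \<open>
  The arguments of a predicate are expected near the trees \<open>places \<sigma>\<close>, after a list of points of sorts
  \<open>profile \<sigma>\<close> has been substituted for the variables.
\<close>
primrec places :: "('s, 'r) sym \<Rightarrow> nat trm list" where
  "places (Shape \<tau> ps) = \<tau> # map Pt [0..<length ps]"
| "places (Rel R) = map Pt [0..<length (arity L0 R)]"

primrec val :: "'x \<Rightarrow> ('s, 'r) sym \<Rightarrow> ('s \<times> 'a) option list \<Rightarrow> real" where
  "val x (Shape \<tau> ps) bs = 0"
| "val x (Rel R) bs = rel M R (x, tuple_of bs)"

definition fits :: "'x \<Rightarrow> ('s, 'r) sym \<Rightarrow> ('s \<times> 'a) option list \<Rightarrow> bool" where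
  "fits x \<sigma> bs \<longleftrightarrow> set bs \<subseteq> points L0 M x \<and> map (map_option fst) bs = profile \<sigma>"

abbreviation "num \<sigma> \<equiv> length (places \<sigma>)"

abbreviation vertex :: "'x \<Rightarrow> ('s, 'r) sym \<Rightarrow> ('s \<times> 'a) option list \<Rightarrow> nat \<Rightarrow> 'u" where
  "vertex x \<sigma> bs i \<equiv> \<phi> x (map_trm ((!) bs) (places \<sigma> ! i))"

definition cost :: "'x \<Rightarrow> ('s, 'r) sym \<Rightarrow> (nat \<Rightarrow> 'u) \<Rightarrow> ('s \<times> 'a) option list \<Rightarrow> real" where
  "cost x \<sigma> z bs = val x \<sigma> bs + (\<Sum>i<num \<sigma>. dU (z i) (vertex x \<sigma> bs i))"

text \<open>
  The largest 1-Lipschitz function below 1 that is at most \<open>val x \<sigma> bs\<close> at the tuple of trees determined by \<open>bs\<close>.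
\<close>
definition encoded :: "'x \<Rightarrow> ('s, 'r) sym \<Rightarrow> (nat \<Rightarrow> 'u) \<Rightarrow> real" where
  "encoded x \<sigma> z = Inf (insert 1 (cost x \<sigma> z ` {bs. fits x \<sigma> bs}))"

lemma countable_syms: "countable syms"
proof -
  have "syms \<subseteq> (\<lambda>(\<tau>, ps). Shape \<tau> ps) ` (UNIV \<times> lists (insert None (Some ` sorts L0))) \<union> Rel ` rels L0"
    unfolding syms_def by (auto simp: lists_eq_set)
  then show ?thesis
    by (rule countable_subset) (intro countable_Un countable_image countable_SIGMA countable_lists countableI_type
        sort_values_countable countable_rels)
qed

lemma syms_nonempty: "syms \<noteq> {}"
proof -
  have "Shape (Pt 0) [None] \<in> syms" by (simp add: syms_def)
  then show ?thesis by blast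
qed

lemma places_vars:
  assumes "\<sigma> \<in> syms" "i < num \<sigma>"
  shows "set_trm (places \<sigma> ! i) \<subseteq> {..<length (profile \<sigma>)}"
  using assms by (cases \<sigma>) (auto simp: syms_def nth_Cons split: nat.splits)

lemma fits_length: "fits x \<sigma> bs \<Longrightarrow> length bs = length (profile \<sigma>)"
  unfolding fits_def by (metis length_map)

lemma place_Tm:
  assumes "\<sigma> \<in> syms" "fits x \<sigma> bs" "i < num \<sigma>"
  shows "map_trm ((!) bs) (places \<sigma> ! i) \<in> Tm x"
proof -
  have "bs ! v \<in> points L0 M x" if "v \<in> set_trm (places \<sigma> ! i)" for v
    using places_vars[OF assms(1,3)] that assms(2) fits_length[OF assms(2)] unfolding fits_def
    by (metis lessThan_iff nth_mem subsetD)
  then show ?thesis by (auto simp: Tm_def trm.set_map)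
qed

lemma vertex_in:
  assumes "x \<in> topspace X" "\<sigma> \<in> syms" "fits x \<sigma> bs" "i < num \<sigma>"
  shows "vertex x \<sigma> bs i \<in> mspace U"
  using \<phi>(1)[OF assms(1) place_Tm[OF assms(2-4)]] .

lemma val_range:
  assumes x: "x \<in> topspace X" and \<sigma>: "\<sigma> \<in> syms" and bs: "fits x \<sigma> bs"
  shows "0 \<le> val x \<sigma> bs" "val x \<sigma> bs \<le> 1"
proof -
  have "0 \<le> val x \<sigma> bs \<and> val x \<sigma> bs \<le> 1"
  proof (cases \<sigma>)
    case (Rel R)
    then have R: "R \<in> rels L0" using \<sigma> by (auto simp: syms_def)
    show ?thesis using relD(1)[OF R tuple_of_fprod[OF x]] bs Rel by (simp add: fits_def)
  qed simp
  then show "0 \<le> val x \<sigma> bs" "val x \<sigma> bs \<le> 1" by auto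
qed

lemma val_lipschitz:
  assumes x: "x \<in> topspace X" and \<sigma>: "\<sigma> \<in> syms" and bs: "fits x \<sigma> bs" "fits x \<sigma> cs"
  shows "\<bar>val x \<sigma> bs - val x \<sigma> cs\<bar> \<le> (\<Sum>i<length bs. dP (bs ! i) (cs ! i))"
proof (cases \<sigma>)
  case (Shape \<tau> ps)
  then show ?thesis by (auto intro!: sum_nonneg pdist_range)
next
  case (Rel R)
  then have R: "R \<in> rels L0" using \<sigma> by (auto simp: syms_def)
  then show ?thesis using rel_tuple_lipschitz[OF R x, of bs cs] bs Rel by (simp add: fits_def)
qed

lemma cost_nonneg: "x \<in> topspace X \<Longrightarrow> \<sigma> \<in> syms \<Longrightarrow> fits x \<sigma> bs \<Longrightarrow> 0 \<le> cost x \<sigma> z bs"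
  unfolding cost_def using val_range by (intro add_nonneg_nonneg sum_nonneg) auto

lemma encoded_bounds:
  assumes "x \<in> topspace X" "\<sigma> \<in> syms"
  shows "0 \<le> encoded x \<sigma> z" "encoded x \<sigma> z \<le> 1" "fits x \<sigma> bs \<Longrightarrow> encoded x \<sigma> z \<le> cost x \<sigma> z bs"
    "encoded x \<sigma> z < r \<longleftrightarrow> 1 < r \<or> (\<exists>bs. fits x \<sigma> bs \<and> cost x \<sigma> z bs < r)"
  unfolding encoded_def using capped_inf[of "{bs. fits x \<sigma> bs}" "cost x \<sigma> z"] cost_nonneg[OF assms] by auto

lemma encoded_lipschitz:
  assumes x: "x \<in> topspace X" and \<sigma>: "\<sigma> \<in> syms" and z: "z \<in> tuples U (num \<sigma>)" "z' \<in> tuples U (num \<sigma>)"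
  shows "\<bar>encoded x \<sigma> z - encoded x \<sigma> z'\<bar> \<le> (\<Sum>i<num \<sigma>. dU (z i) (z' i))"
proof -
  have half: "encoded x \<sigma> z \<le> encoded x \<sigma> z' + (\<Sum>i<num \<sigma>. dU (z i) (z' i))" if z: "z \<in> tuples U (num \<sigma>)" "z' \<in> tuples U (num \<sigma>)" for z z'
  proof (rule field_le_epsilon)
    fix e :: real assume "0 < e"
    let ?D = "\<Sum>i<num \<sigma>. dU (z i) (z' i)"
    have D: "0 \<le> ?D" by (intro sum_nonneg) auto
    have "encoded x \<sigma> z' < encoded x \<sigma> z' + e" using \<open>0 < e\<close> by simp
    then consider "1 < encoded x \<sigma> z' + e" | bs where "fits x \<sigma> bs" "cost x \<sigma> z' bs < encoded x \<sigma> z' + e"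
      using encoded_bounds(4)[OF x \<sigma>] by blast
    then show "encoded x \<sigma> z \<le> encoded x \<sigma> z' + ?D + e"
    proof cases
      case 1
      then show ?thesis using encoded_bounds(2)[OF x \<sigma>, of z] D by linarith
    next
      case 2
      have "(\<Sum>i<num \<sigma>. dU (z i) (vertex x \<sigma> bs i)) \<le> (\<Sum>i<num \<sigma>. dU (z i) (z' i) + dU (z' i) (vertex x \<sigma> bs i))"
        using z vertex_in[OF x \<sigma> 2(1)] by (intro sum_mono mdist_triangle) (auto simp: tuples_def)
      then have "cost x \<sigma> z bs \<le> cost x \<sigma> z' bs + ?D" by (simp add: cost_def sum.distrib)
      then show ?thesis using encoded_bounds(3)[OF x \<sigma> 2(1), of z] 2(2) by linarith
    qed
  qed
  have "(\<Sum>i<num \<sigma>. dU (z' i) (z i)) = (\<Sum>i<num \<sigma>. dU (z i) (z' i))" by (simp add: mdist_commute)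
  then show ?thesis using half[OF z] half[OF z(2,1)] by linarith
qed

lemma tuple_of_lift:
  assumes "set bs \<subseteq> points L0 M x" "map (map_option fst) bs = map Some Ps"
  shows "tuple_of (map (lift_iso f) bs) = (\<lambda>i\<in>{..<length Ps}. f (Ps ! i) (tuple_of bs i))"
proof
  fix i
  have len: "length bs = length Ps" using assms(2) by (metis length_map)
  show "tuple_of (map (lift_iso f) bs) i = (\<lambda>i\<in>{..<length Ps}. f (Ps ! i) (tuple_of bs i)) i"
  proof (cases "i < length Ps")
    case True
    obtain a where "bs ! i = Some (Ps ! i, a)" using list_pointsE[OF assms True] by metis
    then show ?thesis using True len by (simp add: tuple_of_def)
  next
    case False
    then show ?thesis using len by (simp add: tuple_of_def)
  qed
qed

lemma fits_lift:
  assumes f: "(x, y, f) \<in> iso_morphisms L0 X M" and bs: "fits x \<sigma> bs"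
  shows "fits y \<sigma> (map (lift_iso f) bs)"
  using bs lift_iso_points[OF f] unfolding fits_def by (auto simp: comp_def)

lemma fits_lift_surj:
  assumes f: "(x, y, f) \<in> iso_morphisms L0 X M" and cs: "fits y \<sigma> cs"
  shows "\<exists>bs. fits x \<sigma> bs \<and> map (lift_iso f) bs = cs"
proof -
  have "\<forall>q\<in>points L0 M y. \<exists>p. p \<in> points L0 M x \<and> lift_iso f p = q" using lift_iso_surj[OF f] by blast
  from bchoice[OF this] obtain h where h: "\<And>q. q \<in> points L0 M y \<Longrightarrow> h q \<in> points L0 M x \<and> lift_iso f (h q) = q" by blast
  have *: "h q \<in> points L0 M x" "lift_iso f (h q) = q" if "q \<in> set cs" for q using h cs that unfolding fits_def by auto
  have "map_option fst (h q) = map_option fst q" if "q \<in> set cs" for q using *(2)[OF that] sort_lift_iso by metis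
  then have "fits x \<sigma> (map h cs)" using * cs unfolding fits_def by (auto simp: comp_def cong: map_cong)
  moreover have "map (lift_iso f) (map h cs) = cs" using *(2) by (simp add: map_idI)
  ultimately show ?thesis by blast
qed

lemma vertex_lift:
  assumes f: "(x, y, f) \<in> iso_morphisms L0 X M" and \<sigma>: "\<sigma> \<in> syms" and bs: "fits x \<sigma> bs" and i: "i < num \<sigma>"
  shows "vertex y \<sigma> (map (lift_iso f) bs) i = induced (x, y, f) (vertex x \<sigma> bs i)"
proof -
  have "map_trm ((!) (map (lift_iso f) bs)) (places \<sigma> ! i) = map_trm (lift_iso f \<circ> (!) bs) (places \<sigma> ! i)"
    using places_vars[OF \<sigma> i] fits_length[OF bs] by (intro trm.map_cong) auto
  then show ?thesis using induced(2)[OF f place_Tm[OF \<sigma> bs i]] by (simp add: trm.map_comp)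
qed

lemma val_lift:
  assumes f: "(x, y, f) \<in> iso_morphisms L0 X M" and \<sigma>: "\<sigma> \<in> syms" and bs: "fits x \<sigma> bs"
  shows "val y \<sigma> (map (lift_iso f) bs) = val x \<sigma> bs"
proof (cases \<sigma>)
  case (Rel R)
  then have R: "R \<in> rels L0" using \<sigma> by (auto simp: syms_def)
  have bs': "set bs \<subseteq> points L0 M x" "map (map_option fst) bs = map Some (arity L0 R)" using bs Rel by (auto simp: fits_def)
  have "tuple_of bs \<in> (\<Pi>\<^sub>E i \<in> {..<length (arity L0 R)}. fiber (srt M (arity L0 R ! i)) x)"
    using tuple_of_fprod[OF iso_morphismsD(1)[OF f] bs'] by (simp add: fprod_arity)
  then have "rel M R (y, \<lambda>i \<in> {..<length (arity L0 R)}. f (arity L0 R ! i) (tuple_of bs i)) = rel M R (x, tuple_of bs)"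
    using iso_morphismsD(3)[OF f] R unfolding fiber_isomorphisms_def by blast
  then show ?thesis using tuple_of_lift[OF bs', of f] Rel by simp
qed simp

text \<open>
  An isomorphism matches the lists \<open>bs\<close> over \<open>x\<close> with those over \<open>y\<close>, and costs agree along the matching
  because the induced isometry carries trees to trees and \<open>f\<close> preserves relations.
\<close>
lemma encoded_natural:
  assumes f: "(x, y, f) \<in> iso_morphisms L0 X M" and \<sigma>: "\<sigma> \<in> syms" and z: "z \<in> tuples U (num \<sigma>)"
  shows "encoded y \<sigma> (\<lambda>i\<in>{..<num \<sigma>}. induced (x, y, f) (z i)) = encoded x \<sigma> z"
proof -
  let ?z = "\<lambda>i\<in>{..<num \<sigma>}. induced (x, y, f) (z i)"
  have cost: "cost y \<sigma> ?z (map (lift_iso f) bs) = cost x \<sigma> z bs" if bs: "fits x \<sigma> bs" for bs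
  proof -
    have "(\<Sum>i<num \<sigma>. dU (?z i) (vertex y \<sigma> (map (lift_iso f) bs) i)) = (\<Sum>i<num \<sigma>. dU (z i) (vertex x \<sigma> bs i))"
    proof (rule sum.cong[OF refl])
      fix i assume "i \<in> {..<num \<sigma>}"
      then have i: "i < num \<sigma>" by simp
      have "z i \<in> mspace U" using z i by (auto simp: tuples_def)
      then show "dU (?z i) (vertex y \<sigma> (map (lift_iso f) bs) i) = dU (z i) (vertex x \<sigma> bs i)"
        unfolding vertex_lift[OF f \<sigma> bs i]
        using isometry_groupD(2)[OF induced(1)[OF f]] vertex_in[OF iso_morphismsD(1)[OF f] \<sigma> bs i] i by simp
    qed
    then show ?thesis using val_lift[OF f \<sigma> bs] by (simp only: cost_def)
  qed
  have "cost y \<sigma> ?z ` {bs. fits y \<sigma> bs} = cost x \<sigma> z ` {bs. fits x \<sigma> bs}"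
  proof (intro equalityI image_subsetI)
    fix cs assume "cs \<in> {bs. fits y \<sigma> bs}"
    then obtain bs where bs: "fits x \<sigma> bs" "map (lift_iso f) bs = cs" using fits_lift_surj[OF f] by blast
    then show "cost y \<sigma> ?z cs \<in> cost x \<sigma> z ` {bs. fits x \<sigma> bs}" using cost[OF bs(1)] by auto
  next
    fix bs assume "bs \<in> {bs. fits x \<sigma> bs}"
    then have bs: "fits x \<sigma> bs" by simp
    show "cost x \<sigma> z bs \<in> cost y \<sigma> ?z ` {bs. fits y \<sigma> bs}"
      using cost[OF bs, symmetric] fits_lift[OF f bs] by (intro image_eqI) auto
  qed
  then show ?thesis unfolding encoded_def by simp
qed

definition vertices :: "'x \<Rightarrow> ('s, 'r) sym \<Rightarrow> ('s \<times> 'a) option list \<Rightarrow> nat \<Rightarrow> 'u" where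
  "vertices x \<sigma> bs = (\<lambda>i\<in>{..<num \<sigma>}. vertex x \<sigma> bs i)"

lemma vertices_tuples:
  assumes "x \<in> topspace X" "\<sigma> \<in> syms" "fits x \<sigma> bs"
  shows "vertices x \<sigma> bs \<in> tuples U (num \<sigma>)"
  using vertex_in[OF assms] by (auto simp: vertices_def tuples_def)

lemma cost_vertices:
  assumes "x \<in> topspace X" "\<sigma> \<in> syms" "fits x \<sigma> bs"
  shows "cost x \<sigma> (vertices x \<sigma> bs) bs = val x \<sigma> bs"
  using mdist_self[OF vertex_in[OF assms]] by (simp add: cost_def vertices_def)

text \<open>
  On tuples from the fiber the extension has the original value, since the relation is already 1-Lipschitz there.
\<close>
lemma encoded_Rel:
  assumes x: "x \<in> topspace X" and R: "R \<in> rels L0" and bs: "fits x (Rel R) bs"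
  shows "encoded x (Rel R) (vertices x (Rel R) bs) = rel M R (x, tuple_of bs)"
proof (rule antisym)
  have \<sigma>: "Rel R \<in> syms" using R by (simp add: syms_def)
  show "encoded x (Rel R) (vertices x (Rel R) bs) \<le> rel M R (x, tuple_of bs)"
    using encoded_bounds(3)[OF x \<sigma> bs, of "vertices x (Rel R) bs"] cost_vertices[OF x \<sigma> bs] by simp
  have low: "rel M R (x, tuple_of bs) \<le> cost x (Rel R) (vertices x (Rel R) bs) cs" if cs: "fits x (Rel R) cs" for cs
  proof -
    have len: "length bs = num (Rel R)" using fits_length[OF bs] by simp
    have "dP (bs ! i) (cs ! i) = dU (vertices x (Rel R) bs i) (vertex x (Rel R) cs i)" if i: "i < num (Rel R)" for i
    proof -
      have "dU (vertex x (Rel R) bs i) (vertex x (Rel R) cs i) = dT (map_trm ((!) bs) (places (Rel R) ! i)) (map_trm ((!) cs) (places (Rel R) ! i))"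
        using place_Tm[OF \<sigma> bs i] place_Tm[OF \<sigma> cs i] by (intro \<phi>_isometric x)
      then show ?thesis using i by (simp add: vertices_def tdist_Pt[OF pseudometric_pdist])
    qed
    then have "(\<Sum>i<length bs. dP (bs ! i) (cs ! i)) = (\<Sum>i<num (Rel R). dU (vertices x (Rel R) bs i) (vertex x (Rel R) cs i))"
      unfolding len by (intro sum.cong) auto
    then show ?thesis using val_lipschitz[OF x \<sigma> bs cs] unfolding cost_def by simp
  qed
  show "rel M R (x, tuple_of bs) \<le> encoded x (Rel R) (vertices x (Rel R) bs)"
    unfolding encoded_def using low val_range(2)[OF x \<sigma> bs] by (intro cInf_greatest) auto
qed

section \<open>Recovering an isomorphism from an isometry\<close>

definition equivariant :: "'x \<Rightarrow> 'x \<Rightarrow> ('u \<Rightarrow> 'u) \<Rightarrow> bool" where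
  "equivariant x y g \<longleftrightarrow> (\<forall>\<sigma>\<in>syms. \<forall>z\<in>tuples U (num \<sigma>). encoded y \<sigma> (\<lambda>i\<in>{..<num \<sigma>}. g (z i)) = encoded x \<sigma> z)"

text \<open>
  At the tuple \<open>(\<tau>(b), b)\<close> the predicate of the shape \<open>\<tau>\<close> vanishes over \<open>x\<close>, hence also at its image over \<open>y\<close>.
  A vanishing infimum only says that the image is approximated by such tuples \<open>(\<tau>(c), c)\<close> over \<open>y\<close>.
\<close>
lemma shape_transfer:
  assumes x: "x \<in> topspace X" and y: "y \<in> topspace X" and eq: "equivariant x y g"
    and \<sigma>: "Shape \<tau> ps \<in> syms" and bs: "fits x (Shape \<tau> ps) bs" and e: "0 < e"
  shows "\<exists>cs. fits y (Shape \<tau> ps) cs \<and> (\<forall>i<Suc (length ps). dU (g (vertex x (Shape \<tau> ps) bs i)) (vertex y (Shape \<tau> ps) cs i) < e)"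
proof -
  let ?\<sigma> = "Shape \<tau> ps" and ?z = "vertices x (Shape \<tau> ps) bs"
  let ?w = "\<lambda>i\<in>{..<num ?\<sigma>}. g (?z i)"
  have "encoded x ?\<sigma> ?z \<le> 0" using encoded_bounds(3)[OF x \<sigma> bs, of ?z] cost_vertices[OF x \<sigma> bs] by simp
  moreover have "encoded y ?\<sigma> ?w = encoded x ?\<sigma> ?z" using eq \<sigma> vertices_tuples[OF x \<sigma> bs] unfolding equivariant_def by blast
  ultimately have "encoded y ?\<sigma> ?w < min e 1" using e by simp
  then obtain cs where cs: "fits y ?\<sigma> cs" "cost y ?\<sigma> ?w cs < e" using encoded_bounds(4)[OF y \<sigma>] by auto
  have "dU (g (vertex x ?\<sigma> bs i)) (vertex y ?\<sigma> cs i) < e" if i: "i < num ?\<sigma>" for i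
  proof -
    have "dU (?w i) (vertex y ?\<sigma> cs i) \<le> (\<Sum>i<num ?\<sigma>. dU (?w i) (vertex y ?\<sigma> cs i))"
      using i by (intro member_le_sum) auto
    then have "dU (?w i) (vertex y ?\<sigma> cs i) < e" using cs(2) by (simp add: cost_def)
    moreover have "?w i = g (vertex x ?\<sigma> bs i)" using i by (simp add: vertices_def)
    ultimately show ?thesis by simp
  qed
  then show ?thesis using cs(1) by auto
qed

text \<open>
  Points of one sort that converge in the sphere form a Cauchy sequence for the metric of the sort. That metric is complete,
  and the limit stays in the fiber because different fibers are at distance 1.
\<close>
lemma points_closed:
  assumes y: "y \<in> topspace X" and w: "w \<in> mspace U"
    and near: "\<And>e. 0 < e \<Longrightarrow> \<exists>q\<in>points L0 M y. map_option fst q = P \<and> dU w (\<phi> y (Pt q)) < e"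
  shows "\<exists>q\<in>points L0 M y. map_option fst q = P \<and> \<phi> y (Pt q) = w"
proof -
  have \<phi>q: "\<phi> y (Pt q) \<in> mspace U" if "q \<in> points L0 M y" for q using that \<phi>(1)[OF y] by (simp add: Pt_Tm)
  have "\<exists>q\<in>points L0 M y. map_option fst q = P \<and> (\<forall>e>0. dU w (\<phi> y (Pt q)) \<le> 0 + e)"
  proof (cases P)
    case None
    have "dU w (\<phi> y (Pt None)) < e" if "0 < e" for e using near[OF that] None by auto
    then show ?thesis using None points_None[of y] by (intro bexI[of _ None]) (auto simp: less_imp_le)
  next
    case (Some Q)
    have "\<forall>n. \<exists>a. Some (Q, a) \<in> points L0 M y \<and> dU w (\<phi> y (Pt (Some (Q, a)))) < (1/2) ^ n"
    proof
      fix n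
      obtain q where q: "q \<in> points L0 M y" "map_option fst q = P" "dU w (\<phi> y (Pt q)) < (1/2) ^ n" using near[of "(1/2) ^ n"] by auto
      then obtain a where "q = Some (Q, a)" using Some by auto
      then show "\<exists>a. Some (Q, a) \<in> points L0 M y \<and> dU w (\<phi> y (Pt (Some (Q, a)))) < (1/2) ^ n" using q by blast
    qed
    from choice[OF this] obtain a where a: "\<And>n. Some (Q, a n) \<in> points L0 M y" "\<And>n. dU w (\<phi> y (Pt (Some (Q, a n)))) < (1/2) ^ n" by blast
    have Q: "Q \<in> sorts L0" and af: "a n \<in> fiber (srt M Q) y" for n using a(1) by (auto simp: points_Some)
    let ?m = "met (srt M Q)"
    have am: "a n \<in> mspace ?m" for n using af[of n] mspace_sort[OF Q] by (simp add: fiberD)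
    have step: "mdist ?m (a n) (a (Suc n)) \<le> 2 * (1/2) ^ n" for n
    proof -
      have "mdist ?m (a n) (a (Suc n)) = dU (\<phi> y (Pt (Some (Q, a n)))) (\<phi> y (Pt (Some (Q, a (Suc n)))))"
        using \<phi>_isometric[OF y, of "Pt (Some (Q, a n))" "Pt (Some (Q, a (Suc n)))"] a(1) pdist_same[OF Q, of "a n" "a (Suc n)"] af
          tdist_Pt[OF pseudometric_pdist]
        by (simp add: Pt_Tm fiberD)
      also have "\<dots> \<le> dU (\<phi> y (Pt (Some (Q, a n)))) w + dU w (\<phi> y (Pt (Some (Q, a (Suc n)))))"
        by (intro mdist_triangle \<phi>q a(1) w)
      also have "\<dots> \<le> (1/2) ^ n + (1/2) ^ Suc n"
        using a(2)[of n] a(2)[of "Suc n"] mdist_commute[of U w] by (intro add_mono) (auto simp: less_imp_le)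
      also have "\<dots> \<le> 2 * (1/2) ^ n" by simp
      finally show ?thesis .
    qed
    obtain l where l: "l \<in> mspace ?m" "\<And>n. mdist ?m (a n) l \<le> 4 * (1/2) ^ n"
      using geometric_sequence_limit[OF metric_etaleD(2)[OF sort_etale[OF Q]], of 0 a 2] am step by auto
    have "mdist ?m (a 3) l < 1" using l(2)[of 3] by (simp add: power3_eq_cube)
    then have "proj (srt M Q) (a 3) = proj (srt M Q) l"
      using metric_etaleD(6)[OF sort_etale[OF Q], of "a 3" l] am[of 3] l(1) mspace_sort[OF Q] by fastforce
    then have lf: "l \<in> fiber (srt M Q) y" using af[of 3] l(1) mspace_sort[OF Q] by (simp add: fiberD)
    then have lp: "Some (Q, l) \<in> points L0 M y" using Q by (simp add: points_Some)
    have "dU w (\<phi> y (Pt (Some (Q, l)))) \<le> 0 + e" if e: "0 < e" for e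
    proof -
      obtain n where n: "5 * (1/2) ^ n < e" using geometric_small[OF e] by blast
      have "dU w (\<phi> y (Pt (Some (Q, l)))) \<le> dU w (\<phi> y (Pt (Some (Q, a n)))) + dU (\<phi> y (Pt (Some (Q, a n)))) (\<phi> y (Pt (Some (Q, l))))"
        by (intro mdist_triangle \<phi>q a(1) lp w)
      moreover have "dU (\<phi> y (Pt (Some (Q, a n)))) (\<phi> y (Pt (Some (Q, l)))) = mdist ?m (a n) l"
        using \<phi>_isometric[OF y, of "Pt (Some (Q, a n))" "Pt (Some (Q, l))"] a(1) lp pdist_same[OF Q, of "a n" l] af[of n] lf
          tdist_Pt[OF pseudometric_pdist]
        by (simp add: Pt_Tm fiberD)
      ultimately show ?thesis using a(2)[of n] l(2)[of n] n by linarith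
    qed
    then show ?thesis using lp Some by (intro bexI[of _ "Some (Q, l)"]) auto
  qed
  then obtain q where q: "q \<in> points L0 M y" "map_option fst q = P" "\<And>e. 0 < e \<Longrightarrow> dU w (\<phi> y (Pt q)) \<le> 0 + e" by blast
  have "dU w (\<phi> y (Pt q)) \<le> 0" by (rule field_le_epsilon[OF q(3)])
  then have "dU w (\<phi> y (Pt q)) = 0" using mdist_nonneg[of U w "\<phi> y (Pt q)"] by linarith
  then have "w = \<phi> y (Pt q)" using w \<phi>q[OF q(1)] by simp
  then show ?thesis using q(1,2) by blast
qed

lemma point_transfer:
  assumes x: "x \<in> topspace X" and y: "y \<in> topspace X" and eq: "equivariant x y g" and g: "g \<in> isometry_group U"
    and p: "p \<in> points L0 M x"
  shows "\<exists>q\<in>points L0 M y. map_option fst q = map_option fst p \<and> \<phi> y (Pt q) = g (\<phi> x (Pt p))"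
proof (rule points_closed[OF y])
  show "g (\<phi> x (Pt p)) \<in> mspace U" using isometry_groupD(1)[OF g] \<phi>(1)[OF x, of "Pt p"] p by (simp add: Pt_Tm)
  fix e :: real assume e: "0 < e"
  let ?\<sigma> = "Shape (Pt 0) [map_option fst p]"
  have \<sigma>: "?\<sigma> \<in> syms" using p by (auto simp: syms_def points_def)
  have "fits x ?\<sigma> [p]" using p by (simp add: fits_def)
  from shape_transfer[OF x y eq \<sigma> this e] obtain cs where cs: "fits y ?\<sigma> cs" "dU (g (vertex x ?\<sigma> [p] 0)) (vertex y ?\<sigma> cs 0) < e"
    by auto
  then obtain q where "cs = [q]" by (auto simp: fits_def)
  then show "\<exists>q\<in>points L0 M y. map_option fst q = map_option fst p \<and> dU (g (\<phi> x (Pt p))) (\<phi> y (Pt q)) < e"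
    using cs by (auto simp: fits_def)
qed

text \<open>
  Name the leaves of \<open>t\<close> by variables. The isometry already acts on leaves by \<open>F\<close>, so in
  \<open>shape_transfer\<close> the approximating leaves \<open>c\<close> converge to the leaves of \<open>map_trm F t\<close>, and by continuity of
  the tree distance the trees \<open>\<tau>(c)\<close> converge to \<open>map_trm F t\<close>.
\<close>
lemma term_transfer:
  assumes x: "x \<in> topspace X" and y: "y \<in> topspace X" and eq: "equivariant x y g" and g: "g \<in> isometry_group U"
    and F: "\<And>p. p \<in> points L0 M x \<Longrightarrow> F p \<in> points L0 M y" "\<And>p. p \<in> points L0 M x \<Longrightarrow> map_option fst (F p) = map_option fst p"
      "\<And>p. p \<in> points L0 M x \<Longrightarrow> \<phi> y (Pt (F p)) = g (\<phi> x (Pt p))"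
    and t: "t \<in> Tm x"
  shows "g (\<phi> x t) = \<phi> y (map_trm F t)"
proof -
  obtain bs where bs: "set bs = set_trm t" using finite_list[OF finite_set_trm[of t]] by (elim exE)
  define idx where "idx = (\<lambda>p. SOME i. i < length bs \<and> bs ! i = p)"
  have idx: "idx p < length bs" "bs ! idx p = p" if "p \<in> set_trm t" for p
  proof -
    have "\<exists>i. i < length bs \<and> bs ! i = p" using that bs by (metis in_set_conv_nth)
    from someI_ex[OF this] show "idx p < length bs" "bs ! idx p = p" by (auto simp: idx_def)
  qed
  \<comment> \<open>The leaves of \<open>t\<close> become the variables \<open>0, 1, \<dots>\<close> of the shape \<open>\<tau>\<close>, and \<open>bs\<close> substitutes them back.\<close>
  define \<tau> where "\<tau> = map_trm idx t"
  define ps where "ps = map (map_option fst) bs"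
  let ?\<sigma> = "Shape \<tau> ps"
  have pts: "set bs \<subseteq> points L0 M x" using bs t by (simp add: Tm_def)
  have \<tau>vars: "set_trm \<tau> \<subseteq> {..<length bs}" using idx(1) by (auto simp: \<tau>_def trm.set_map)
  have "map_option fst p \<in> insert None (Some ` sorts L0)" if "p \<in> points L0 M x" for p using that by (auto simp: points_def)
  then have \<sigma>: "?\<sigma> \<in> syms" using pts \<tau>vars by (auto simp: syms_def ps_def)
  have fit: "fits x ?\<sigma> bs" using pts by (simp add: fits_def ps_def)
  have tau_bs: "map_trm ((!) bs) \<tau> = t"
    using idx(2) by (simp add: \<tau>_def trm.map_comp comp_def cong: trm.map_cong) (simp add: trm.map_ident)
  have tau_F: "map_trm ((!) (map F bs)) \<tau> = map_trm F t"
    unfolding \<tau>_def trm.map_comp using idx by (intro trm.map_cong) auto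
  have FT: "map_trm F t \<in> Tm y" using F(1) t by (auto simp: Tm_def trm.set_map)
  have approx: "dU (g (\<phi> x t)) (\<phi> y (map_trm F t)) \<le> 0 + e" if e: "0 < e" for e
  proof -
    define \<eta> where "\<eta> = e / (1 + 3 ^ lev \<tau>)"
    have \<eta>: "0 < \<eta>" unfolding \<eta>_def using e by (intro divide_pos_pos add_pos_pos) auto
    obtain cs where cs: "fits y ?\<sigma> cs" "\<And>i. i < Suc (length ps) \<Longrightarrow> dU (g (vertex x ?\<sigma> bs i)) (vertex y ?\<sigma> cs i) < \<eta>"
      using shape_transfer[OF x y eq \<sigma> fit \<eta>] by blast
    have len: "length cs = length bs" "length ps = length bs" using fits_length[OF cs(1)] by (auto simp: ps_def)
    have cspts: "cs ! i \<in> points L0 M y" if "i < length bs" for i using cs(1) that len by (auto simp: fits_def)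
    have close: "dP ((map F bs) ! i) (cs ! i) \<le> \<eta>" if i: "i < length bs" for i
    proof -
      have b: "bs ! i \<in> points L0 M x" using pts i by auto
      have "dU (g (vertex x ?\<sigma> bs (Suc i))) (vertex y ?\<sigma> cs (Suc i)) < \<eta>" using cs(2)[of "Suc i"] i len by simp
      then have "dU (\<phi> y (Pt (F (bs ! i)))) (\<phi> y (Pt (cs ! i))) < \<eta>" using F(3)[OF b] i len by simp
      then show ?thesis
        using \<phi>_isometric[OF y, of "Pt (F (bs ! i))" "Pt (cs ! i)"] F(1)[OF b] cspts[OF i] tdist_Pt[OF pseudometric_pdist] i
        by (simp add: Pt_Tm)
    qed
    have cT: "map_trm ((!) cs) \<tau> \<in> Tm y" using place_Tm[OF \<sigma> cs(1), of 0] by simp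
    have "dT (map_trm ((!) (map F bs)) \<tau>) (map_trm ((!) cs) \<tau>) \<le> 3 ^ lev \<tau> * \<eta>"
      using close \<tau>vars \<eta> by (intro tdist_perturb[OF pseudometric_pdist]) auto
    then have d1: "dU (\<phi> y (map_trm F t)) (\<phi> y (map_trm ((!) cs) \<tau>)) \<le> 3 ^ lev \<tau> * \<eta>"
      using \<phi>_isometric[OF y FT cT] tau_F by simp
    have d2: "dU (g (\<phi> x t)) (\<phi> y (map_trm ((!) cs) \<tau>)) < \<eta>" using cs(2)[of 0] tau_bs by simp
    have "dU (g (\<phi> x t)) (\<phi> y (map_trm F t)) \<le> dU (g (\<phi> x t)) (\<phi> y (map_trm ((!) cs) \<tau>)) + dU (\<phi> y (map_trm ((!) cs) \<tau>)) (\<phi> y (map_trm F t))"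
      using isometry_groupD(1)[OF g] \<phi>(1) x y t FT cT by (intro mdist_triangle) auto
    also have "\<dots> \<le> \<eta> + 3 ^ lev \<tau> * \<eta>" using d1 d2 mdist_commute[of U "\<phi> y (map_trm F t)"] by simp
    also have "\<dots> = (1 + 3 ^ lev \<tau>) * \<eta>" by (simp add: algebra_simps)
    also have "\<dots> = e"
    proof -
      have "(1 + 3 ^ lev \<tau> :: real) \<noteq> 0" using zero_less_power[of "3 :: real" "lev \<tau>"] by linarith
      then show ?thesis by (simp add: \<eta>_def)
    qed
    finally show ?thesis by simp
  qed
  have "dU (g (\<phi> x t)) (\<phi> y (map_trm F t)) \<le> 0" by (rule field_le_epsilon[OF approx])
  then have "dU (g (\<phi> x t)) (\<phi> y (map_trm F t)) = 0" using mdist_nonneg[of U "g (\<phi> x t)" "\<phi> y (map_trm F t)"] by linarith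
  then show ?thesis using isometry_groupD(1)[OF g \<phi>(1)[OF x t]] \<phi>(1)[OF y FT] by simp
qed

lemma inverse_isometry:
  assumes g: "g \<in> isometry_group U" and a: "a \<in> mspace U"
  shows "inv_into (mspace U) g a \<in> mspace U" "g (inv_into (mspace U) g a) = a" "inv_into (mspace U) g (g a) = a"
  using isometry_groupD(3)[OF g] a
  by (metis bij_betw_imp_surj_on inv_into_into, metis bij_betw_inv_into_right, metis bij_betw_inv_into_left)

lemma equivariant_inverse:
  assumes g: "g \<in> isometry_group U" and eq: "equivariant x y g"
  shows "equivariant y x (\<lambda>a\<in>mspace U. inv_into (mspace U) g a)"
  unfolding equivariant_def
proof (intro ballI)
  let ?h = "\<lambda>a\<in>mspace U. inv_into (mspace U) g a"
  fix \<sigma> z assume \<sigma>: "\<sigma> \<in> syms" and z: "z \<in> tuples U (num \<sigma>)"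
  have z': "(\<lambda>i\<in>{..<num \<sigma>}. ?h (z i)) \<in> tuples U (num \<sigma>)" 
    using z inverse_isometry(1)[OF g] by (auto simp: tuples_def)
  have "(\<lambda>i\<in>{..<num \<sigma>}. g ((\<lambda>i\<in>{..<num \<sigma>}. ?h (z i)) i)) = z"
    using z inverse_isometry(2)[OF g] by (auto simp: tuples_def fun_eq_iff PiE_iff extensional_def)
  then show "encoded x \<sigma> (\<lambda>i\<in>{..<num \<sigma>}. ?h (z i)) = encoded y \<sigma> z"
    using eq[unfolded equivariant_def, rule_format, OF \<sigma> z'] by simp
qed

text \<open>
  The action \<open>F\<close> on leaves is onto because the inverse isometry is equivariant as well, and it preserves
  relations because their extensions have the original values on leaves.
\<close>
lemma equivariant_comes_from_isomorphism:
  assumes x: "x \<in> topspace X" and y: "y \<in> topspace X" and g: "g \<in> isometry_group U" and eq: "equivariant x y g"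
  shows "\<exists>f. (x, y, f) \<in> iso_morphisms L0 X M \<and> induced (x, y, f) = g"
proof -
  have "\<forall>p\<in>points L0 M x. \<exists>q. q \<in> points L0 M y \<and> map_option fst q = map_option fst p \<and> \<phi> y (Pt q) = g (\<phi> x (Pt p))"
    using point_transfer[OF x y eq g] by blast
  from bchoice[OF this] obtain F where F: "\<And>p. p \<in> points L0 M x \<Longrightarrow> F p \<in> points L0 M y"
    "\<And>p. p \<in> points L0 M x \<Longrightarrow> map_option fst (F p) = map_option fst p"
    "\<And>p. p \<in> points L0 M x \<Longrightarrow> \<phi> y (Pt (F p)) = g (\<phi> x (Pt p))" by blast
  have \<phi>x: "\<phi> x (Pt p) \<in> mspace U" if "p \<in> points L0 M x" for p using that \<phi>(1)[OF x] by (simp add: Pt_Tm)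
  have dPU: "dU (\<phi> x (Pt p)) (\<phi> x (Pt q)) = dP p q" if "x \<in> topspace X" "p \<in> points L0 M x" "q \<in> points L0 M x" for x p q
    using \<phi>_isometric[OF that(1), of "Pt p" "Pt q"] that tdist_Pt[OF pseudometric_pdist] by (simp add: Pt_Tm)
  have Fd: "dP (F p) (F q) = dP p q" if "p \<in> points L0 M x" "q \<in> points L0 M x" for p q
    using dPU[OF y F(1)[OF that(1)] F(1)[OF that(2)]] dPU[OF x that] F(3) isometry_groupD(2)[OF g \<phi>x \<phi>x] that by simp
  have Fsurj: "\<exists>p\<in>points L0 M x. F p = q" if q: "q \<in> points L0 M y" for q
  proof -
    have qU: "\<phi> y (Pt q) \<in> mspace U" using q \<phi>(1)[OF y] by (simp add: Pt_Tm)
    obtain p where p: "p \<in> points L0 M x" "\<phi> x (Pt p) = (\<lambda>a\<in>mspace U. inv_into (mspace U) g a) (\<phi> y (Pt q))"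
      using point_transfer[OF y x equivariant_inverse[OF g eq] isometry_group_inverse[OF g] q] by blast
    then have "g (\<phi> x (Pt p)) = \<phi> y (Pt q)" using qU inverse_isometry(2)[OF g qU] by simp
    then have "dP (F p) q = 0" using dPU[OF y F(1)[OF p(1)] q] F(3)[OF p(1)] mdist_self[OF qU] by simp
    then have "F p = q" using pdist_zero_iff[OF F(1)[OF p(1)] q] by simp
    then show ?thesis using p(1) by blast
  qed
  define f where "f = (\<lambda>P\<in>sorts L0. \<lambda>a\<in>fiber (srt M P) x. snd (the (F (Some (P, a)))))"
  have FS: "F (Some (P, a)) = Some (P, f P a)" "f P a \<in> fiber (srt M P) y" if P: "P \<in> sorts L0" "a \<in> fiber (srt M P) x" for P a
  proof -
    have p: "Some (P, a) \<in> points L0 M x" using P by (simp add: points_Some)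
    obtain b where b: "F (Some (P, a)) = Some (P, b)" using F(2)[OF p] by (cases "F (Some (P, a))") auto
    then have "f P a = b" using P by (simp add: f_def)
    then show "F (Some (P, a)) = Some (P, f P a)" "f P a \<in> fiber (srt M P) y"
      using b F(1)[OF p] by (auto simp: points_Some)
  qed
  have lift: "lift_iso f p = F p" if p: "p \<in> points L0 M x" for p
  proof (cases p)
    case None
    then show ?thesis using F(2)[OF p] by (cases "F None") auto
  next
    case (Some Pa)
    then show ?thesis using p FS(1) by (cases Pa) (auto simp: points_Some)
  qed
  have dist: "mdist (met (srt M P)) (f P a) (f P b) = mdist (met (srt M P)) a b"
    if P: "P \<in> sorts L0" "a \<in> fiber (srt M P) x" "b \<in> fiber (srt M P) x" for P a b
  proof -
    have "dP (F (Some (P, a))) (F (Some (P, b))) = dP (Some (P, a)) (Some (P, b))" using P by (intro Fd) (auto simp: points_Some)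
    then show ?thesis using FS P pdist_same[OF P(1)] by (simp add: fiberD)
  qed
  have inj: "inj_on (f P) (fiber (srt M P) x)" if P: "P \<in> sorts L0" for P
  proof (rule inj_onI)
    fix a b assume ab: "a \<in> fiber (srt M P) x" "b \<in> fiber (srt M P) x" "f P a = f P b"
    have "f P b \<in> mspace (met (srt M P))" using FS(2)[OF P ab(2)] mspace_sort[OF P] by (simp add: fiberD)
    then have "mdist (met (srt M P)) a b = 0" using dist[OF P ab(1,2)] ab(3) mdist_self by metis
    then show "a = b" using ab mspace_sort[OF P] by (simp add: fiberD)
  qed
  have surj: "f P ` fiber (srt M P) x = fiber (srt M P) y" if P: "P \<in> sorts L0" for P
  proof (intro equalityI image_subsetI FS(2)[OF P] subsetI)
    fix b assume "b \<in> fiber (srt M P) y"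
    then obtain p where p: "p \<in> points L0 M x" "F p = Some (P, b)" using Fsurj[of "Some (P, b)"] P by (auto simp: points_Some)
    then obtain a where a: "p = Some (P, a)" using F(2)[OF p(1)] by (cases p) auto
    then have "a \<in> fiber (srt M P) x" using p(1) by (simp add: points_Some)
    moreover have "f P a = b" using FS(1)[OF P calculation] p(2) a by simp
    ultimately show "b \<in> f P ` fiber (srt M P) x" by blast
  qed
  have rel: "rel M R (y, \<lambda>i \<in> {..<length (arity L0 R)}. f (arity L0 R ! i) (a i)) = rel M R (x, a)"
    if R: "R \<in> rels L0" and a: "a \<in> (\<Pi>\<^sub>E i \<in> {..<length (arity L0 R)}. fiber (srt M (arity L0 R ! i)) x)" for R a
  proof -
    let ?n = "length (arity L0 R)" and ?\<sigma> = "Rel R :: ('s, 'r) sym"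
    have \<sigma>: "?\<sigma> \<in> syms" using R by (simp add: syms_def)
    define bs where "bs = map (\<lambda>i. Some (arity L0 R ! i, a i)) [0..<?n]"
    have ai: "a i \<in> fiber (srt M (arity L0 R ! i)) x" if "i < ?n" for i using a that by (auto simp: PiE_iff)
    have bsx: "fits x ?\<sigma> bs"
      unfolding fits_def bs_def using arity_sorts[OF R] ai by (auto simp: points_Some comp_def intro: nth_equalityI)
    have tb: "tuple_of bs = a" using a by (auto simp: tuple_of_def bs_def fun_eq_iff PiE_iff extensional_def)
    have "map (map_option fst) (map F bs) = map (map_option fst) bs"
    proof -
      have "map_option fst (F p) = map_option fst p" if "p \<in> set bs" for p using F(2) bsx that by (auto simp: fits_def)
      then show ?thesis by simp
    qed
    then have "map (map_option fst) (map F bs) = profile ?\<sigma>" using bsx by (simp only: fits_def)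
    moreover have "set (map F bs) \<subseteq> points L0 M y" using bsx F(1) by (auto simp: fits_def)
    ultimately have "fits y ?\<sigma> (map F bs)" by (simp only: fits_def)
    moreover have eqF: "map F bs = map (lift_iso f) bs" using bsx lift by (auto simp: fits_def)
    ultimately have bsy: "fits y ?\<sigma> (map (lift_iso f) bs)" by simp
    have "(\<lambda>i\<in>{..<num ?\<sigma>}. g (vertices x ?\<sigma> bs i)) = vertices y ?\<sigma> (map (lift_iso f) bs)"
    proof (rule ext)
      fix i show "(\<lambda>i\<in>{..<num ?\<sigma>}. g (vertices x ?\<sigma> bs i)) i = vertices y ?\<sigma> (map (lift_iso f) bs) i"
      proof (cases "i < ?n")
        case True
        have p: "bs ! i \<in> points L0 M x" using bsx True by (auto simp: fits_def bs_def)
        then show ?thesis using True F(3)[OF p] lift[OF p] fits_length[OF bsx] by (simp add: vertices_def)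
      qed (simp add: vertices_def)
    qed
    then have "encoded y ?\<sigma> (vertices y ?\<sigma> (map (lift_iso f) bs)) = encoded x ?\<sigma> (vertices x ?\<sigma> bs)"
      using eq[unfolded equivariant_def, rule_format, OF \<sigma> vertices_tuples[OF x \<sigma> bsx]] by simp
    then have "rel M R (y, tuple_of (map (lift_iso f) bs)) = rel M R (x, tuple_of bs)"
      by (simp only: encoded_Rel[OF x R bsx] encoded_Rel[OF y R bsy])
    then show ?thesis using tuple_of_lift[of bs x "arity L0 R" f] bsx tb by (simp add: fits_def)
  qed
  have "f \<in> fiber_isomorphisms L0 M x y"
    unfolding fiber_isomorphisms_def using FS(2) inj surj dist rel by (auto simp: f_def bij_betw_def)
  then have iso: "(x, y, f) \<in> iso_morphisms L0 X M" using x y by (simp add: iso_morphisms_def)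
  moreover have "induced (x, y, f) = g"
  proof (rule induced_unique[OF iso g])
    fix t assume t: "t \<in> Tm x"
    have "map_trm (lift_iso f) t = map_trm F t" using lift t by (intro trm.map_cong) (auto simp: Tm_def)
    then show "g (\<phi> x t) = \<phi> y (map_trm (lift_iso f) t)" using term_transfer[OF x y eq g F t] by simp
  qed
  ultimately show ?thesis by blast
qed

section \<open>Measurability of the coding\<close>

text \<open>
  The infimum in \<open>encoded\<close> may be taken over lists of sections, of which there are countably many: nearby
  points have the same sort, and the cost is continuous in the list.
\<close>
lemma section_fit:
  assumes x: "x \<in> topspace X" and \<sigma>: "\<sigma> \<in> syms" and bs: "fits x \<sigma> bs" and z: "z \<in> tuples U (num \<sigma>)" and lt: "cost x \<sigma> z bs < r"
  shows "\<exists>cs. fits x \<sigma> (map (s x) cs) \<and> cost x \<sigma> z (map (s x) cs) < r"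
proof -
  \<comment> \<open>Moving the listed points by \<open>\<eta>\<close> changes the value by at most \<open>length bs * \<eta>\<close> and the tree at place \<open>i\<close> by the factor from \<open>tdist_perturb\<close>.\<close>
  define K where "K = real (length bs) + (\<Sum>i<num \<sigma>. 3 ^ lev (places \<sigma> ! i))"
  have K: "0 \<le> K" unfolding K_def by (intro add_nonneg_nonneg sum_nonneg) auto
  define \<eta> where "\<eta> = min (1/2) ((r - cost x \<sigma> z bs) / (K + 1))"
  have "0 < (r - cost x \<sigma> z bs) / (K + 1)" using lt K by (intro divide_pos_pos) auto
  then have "0 < \<eta>" by (simp add: \<eta>_def)
  moreover have "\<eta> \<le> 1/2" unfolding \<eta>_def by (rule min.cobounded1)
  ultimately have \<eta>: "0 < \<eta>" "\<eta> \<le> 1/2" by auto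
  have K\<eta>: "K * \<eta> < r - cost x \<sigma> z bs"
  proof -
    have "K * \<eta> \<le> K * ((r - cost x \<sigma> z bs) / (K + 1))" using K by (intro mult_left_mono) (auto simp: \<eta>_def)
    also have "\<dots> < r - cost x \<sigma> z bs" using K lt by (simp add: field_simps)
    finally show ?thesis .
  qed
  have "\<forall>p\<in>points L0 M x. \<exists>c. dP p (s x c) < \<eta>" using s_dense[OF x _ \<eta>(1)] by blast
  from bchoice[OF this] obtain c where c: "\<And>p. p \<in> points L0 M x \<Longrightarrow> dP p (s x (c p)) < \<eta>" by blast
  let ?cs = "map (s x) (map c bs)"
  have pts: "set bs \<subseteq> points L0 M x" using bs by (simp add: fits_def)
  have fit: "fits x \<sigma> ?cs"
  proof -
    have "map_option fst (s x (c p)) = map_option fst p" if "p \<in> set bs" for p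
    proof -
      have "p \<in> points L0 M x" using that pts by blast
      then have "dP p (s x (c p)) < 1" using c[of p] \<eta>(2) by linarith
      then show ?thesis using pdist_sort by metis
    qed
    then have "map (map_option fst) ?cs = map (map_option fst) bs" by simp
    then show ?thesis using bs s_points[OF x] unfolding fits_def by auto
  qed
  have close: "dP (bs ! i) (?cs ! i) \<le> \<eta>" if "i < length bs" for i
    using c[of "bs ! i"] pts that by (simp add: less_imp_le subset_iff)
  have "val x \<sigma> ?cs \<le> val x \<sigma> bs + (\<Sum>i<length bs. \<eta>)"
  proof -
    have "(\<Sum>i<length bs. dP (bs ! i) (?cs ! i)) \<le> (\<Sum>i<length bs. \<eta>)" using close by (intro sum_mono) auto
    then show ?thesis using val_lipschitz[OF x \<sigma> bs fit] by linarith
  qed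
  moreover have "(\<Sum>i<num \<sigma>. dU (z i) (vertex x \<sigma> ?cs i)) \<le> (\<Sum>i<num \<sigma>. dU (z i) (vertex x \<sigma> bs i) + 3 ^ lev (places \<sigma> ! i) * \<eta>)"
  proof (rule sum_mono)
    fix i assume "i \<in> {..<num \<sigma>}"
    then have i: "i < num \<sigma>" by simp
    have "dU (vertex x \<sigma> bs i) (vertex x \<sigma> ?cs i) = dT (map_trm ((!) bs) (places \<sigma> ! i)) (map_trm ((!) ?cs) (places \<sigma> ! i))"
      by (intro \<phi>_isometric x place_Tm[OF \<sigma> bs i] place_Tm[OF \<sigma> fit i])
    also have "\<dots> \<le> 3 ^ lev (places \<sigma> ! i) * \<eta>"
    proof (rule tdist_perturb[OF pseudometric_pdist])
      fix v assume "v \<in> set_trm (places \<sigma> ! i)"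
      then have "v < length bs" using places_vars[OF \<sigma> i] fits_length[OF bs] by auto
      then show "dP (bs ! v) (?cs ! v) \<le> \<eta>" by (rule close)
    qed (use \<eta> in simp)
    finally have "dU (vertex x \<sigma> bs i) (vertex x \<sigma> ?cs i) \<le> 3 ^ lev (places \<sigma> ! i) * \<eta>" .
    moreover have "dU (z i) (vertex x \<sigma> ?cs i) \<le> dU (z i) (vertex x \<sigma> bs i) + dU (vertex x \<sigma> bs i) (vertex x \<sigma> ?cs i)"
    proof (rule mdist_triangle)
      show "z i \<in> mspace U" using z i by (auto simp: tuples_def)
    qed (use vertex_in[OF x \<sigma> bs i] vertex_in[OF x \<sigma> fit i] in auto)
    ultimately show "dU (z i) (vertex x \<sigma> ?cs i) \<le> dU (z i) (vertex x \<sigma> bs i) + 3 ^ lev (places \<sigma> ! i) * \<eta>" by linarith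
  qed
  moreover have "(\<Sum>i<length bs. \<eta>) + (\<Sum>i<num \<sigma>. 3 ^ lev (places \<sigma> ! i) * \<eta>) = K * \<eta>"
    by (simp add: K_def sum_distrib_right distrib_right)
  ultimately have "cost x \<sigma> z ?cs \<le> cost x \<sigma> z bs + K * \<eta>" unfolding cost_def sum.distrib by linarith
  then show ?thesis using K\<eta> fit by (intro exI[of _ "map c bs"]) auto
qed

lemma val_set:
  assumes \<sigma>: "\<sigma> \<in> syms"
  shows "{x \<in> topspace X. fits x \<sigma> (map (s x) cs) \<and> val x \<sigma> (map (s x) cs) < r} \<in> sets (borel_of X)"
proof -
  have fit: "fits x \<sigma> (map (s x) cs) \<longleftrightarrow> map (map_option fst) (map (s x) cs) = profile \<sigma>" if "x \<in> topspace X" for x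
    using s_points[OF that] by (auto simp: fits_def)
  show ?thesis
  proof (cases \<sigma>)
    case (Shape \<tau> ps)
    have "{x \<in> topspace X. fits x \<sigma> (map (s x) cs) \<and> val x \<sigma> (map (s x) cs) < r} =
       (if 0 < r then {x \<in> topspace X. map (map_option fst) (map (s x) cs) = ps} else {})"
      using fit Shape by auto
    then show ?thesis using profile_set[of cs ps] by (simp del: map_map)
  next
    case (Rel R)
    then have R: "R \<in> rels L0" using \<sigma> by (auto simp: syms_def)
    have "{x \<in> topspace X. fits x \<sigma> (map (s x) cs) \<and> val x \<sigma> (map (s x) cs) < r} =
       {x \<in> topspace X. map (map_option fst) (map (s x) cs) = map Some (arity L0 R) \<and> rel M R (x, tuple_of (map (s x) cs)) < r}"
      using fit Rel by auto
    then show ?thesis using relation_set[OF R] by simp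
  qed
qed

lemma measurable_encoded:
  assumes \<sigma>: "\<sigma> \<in> syms" and z: "z \<in> tuples U (num \<sigma>)"
  shows "(\<lambda>x. encoded x \<sigma> z) \<in> borel_measurable (borel_of X)"
proof (rule borel_measurableI_less)
  fix r :: real
  define h where "h = (\<lambda>cs x. \<Sum>i<num \<sigma>. dU (\<Phi> x (map_trm ((!) cs) (places \<sigma> ! i))) (z i))"
  have h[measurable]: "h cs \<in> borel_measurable (borel_of X)" for cs
    unfolding h_def using z by (intro borel_measurable_sum \<Phi>_meas) (auto simp: tuples_def)
  have cost: "cost x \<sigma> z (map (s x) cs) = val x \<sigma> (map (s x) cs) + h cs x"
    if x: "x \<in> topspace X" and fit: "fits x \<sigma> (map (s x) cs)" for x cs
  proof -
    have "vertex x \<sigma> (map (s x) cs) i = \<Phi> x (map_trm ((!) cs) (places \<sigma> ! i))" if i: "i < num \<sigma>" for i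
    proof -
      have "map_trm ((!) (map (s x) cs)) (places \<sigma> ! i) = map_trm (s x) (map_trm ((!) cs) (places \<sigma> ! i))"
        unfolding trm.map_comp using places_vars[OF \<sigma> i] fits_length[OF fit] by (intro trm.map_cong) auto
      then show ?thesis using \<phi>_section[OF x] by simp
    qed
    then show ?thesis by (simp add: cost_def h_def mdist_commute)
  qed
  define E where "E = (\<lambda>cs. {x \<in> topspace X. fits x \<sigma> (map (s x) cs) \<and> cost x \<sigma> z (map (s x) cs) < r})"
  have E: "E cs \<in> sets (borel_of X)" for cs
  proof -
    let ?G = "\<lambda>q::rat. {x \<in> topspace X. fits x \<sigma> (map (s x) cs) \<and> val x \<sigma> (map (s x) cs) < of_rat q} \<inter> {x \<in> space (borel_of X). h cs x < r - of_rat q}"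
    have "E cs = (\<Union>q. ?G q)"
    proof (intro equalityI subsetI)
      fix x assume "x \<in> E cs"
      then have x: "x \<in> topspace X" "fits x \<sigma> (map (s x) cs)" "val x \<sigma> (map (s x) cs) < r - h cs x"
        using cost by (auto simp: E_def)
      obtain q where "val x \<sigma> (map (s x) cs) < of_rat q" "of_rat q < r - h cs x" using of_rat_dense[OF x(3)] by blast
      then have "x \<in> ?G q" using x by simp
      then show "x \<in> (\<Union>q. ?G q)" by blast
    next
      fix x assume "x \<in> (\<Union>q. ?G q)"
      then obtain q where "x \<in> ?G q" by blast
      then show "x \<in> E cs" using cost[of x cs] by (simp add: E_def)
    qed
    also have "\<dots> \<in> sets (borel_of X)"
    proof (intro sets.countable_UN' countableI_type image_subsetI sets.Int val_set[OF \<sigma>])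
      show "{x \<in> space (borel_of X). h cs x < r - of_rat q} \<in> sets (borel_of X)" for q by measurable
    qed
    finally show ?thesis .
  qed
  have "{x \<in> space (borel_of X). encoded x \<sigma> z < r} = (if 1 < r then space (borel_of X) else (\<Union>cs. E cs))"
    using encoded_bounds(4)[OF _ \<sigma>, of _ z r] section_fit[OF _ \<sigma> _ z, of _ _ r] by (auto simp: E_def)
  then show "{x \<in> space (borel_of X). encoded x \<sigma> z < r} \<in> sets (borel_of X)"
    using sets.top[of "borel_of X"] sets.countable_UN'[of UNIV E "borel_of X"] E by (auto split: if_splits)
qed

section \<open>The functor\<close>

definition symbol :: "nat \<Rightarrow> ('s, 'r) sym" where
  "symbol = from_nat_into syms"

lemma symbol: "symbol n \<in> syms"
  unfolding symbol_def by (rule from_nat_into[OF syms_nonempty])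

lemma symbol_surj: "\<sigma> \<in> syms \<Longrightarrow> \<exists>n. symbol n = \<sigma>"
  unfolding symbol_def by (rule from_nat_into_surj[OF countable_syms])

definition Lang :: "(unit, nat) language" where
  "Lang = \<lparr>sorts = {()}, rels = UNIV, arity = (\<lambda>n. replicate (num (symbol n)) ())\<rparr>"

lemma Lang [simp]: "rels Lang = UNIV" "length (arity Lang n) = num (symbol n)"
  by (simp_all add: Lang_def)

lemma Lang_language: "is_language Lang" "single_sorted Lang" "countable_language Lang"
  by (auto simp: is_language_def single_sorted_def countable_language_def Lang_def)

definition F0 :: "'x \<Rightarrow> nat \<Rightarrow> (nat \<Rightarrow> 'u) \<Rightarrow> real" where
  "F0 x = (\<lambda>n. \<lambda>z\<in>tuples U (num (symbol n)). encoded x (symbol n) z)"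

definition F1 :: "'x \<times> 'x \<times> ('s \<Rightarrow> 'a \<Rightarrow> 'a) \<Rightarrow> ('u \<Rightarrow> 'u) \<times> (nat \<Rightarrow> (nat \<Rightarrow> 'u) \<Rightarrow> real)" where
  "F1 w = (induced w, F0 (fst w))"

lemma F0_Mod:
  assumes x: "x \<in> topspace X"
  shows "F0 x \<in> Mod U Lang"
proof -
  have "\<bar>encoded x (symbol n) a - encoded x (symbol n) b\<bar> \<le> min 1 (\<Sum>i<num (symbol n). dU (a i) (b i))"
    if "a \<in> tuples U (num (symbol n))" "b \<in> tuples U (num (symbol n))" for n a b
    using encoded_lipschitz[OF x symbol that] encoded_bounds(1,2)[OF x symbol, of n a] encoded_bounds(1,2)[OF x symbol, of n b] by linarith
  then show ?thesis using encoded_bounds(1,2)[OF x symbol] unfolding Mod_def F0_def by auto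
qed

text \<open>
  The definition of \<open>equivariant\<close> evaluates at \<open>g z\<close>, the logic action at the inverse image; the two
  formulations differ by a change of variables.
\<close>
lemma action_equivariant:
  assumes g: "g \<in> isometry_group U"
  shows "logic_action U Lang g (F0 x) = F0 y \<longleftrightarrow> equivariant x y g"
proof
  have g_t: "(\<lambda>i\<in>{..<n}. g (z i)) \<in> tuples U n" if "z \<in> tuples U n" for z n
    using that isometry_groupD(1)[OF g] by (auto simp: tuples_def)
  assume eq: "logic_action U Lang g (F0 x) = F0 y"
  show "equivariant x y g"
    unfolding equivariant_def
  proof (intro ballI)
    fix \<sigma> z assume \<sigma>: "\<sigma> \<in> syms" and z: "z \<in> tuples U (num \<sigma>)"
    obtain n where n: "symbol n = \<sigma>" using symbol_surj[OF \<sigma>] by blast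
    let ?w = "\<lambda>i\<in>{..<num \<sigma>}. g (z i)"
    have "(\<lambda>i\<in>{..<num \<sigma>}. inv_into (mspace U) g (?w i)) = z"
      using z inverse_isometry(3)[OF g] by (auto simp: tuples_def fun_eq_iff PiE_iff extensional_def)
    then have "logic_action U Lang g (F0 x) n ?w = encoded x \<sigma> z"
      using g_t[OF z] z n by (simp add: logic_action_def F0_def)
    moreover have "F0 y n ?w = encoded y \<sigma> ?w" using g_t[OF z] n by (simp add: F0_def)
    ultimately show "encoded y \<sigma> ?w = encoded x \<sigma> z" using eq by simp
  qed
next
  have inv_t: "(\<lambda>i\<in>{..<n}. inv_into (mspace U) g (z i)) \<in> tuples U n" if "z \<in> tuples U n" for z n
    using that inverse_isometry(1)[OF g] by (auto simp: tuples_def)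
  assume eq: "equivariant x y g"
  show "logic_action U Lang g (F0 x) = F0 y"
  proof (rule ext, rule ext)
    fix n z
    show "logic_action U Lang g (F0 x) n z = F0 y n z"
    proof (cases "z \<in> tuples U (num (symbol n))")
      case True
      let ?w = "\<lambda>i\<in>{..<num (symbol n)}. inv_into (mspace U) g (z i)"
      have "(\<lambda>i\<in>{..<num (symbol n)}. g (?w i)) = z"
        using True inverse_isometry(2)[OF g] by (auto simp: tuples_def fun_eq_iff PiE_iff extensional_def)
      then have "encoded y (symbol n) z = encoded x (symbol n) ?w"
        using eq[unfolded equivariant_def, rule_format, OF symbol inv_t[OF True]] by simp
      then show ?thesis using True inv_t[OF True] by (simp add: logic_action_def F0_def)
    next
      case False
      then show ?thesis by (simp add: logic_action_def F0_def)
    qed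
  qed
qed

lemma induced_equivariant:
  assumes f: "(x, y, f) \<in> iso_morphisms L0 X M"
  shows "equivariant x y (induced (x, y, f))"
  unfolding equivariant_def using encoded_natural[OF f] by blast

text \<open>
  A leaf is a tree, so the induced isometry determines the image of each point of the fiber in the sphere, and
  \<open>\<phi> y\<close> is injective on points because the sorts are metric spaces.
\<close>
lemma induced_faithful:
  assumes f: "(x, y, f) \<in> iso_morphisms L0 X M" and f': "(x, y, f') \<in> iso_morphisms L0 X M"
    and eq: "induced (x, y, f) = induced (x, y, f')"
  shows "f = f'"
proof -
  note xy = iso_morphismsD(1,2)[OF f]
  have *: "f P a = f' P a" if P: "P \<in> sorts L0" "a \<in> fiber (srt M P) x" for P a
  proof -
    let ?p = "Some (P, a)"
    have p: "?p \<in> points L0 M x" using P by (simp add: points_Some)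
    have q: "lift_iso f ?p \<in> points L0 M y" "lift_iso f' ?p \<in> points L0 M y" using lift_iso_points[OF _ p] f f' by blast+
    have "\<phi> y (Pt (lift_iso f ?p)) = \<phi> y (Pt (lift_iso f' ?p))"
      using induced(2)[OF f, of "Pt ?p"] induced(2)[OF f', of "Pt ?p"] eq p by (simp add: Pt_Tm)
    then have "dT (Pt (lift_iso f ?p)) (Pt (lift_iso f' ?p)) = 0"
      using \<phi>_isometric[OF xy(2), of "Pt (lift_iso f ?p)" "Pt (lift_iso f' ?p)"] q mdist_self[OF \<phi>(1)[OF xy(2)]]
      by (simp only: Pt_Tm)
    then have "dP (lift_iso f ?p) (lift_iso f' ?p) = 0" using tdist_Pt[OF pseudometric_pdist] by simp
    then show ?thesis using pdist_zero_iff[OF q] by simp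
  qed
  have e: "f \<in> (\<Pi>\<^sub>E P \<in> sorts L0. fiber (srt M P) x \<rightarrow>\<^sub>E fiber (srt M P) y)" "f' \<in> (\<Pi>\<^sub>E P \<in> sorts L0. fiber (srt M P) x \<rightarrow>\<^sub>E fiber (srt M P) y)"
    using iso_morphismsD(3)[OF f] iso_morphismsD(3)[OF f'] by (auto simp: fiber_isomorphisms_def)
  show ?thesis
  proof (rule PiE_ext[OF e])
    fix P assume P: "P \<in> sorts L0"
    show "f P = f' P" by (rule PiE_ext[OF PiE_mem[OF e(1) P] PiE_mem[OF e(2) P]]) (rule *[OF P])
  qed
qed

lemma induced_id:
  assumes x: "x \<in> topspace X"
  shows "induced (x, x, \<lambda>P \<in> sorts L0. \<lambda>a \<in> fiber (srt M P) x. a) = (\<lambda>a\<in>mspace U. a)"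
proof (rule induced_unique[OF identity_morphism[OF x] isometry_group_id])
  fix t assume t: "t \<in> Tm x"
  have "lift_iso (\<lambda>P \<in> sorts L0. \<lambda>a \<in> fiber (srt M P) x. a) p = id p" if "p \<in> points L0 M x" for p
    using that by (auto simp: points_def)
  then have "map_trm (lift_iso (\<lambda>P \<in> sorts L0. \<lambda>a \<in> fiber (srt M P) x. a)) t = map_trm id t"
    using t by (intro trm.map_cong) (auto simp: Tm_def)
  then show "(\<lambda>a\<in>mspace U. a) (\<phi> x t) = \<phi> x (map_trm (lift_iso (\<lambda>P \<in> sorts L0. \<lambda>a \<in> fiber (srt M P) x. a)) t)"
    using \<phi>(1)[OF x t] by (simp add: trm.map_id)
qed

lemma induced_compose:
  assumes f: "(x, y, f) \<in> iso_morphisms L0 X M" and g: "(y, z, g) \<in> iso_morphisms L0 X M"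
  shows "induced (x, z, \<lambda>P \<in> sorts L0. compose (fiber (srt M P) x) (g P) (f P)) = compose (mspace U) (induced (y, z, g)) (induced (x, y, f))"
proof (rule induced_unique)
  let ?h = "\<lambda>P \<in> sorts L0. compose (fiber (srt M P) x) (g P) (f P)"
  show "(x, z, ?h) \<in> iso_morphisms L0 X M"
    using fiber_isomorphisms_compose[OF is_lang iso_morphismsD(3)[OF f] iso_morphismsD(3)[OF g]] iso_morphismsD(1)[OF f] iso_morphismsD(2)[OF g]
    unfolding iso_morphisms_def by blast
  show "compose (mspace U) (induced (y, z, g)) (induced (x, y, f)) \<in> isometry_group U"
    by (rule isometry_group_compose[OF induced(1)[OF f] induced(1)[OF g]])
  fix t assume t: "t \<in> Tm x"
  have "lift_iso ?h p = (lift_iso g \<circ> lift_iso f) p" if "p \<in> points L0 M x" for p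
    using that by (auto simp: points_def compose_eq)
  then have "map_trm (lift_iso ?h) t = map_trm (lift_iso g) (map_trm (lift_iso f) t)"
    unfolding trm.map_comp using t by (intro trm.map_cong) (auto simp: Tm_def)
  then show "compose (mspace U) (induced (y, z, g)) (induced (x, y, f)) (\<phi> x t) = \<phi> z (map_trm (lift_iso ?h) t)"
    using \<phi>(1)[OF iso_morphismsD(1)[OF f] t] induced(2)[OF f t] induced(2)[OF g lift_Tm[OF f t]] by (simp add: compose_eq)
qed

lemma measurable_F0: "F0 \<in> measurable (borel_of X) (borel_of (Mod_topology U Lang))"
proof -
  obtain D :: "nat \<Rightarrow> 'u" where D: "\<And>n. D n \<in> mspace U" "\<And>z e. z \<in> mspace U \<Longrightarrow> 0 < e \<Longrightarrow> \<exists>n. mdist U z (D n) < e"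
    using urysohn_dense_sequence[OF U] by blast
  let ?E = "{\<lambda>N :: nat \<Rightarrow> (nat \<Rightarrow> 'u) \<Rightarrow> real. N R (dense_tuple D js) | R js. R \<in> rels Lang \<and> length js = length (arity Lang R)}"
  show ?thesis
  proof (rule measurable_borel_of_controls[OF controls_Mod_topology[of D U Lang, OF D]])
    have "?E \<subseteq> (\<lambda>(R, js) N. N R (dense_tuple D js)) ` UNIV" by auto
    then show "countable ?E" by (rule countable_subset) auto
    show "F0 \<in> space (borel_of X) \<rightarrow> topspace (Mod_topology U Lang)" using F0_Mod by auto
    fix e assume "e \<in> ?E"
    then obtain R js where e: "e = (\<lambda>N. N R (dense_tuple D js))" "length js = num (symbol R)" by auto
    have t: "dense_tuple D js \<in> tuples U (num (symbol R))" using e(2) D(1) by (auto simp: dense_tuple_def tuples_def)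
    show "(\<lambda>w. e (F0 w)) \<in> borel_measurable (borel_of X)"
      using measurable_encoded[OF symbol t] t by (simp add: e(1) F0_def)
  qed
qed

lemma F1_in: "F1 \<in> iso_morphisms L0 X M \<rightarrow> isometry_group U \<times> Mod U Lang"
proof
  fix w assume w: "w \<in> iso_morphisms L0 X M"
  obtain x y f where w': "w = (x, y, f)" by (cases w)
  show "F1 w \<in> isometry_group U \<times> Mod U Lang"
    using induced(1)[of x y f] F0_Mod[of x] iso_morphismsD(1)[of x y f L0 X M] w w' by (simp add: F1_def)
qed

lemma measurable_F1: "F1 \<in> measurable MX (borel_of (prod_topology (isometry_group_topology U) (Mod_topology U Lang)))"
proof -
  obtain D :: "nat \<Rightarrow> 'u" where D: "\<And>n. D n \<in> mspace U" "\<And>z e. z \<in> mspace U \<Longrightarrow> 0 < e \<Longrightarrow> \<exists>n. mdist U z (D n) < e"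
    using urysohn_dense_sequence[OF U] by blast
  let ?E = "{\<lambda>g. dU (g (D i)) (D j) | i j. True}"
  let ?E' = "{\<lambda>N :: nat \<Rightarrow> (nat \<Rightarrow> 'u) \<Rightarrow> real. N R (dense_tuple D js) | R js. R \<in> rels Lang \<and> length js = length (arity Lang R)}"
  show ?thesis
  proof (rule measurable_borel_of_controls[OF controls_prod_topology[OF controls_isometry_group[of D U, OF D] controls_Mod_topology[of D U Lang, OF D]]])
    have "?E \<subseteq> (\<lambda>(i, j) g. dU (g (D i)) (D j)) ` UNIV" by auto
    then have "countable ?E" by (rule countable_subset) auto
    moreover have "?E' \<subseteq> (\<lambda>(R, js) N. N R (dense_tuple D js)) ` UNIV" by auto
    then have "countable ?E'" by (rule countable_subset) auto
    ultimately show "countable ((\<lambda>e. e \<circ> fst) ` ?E \<union> (\<lambda>e. e \<circ> snd) ` ?E')" by (intro countable_Un countable_image)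
    show "F1 \<in> space MX \<rightarrow> topspace (prod_topology (isometry_group_topology U) (Mod_topology U Lang))"
      using F1_in by simp
    fix e assume "e \<in> (\<lambda>e. e \<circ> fst) ` ?E \<union> (\<lambda>e. e \<circ> snd) ` ?E'"
    then consider i j where "e = (\<lambda>g. dU (g (D i)) (D j)) \<circ> fst"
      | R js where "e = (\<lambda>N. N R (dense_tuple D js)) \<circ> snd" "length js = num (symbol R)" by auto
    then show "(\<lambda>w. e (F1 w)) \<in> borel_measurable MX"
    proof cases
      case 1
      then show ?thesis using measurable_induced[OF D(1)[of i] D(1)[of j]] by (simp add: F1_def)
    next
      case 2
      have t: "dense_tuple D js \<in> tuples U (num (symbol R))" using 2(2) D(1) by (auto simp: dense_tuple_def tuples_def)
      have "(\<lambda>w. encoded ((\<lambda>(x, y, f). x) w) (symbol R) (dense_tuple D js)) \<in> borel_measurable MX"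
        by (rule measurable_compose[OF measurable_iso_source measurable_encoded[OF symbol t]])
      then show ?thesis using 2 t by (simp add: F1_def F0_def split_def)
    qed
  qed
qed

lemma functor_F: "is_functor (iso_groupoid L0 X M) (action_groupoid U Lang) F0 F1"
  unfolding is_functor_def
proof (intro conjI ballI impI)
  let ?G = "iso_groupoid L0 X M" and ?H = "action_groupoid U Lang"
  have sp: "space (ob ?G) = topspace X" "space (mor ?G) = iso_morphisms L0 X M"
    "space (ob ?H) = Mod U Lang" "space (mor ?H) = isometry_group U \<times> Mod U Lang"
    by (simp_all add: iso_groupoid_def action_groupoid_def)
  show "F0 \<in> space (ob ?G) \<rightarrow> space (ob ?H)" unfolding sp using F0_Mod by blast
  show "F1 \<in> space (mor ?G) \<rightarrow> space (mor ?H)" unfolding sp by (rule F1_in)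
  show "F1 (idt ?G x) = idt ?H (F0 x)" if "x \<in> space (ob ?G)" for x
    using induced_id that by (simp add: sp F1_def iso_groupoid_def action_groupoid_def)
  fix w assume w: "w \<in> space (mor ?G)"
  obtain x y f where w': "w = (x, y, f)" by (cases w)
  have f: "(x, y, f) \<in> iso_morphisms L0 X M" using w w' sp by simp
  show "src ?H (F1 w) = F0 (src ?G w)" by (simp add: F1_def w' iso_groupoid_def action_groupoid_def)
  show "tgt ?H (F1 w) = F0 (tgt ?G w)"
    using action_equivariant[OF induced(1)[OF f]] induced_equivariant[OF f] by (simp add: F1_def w' iso_groupoid_def action_groupoid_def)
  fix v assume v: "v \<in> space (mor ?G)" "src ?G v = tgt ?G w"
  obtain z g where v': "v = (y, z, g)" using v(2) w' by (cases v) (auto simp: iso_groupoid_def)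
  have g: "(y, z, g) \<in> iso_morphisms L0 X M" using v v' sp by simp
  show "F1 (cmp ?G v w) = cmp ?H (F1 v) (F1 w)"
    using induced_compose[OF f g] by (simp add: F1_def w' v' iso_groupoid_def action_groupoid_def)
qed

lemma full_F: "full_functor (iso_groupoid L0 X M) (action_groupoid U Lang) F0 F1"
  unfolding full_functor_def
proof (intro ballI equalityI subsetI)
  let ?G = "iso_groupoid L0 X M" and ?H = "action_groupoid U Lang"
  fix x y assume "x \<in> space (ob ?G)" "y \<in> space (ob ?G)"
  then have xy: "x \<in> topspace X" "y \<in> topspace X" by (simp_all add: iso_groupoid_def)
  {
    fix v assume "v \<in> F1 ` hom_set ?G x y"
    then obtain f where f: "(x, y, f) \<in> iso_morphisms L0 X M" "v = F1 (x, y, f)" by (auto simp: hom_set_def iso_groupoid_def)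
    then show "v \<in> hom_set ?H (F0 x) (F0 y)"
      using induced(1)[OF f(1)] F0_Mod[OF xy(1)] action_equivariant[OF induced(1)[OF f(1)]] induced_equivariant[OF f(1)]
      by (simp add: hom_set_def action_groupoid_def F1_def)
  next
    fix v assume v: "v \<in> hom_set ?H (F0 x) (F0 y)"
    then obtain g where g: "v = (g, F0 x)" "g \<in> isometry_group U" "logic_action U Lang g (F0 x) = F0 y"
      by (auto simp: hom_set_def action_groupoid_def)
    then obtain f where f: "(x, y, f) \<in> iso_morphisms L0 X M" "induced (x, y, f) = g"
      using equivariant_comes_from_isomorphism[OF xy g(2)] action_equivariant[OF g(2)] by blast
    then have "v = F1 (x, y, f)" "(x, y, f) \<in> hom_set ?G x y" using g(1) by (auto simp: F1_def hom_set_def iso_groupoid_def)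
    then show "v \<in> F1 ` hom_set ?G x y" by blast
  }
qed

lemma faithful_F: "faithful_functor (iso_groupoid L0 X M) (action_groupoid U Lang) F0 F1"
  unfolding faithful_functor_def
proof (intro ballI inj_onI)
  fix x y v w
  assume "v \<in> hom_set (iso_groupoid L0 X M) x y" "w \<in> hom_set (iso_groupoid L0 X M) x y" and eq: "F1 v = F1 w"
  then have vw: "v \<in> iso_morphisms L0 X M" "fst v = x" "fst (snd v) = y" "w \<in> iso_morphisms L0 X M" "fst w = x" "fst (snd w) = y"
    by (simp_all add: hom_set_def iso_groupoid_def split_def)
  define f f' where "f = snd (snd v)" and "f' = snd (snd w)"
  have v: "v = (x, y, f)" and w: "w = (x, y, f')" using vw by (simp_all add: f_def f'_def prod_eq_iff)
  have "f = f'" using vw(1,4) eq unfolding v w by (intro induced_faithful[of x y f f']) (simp_all add: F1_def)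
  then show "v = w" by (simp add: v w)
qed

end

lemma urysohn_model_exists:
  assumes "etale_sections L0 X M s \<kappa> B" and U: "urysohn_sphere U"
  shows "\<exists>\<Phi>. urysohn_model L0 X M s \<kappa> B U \<Phi>"
proof -
  interpret etale_sections L0 X M s \<kappa> B by fact
  define \<delta> where "\<delta> = (\<lambda>x. tdist (\<lambda>i j. dP (s x i) (s x j)))"
  have pm: "pseudometric_on UNIV (\<lambda>i j. dP (s x i) (s x j))" for x
    using pseudometric_pdist unfolding pseudometric_on_def by blast
  obtain \<Phi> where \<Phi>: "\<And>x \<tau>. x \<in> space (borel_of X) \<Longrightarrow> \<Phi> x \<tau> \<in> mspace U"
    "\<And>x \<tau> \<sigma>. x \<in> space (borel_of X) \<Longrightarrow> mdist U (\<Phi> x \<tau>) (\<Phi> x \<sigma>) = \<delta> x \<tau> \<sigma>"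
    "\<And>x z e. x \<in> space (borel_of X) \<Longrightarrow> z \<in> mspace U \<Longrightarrow> 0 < e \<Longrightarrow> \<exists>\<tau>. mdist U (\<Phi> x \<tau>) z < e"
    "\<And>\<tau> z. z \<in> mspace U \<Longrightarrow> (\<lambda>x. mdist U (\<Phi> x \<tau>) z) \<in> borel_measurable (borel_of X)"
  proof (rule uniform_back_and_forth[OF U, of "borel_of X" \<delta>])
    show "pseudometric_on UNIV (\<delta> x)" "approx_ext (\<delta> x)" for x
      unfolding \<delta>_def by (intro pseudometric_on_tdist approx_ext_tdist pm)+
    show "(\<lambda>x. \<delta> x \<tau> \<sigma>) \<in> borel_measurable (borel_of X)" for \<tau> \<sigma>
      unfolding \<delta>_def by (intro measurable_tdist measurable_section_distance)
    fix \<Phi> assume H: "\<And>x \<tau>. x \<in> space (borel_of X) \<Longrightarrow> \<Phi> x \<tau> \<in> mspace U"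
      "\<And>x \<tau> \<sigma>. x \<in> space (borel_of X) \<Longrightarrow> mdist U (\<Phi> x \<tau>) (\<Phi> x \<sigma>) = \<delta> x \<tau> \<sigma>"
      "\<And>x z e. x \<in> space (borel_of X) \<Longrightarrow> z \<in> mspace U \<Longrightarrow> 0 < e \<Longrightarrow> \<exists>\<tau>. mdist U (\<Phi> x \<tau>) z < e"
      "\<And>\<tau> z. z \<in> mspace U \<Longrightarrow> (\<lambda>x. mdist U (\<Phi> x \<tau>) z) \<in> borel_measurable (borel_of X)"
    show thesis by (rule that[OF H])
  qed
  have \<delta>: "\<delta> x \<tau> \<sigma> = tdist dP (map_trm (s x) \<tau>) (map_trm (s x) \<sigma>)" for x \<tau> \<sigma>
    unfolding \<delta>_def by (rule tdist_map_trm[of UNIV, symmetric]) auto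
  have "urysohn_model L0 X M s \<kappa> B U \<Phi>"
    by unfold_locales (use U \<Phi> \<delta> in auto)
  then show ?thesis by blast
qed

theorem theorem1p9:
  fixes X :: "'x topology"
    and L0 :: "('s, 'r) language"
    and M :: "('s, 'r, 'x, 'a) etale_structure"
    and \<U> :: "'u metric"
  assumes "quasi_polish X"
    and "metric_etale_structure L0 X M"
    and "second_countable_structure L0 X M"
    and "urysohn_sphere \<U>"
  shows "\<exists>(L :: (unit, nat) language) F0 F1.
           is_language L \<and> single_sorted L \<and> countable_language L \<and>
           borel_functor (iso_groupoid L0 X M) (action_groupoid \<U> L) F0 F1 \<and>
           full_functor (iso_groupoid L0 X M) (action_groupoid \<U> L) F0 F1 \<and>
           faithful_functor (iso_groupoid L0 X M) (action_groupoid \<U> L) F0 F1"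
proof -
  have "etale L0 X M" using assms by unfold_locales
  then obtain s \<kappa> B where "etale_sections L0 X M s \<kappa> B" using etale.etale_sections_exist by blast
  then obtain \<Phi> where "urysohn_model L0 X M s \<kappa> B \<U> \<Phi>" using urysohn_model_exists[OF _ assms(4)] by blast
  then interpret urysohn_model L0 X M s \<kappa> B \<U> \<Phi> .
  have "borel_functor (iso_groupoid L0 X M) (action_groupoid \<U> Lang) F0 F1"
    using functor_F measurable_F0 measurable_F1 by (simp add: borel_functor_def iso_groupoid_def action_groupoid_def)
  then show ?thesis using Lang_language full_F faithful_F by blast
qed

end
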